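(* Let $n\ge2$, let $\omega(k)=\sum_{j=2}^n\omega_jk^j$ be a polynomial with real coefficients and $\omega_n\ne0$. Assume $q_o\in L^2(\mathbb R)$ and that there exist $c_0=-\infty<c_1<c_2<\dots<c_N<c_{N+1}=\infty$ such that for each $i=0,1,\dots,N$ the restriction $q_o|_{(c_i,c_{i+1})}$ has one derivative in $L^2((c_i,c_{i+1}))$. Let $q(x,t)=\frac1{2\pi}\int_{\mathbb R}e^{ikx-i\omega(k)t}\hat q_o(k)\,dk$. If $1\le i\le N$ and $[q_o(c_i)]:=q_o(c_i^+)-q_o(c_i^-)\neq0$, then there exists a constant $q_{c_i}$ such that $$\lim_{t\downarrow0}\frac{q\big(c_i+x|\omega_nt|^{1/n},t\big)-q_{c_i}}{[q_o(c_i)]}=I_{\varpi,0}(x,1),\qquad \varpi(k)=e^{i\arg(\omega_n)}k^n,$$ uniformly for $x$ in any bounded set.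
   Context: The Fourier transform is $\hat q_o(k)=\int_{\mathbb R}e^{-ikx}q_o(x)\,dx$; $q$ is the $L^2$ solution of $iq_t-\omega(-i\partial_x)q=0$ with $q(x,0)=q_o(x)$, and for $t>0$ one takes the continuous representative of $q(\cdot,t)$. Here $q_o(c^\pm)$ denote one-sided limits. For a polynomial $\varpi$, $$I_{\varpi,0}(y,t)=\frac1{2\pi}\int_Ce^{iky-i\varpi(k)t}\frac{dk}{ik}$$ (improper integral at $\pm\infty$), where $C$ is the contour running from $-\infty$ to $+\infty$ along the real axis except that it avoids $k=0$ by a small semicircle (radius less than 1) in the upper half-plane. *)

theory Defs
  imports "HOL-Complex_Analysis.Complex_Analysis" "HOL-Computational_Algebra.Polynomial"
begin

definition square_integrable_on :: "(real \<Rightarrow> complex) \<Rightarrow> real set \<Rightarrow> bool" where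
  "square_integrable_on f S \<longleftrightarrow>
     set_borel_measurable lborel S f \<and> set_integrable lborel S (\<lambda>x. (cmod (f x))\<^sup>2)"

text \<open>
  Elements of \<open>L\<^sup>2\<close> are represented by Borel functions; every notion below depends on such a
  function only up to equality almost everywhere. Convergence in \<open>L\<^sup>2\<close> is expressed through the
  nonnegative integral, so that it cannot hold by the convention that the integral of a
  non-integrable function is zero.
\<close>

definition L2_tendsto :: "(real \<Rightarrow> real \<Rightarrow> complex) \<Rightarrow> (real \<Rightarrow> complex) \<Rightarrow> bool" where
  "L2_tendsto F f \<longleftrightarrow>
     ((\<lambda>R. \<integral>\<^sup>+x. ennreal ((cmod (F R x - f x))\<^sup>2) \<partial>lborel) \<longlongrightarrow> 0) at_top"

text \<open>
  The Fourier transform on \<open>L\<^sup>2(\<real>)\<close> in the sense of Plancherel: the integral over the line is the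
  \<open>L\<^sup>2\<close>-limit of the integrals over \<open>[-R, R]\<close>. The limit is unique up to null sets, and
  \<open>SOME\<close> picks a representative.
\<close>

definition fourier_L2 :: "(real \<Rightarrow> complex) \<Rightarrow> real \<Rightarrow> complex" where
  "fourier_L2 f = (SOME F. square_integrable_on F UNIV \<and>
     L2_tendsto (\<lambda>R k. LINT x:{-R..R}|lborel. exp (- \<i> * of_real k * of_real x) * f x) F)"

definition is_inverse_fourier_L2 :: "(real \<Rightarrow> complex) \<Rightarrow> (real \<Rightarrow> complex) \<Rightarrow> bool" where
  "is_inverse_fourier_L2 G u \<longleftrightarrow> square_integrable_on u UNIV \<and>
     L2_tendsto (\<lambda>R x. 1 / (2 * of_real pi) *
       (LINT k:{-R..R}|lborel. exp (\<i> * of_real k * of_real x) * G k)) u"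

text \<open>
  \<open>dispersive_solution w q0 t\<close> is, for \<open>t > 0\<close>, the continuous representative of the \<open>L\<^sup>2\<close> solution
  at time \<open>t\<close> of \<open>i q\<^sub>t - w(-i \<partial>\<^sub>x) q = 0\<close> with initial datum \<open>q0\<close>.
\<close>

definition dispersive_solution ::
    "(real \<Rightarrow> real) \<Rightarrow> (real \<Rightarrow> complex) \<Rightarrow> real \<Rightarrow> real \<Rightarrow> complex" where
  "dispersive_solution w q0 t = (THE u. continuous_on UNIV u \<and>
     is_inverse_fourier_L2 (\<lambda>k. exp (- \<i> * of_real (w k) * of_real t) * fourier_L2 q0 k) u)"

text \<open>
  Weak derivatives on an open set \<open>S\<close>. As usual in one dimension, the (real) test functions are
  the continuously differentiable functions with compact support in \<open>S\<close>.
\<close>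

definition has_weak_derivative_on ::
    "(real \<Rightarrow> complex) \<Rightarrow> (real \<Rightarrow> complex) \<Rightarrow> real set \<Rightarrow> bool" where
  "has_weak_derivative_on f g S \<longleftrightarrow>
     (\<forall>\<phi> \<phi>' :: real \<Rightarrow> real.
        (\<forall>x. (\<phi> has_real_derivative \<phi>' x) (at x)) \<and> continuous_on UNIV \<phi>' \<and>
        (\<exists>K. compact K \<and> K \<subseteq> S \<and> (\<forall>x. x \<notin> K \<longrightarrow> \<phi> x = 0)) \<longrightarrow>
        (LINT x:S|lborel. f x * of_real (\<phi>' x)) = - (LINT x:S|lborel. g x * of_real (\<phi> x)))"

definition has_L2_derivative_on :: "(real \<Rightarrow> complex) \<Rightarrow> real set \<Rightarrow> bool" where
  "has_L2_derivative_on f S \<longleftrightarrow>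
     (\<exists>g. square_integrable_on g S \<and> has_weak_derivative_on f g S)"

text \<open>
  One-sided limits that ignore null sets, as befits an element of \<open>L\<^sup>2\<close>: these are the one-sided
  limits of a continuous representative, and they agree with the pointwise ones when those exist.
\<close>

definition right_limit :: "(real \<Rightarrow> complex) \<Rightarrow> real \<Rightarrow> complex" where
  "right_limit f c = Lim (inf (at_right c) (ae_filter lborel)) f"

definition left_limit :: "(real \<Rightarrow> complex) \<Rightarrow> real \<Rightarrow> complex" where
  "left_limit f c = Lim (inf (at_left c) (ae_filter lborel)) f"

definition jump :: "(real \<Rightarrow> complex) \<Rightarrow> real \<Rightarrow> complex" where
  "jump f c = right_limit f c - left_limit f c"

definition indented_path :: "real \<Rightarrow> real \<Rightarrow> real \<Rightarrow> real \<Rightarrow> complex" where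
  "indented_path r A B =
     linepath (of_real (- A)) (of_real (- r)) +++ part_circlepath 0 r pi 0 +++
     linepath (of_real r) (of_real B)"

text \<open>
  \<open>I_zero r p y t\<close> is \<open>I\<^bsub>p,0\<^esub>(y,t)\<close>, computed along the contour whose semicircle has radius \<open>r\<close>.
  Both ends of the contour tend to infinity independently.
\<close>

definition I_zero :: "real \<Rightarrow> complex poly \<Rightarrow> real \<Rightarrow> real \<Rightarrow> complex" where
  "I_zero r p y t = 1 / (2 * of_real pi) *
     Lim (at_top \<times>\<^sub>F at_top) (\<lambda>(A, B). contour_integral (indented_path r A B)
       (\<lambda>k. exp (\<i> * k * of_real y - \<i> * poly p k * of_real t) / (\<i> * k)))"

end

theory Submission
  imports Defs "HOL-Probability.Probability"
begin

text \<open>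
  Integrating by parts on each piece gives
  \<open>\<i> k F(k) = (\<Sum>j. J\<^sub>j * exp (- \<i> k c\<^sub>j)) + G(k)\<close> for the Fourier transform \<open>F\<close> of the datum, with
  \<open>J\<^sub>j\<close> the jumps and \<open>G\<close> the transform of the \<open>L\<^sup>2\<close> derivative. So \<open>F\<close> is an integrable function plus
  the terms \<open>J\<^sub>j * exp (- \<i> k c\<^sub>j) / (\<i> k)\<close> on \<open>|k| > 1\<close>. The integrable part contributes a function that is
  continuous up to \<open>t = 0\<close>. The \<open>j\<close>-th jump term contributes the oscillatory integral of
  \<open>exp (\<i> k (x - c\<^sub>j) - \<i> \<omega>(k) t) / (\<i> k)\<close> over \<open>|k| > 1\<close>, whose tail is bounded uniformly in \<open>x\<close> by van der
  Corput's lemma for the \<open>n\<close>-th derivative of the phase. For \<open>j \<noteq> i\<close> it converges to its value at \<open>t = 0\<close>; for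
  \<open>j = i\<close> the substitution \<open>k = \<kappa> / |\<omega>\<^sub>n t|\<^bsup>1/n\<^esup>\<close> turns it, up to \<open>O(|\<omega>\<^sub>n t|\<^bsup>1/n\<^esup>)\<close>, into the principal value
  integral of \<open>exp (\<i> \<kappa> y - \<i> \<varpi>(\<kappa>)) / (\<i> \<kappa>)\<close>. The latter differs from the contour integral by the half
  residue \<open>pi\<close>, which is absorbed into \<open>q\<^sub>c\<close>. The constant \<open>q\<^sub>c\<close> only has to exist, so the inversion
  theorem is not needed, and an inequality suffices in place of the Plancherel identity.
\<close>

section \<open>A Plancherel inequality\<close>

text \<open>Two scales compete. Van der Corput controls a jump term, uniformly in the position, only
  beyond |k| = K / s with s = |\<open>\<omega> n * t\<close>|^(1/n), so a range of growing length
  remains. At the jump itself that range is harmless: dk / k is scale invariant and pairing k with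
  -k tames the pole, so in the variable s * k the comparison lives between s and K with a bound that
  does not degenerate as s tends to 0. At another node the rescaled offset blows up, and the crude
  estimate |exp (i a) - exp (i b)| <= |a - b| gives only O(1) up to K / s; the missing factor s
  comes from integrating by parts against exp (i k d), where d is the non-zero distance to that
  node. A second obstacle is that the transforms are L2 limits while the claim is pointwise. Fatou's
  lemma bridges this: if the symmetric truncations converge almost everywhere along a sequence, the
  pointwise limit is the L2 limit, and continuity singles out one representative.\<close>

lemma fourier_gaussian:
  fixes z \<sigma> :: real
  assumes "0 < \<sigma>"
  shows "(LINT k|lborel. exp (\<i> * of_real (k * z)) * of_real (exp (- (k / \<sigma>)\<^sup>2 / 2))) =
    of_real (\<sigma> * sqrt (2 * pi) * exp (- (\<sigma> * z)\<^sup>2 / 2))"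
proof -
  \<comment> \<open>The claim is the characteristic function of the standard normal law at
    \<open>\<sigma> * z\<close>, after substituting \<open>x = k / \<sigma>\<close>.\<close>
  have "of_real (exp (- (\<sigma> * z)\<^sup>2 / 2)) = char std_normal_distribution (\<sigma> * z)"
    by (simp add: char_std_normal_distribution)
  also have "\<dots> = (LINT x|lborel. std_normal_density x *\<^sub>R exp (\<i> * of_real (\<sigma> * z * x)))"
    unfolding char_def by (subst integral_density) (auto simp: mult_ac)
  also have "\<dots> = \<bar>1 / \<sigma>\<bar> *\<^sub>R (LINT x|lborel. std_normal_density (0 + (1 / \<sigma>) * x) *\<^sub>R
      exp (\<i> * of_real (\<sigma> * z * (0 + (1 / \<sigma>) * x))))"
    by (subst lborel_integral_real_affine[where c = "1 / \<sigma>" and t = 0]) (use assms in auto)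
  also have "(\<lambda>x. std_normal_density (0 + (1 / \<sigma>) * x) *\<^sub>R
      exp (\<i> * of_real (\<sigma> * z * (0 + (1 / \<sigma>) * x)))) =
    (\<lambda>k. (1 / sqrt (2 * pi)) *\<^sub>R (exp (\<i> * of_real (k * z)) * of_real (exp (- (k / \<sigma>)\<^sup>2 / 2))))"
    using assms by (auto simp: std_normal_density_def scaleR_conv_of_real mult_ac)
  finally show ?thesis
    using assms by (simp add: scaleR_conv_of_real field_simps flip: of_real_mult)
qed

lemma integrable_gaussian:
  fixes \<sigma> :: real
  assumes "0 < \<sigma>"
  shows "integrable lborel (\<lambda>k. exp (- (k / \<sigma>)\<^sup>2 / 2))"
proof -
  have "(\<lambda>k. exp (- (k / \<sigma>)\<^sup>2 / 2)) = (\<lambda>k. sqrt (2 * pi * \<sigma>\<^sup>2) * normal_density 0 \<sigma> k)"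
    using assms by (auto simp: normal_density_def power_divide)
  moreover have "integrable lborel (\<lambda>k. sqrt (2 * pi * \<sigma>\<^sup>2) * normal_density 0 \<sigma> k)"
    using assms by (intro integrable_mult_right integrable_normal_density)
  ultimately show ?thesis by simp
qed

text \<open>The transform of the Gaussian weight is \<open>2 * pi\<close> times a normal density
  with mean \<open>y\<close> and standard deviation \<open>1 / \<sigma>\<close>. Its mass does not
  depend on \<open>\<sigma>\<close>, which makes the weighted bound uniform in the weight.\<close>

lemma integral_gaussian_shift:
  fixes \<sigma> y :: real
  assumes "0 < \<sigma>"
  shows "integrable lborel (\<lambda>x. \<sigma> * sqrt (2 * pi) * exp (- (\<sigma> * (x - y))\<^sup>2 / 2))" (is ?A)
    and "(LINT x|lborel. \<sigma> * sqrt (2 * pi) * exp (- (\<sigma> * (x - y))\<^sup>2 / 2)) = 2 * pi" (is ?B)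
proof -
  have "(\<lambda>x. \<sigma> * sqrt (2 * pi) * exp (- (\<sigma> * (x - y))\<^sup>2 / 2)) = (\<lambda>x. 2 * pi * normal_density y (1 / \<sigma>) x)"
  proof
    fix x
    have "sqrt (2 * pi) * sqrt (2 * pi) = 2 * pi" by simp
    hence "\<sigma> * sqrt (2 * pi) = 2 * pi * \<sigma> / sqrt (2 * pi)" by (simp add: field_simps)
    thus "\<sigma> * sqrt (2 * pi) * exp (- (\<sigma> * (x - y))\<^sup>2 / 2) = 2 * pi * normal_density y (1 / \<sigma>) x"
      using assms by (simp add: normal_density_def power_divide power_mult_distrib real_sqrt_divide mult_ac)
  qed
  thus ?A ?B using assms by simp_all
qed

text \<open>
  Weighting \<open>|F|\<^sup>2\<close> with a Gaussian and integrating by Fubini gives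
  \<open>\<integral>\<integral> f x * cnj (f y) * g (x - y)\<close> with a Gaussian \<open>g\<close> of total mass \<open>2 * pi\<close>, and
  \<open>|f x * f y| \<le> (|f x|\<^sup>2 + |f y|\<^sup>2) / 2\<close>. Then the weight is removed by Fatou's lemma.
\<close>

lemma plancherel_gaussian:
  fixes f :: "real \<Rightarrow> complex" and s :: real
  assumes f: "integrable lborel f" and f2: "integrable lborel (\<lambda>x. (cmod (f x))\<^sup>2)"
    and s: "\<bar>s\<bar> = 1" and \<sigma>: "0 < \<sigma>"
  defines "F \<equiv> \<lambda>k. LINT x|lborel. exp (\<i> * of_real (k * (s * x))) * f x"
  shows "(\<integral>\<^sup>+k. ennreal ((cmod (F k))\<^sup>2 * exp (- (k / \<sigma>)\<^sup>2 / 2)) \<partial>lborel) \<le>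
         ennreal (2 * pi * (LINT x|lborel. (cmod (f x))\<^sup>2))"
proof -
  note [measurable] = borel_measurable_integrable[OF f]
  define w where "w = (\<lambda>k::real. exp (- (k / \<sigma>)\<^sup>2 / 2))"
  define G where "G = (\<lambda>z::real. \<sigma> * sqrt (2 * pi) * exp (- (\<sigma> * z)\<^sup>2 / 2))"
  have wm[measurable]: "w \<in> borel_measurable borel" unfolding w_def by measurable
  have Gm[measurable]: "G \<in> borel_measurable borel" unfolding G_def by measurable
  have G0: "0 \<le> G z" for z using \<sigma> by (auto simp: G_def)
  have w0: "0 \<le> w z" for z by (auto simp: w_def)
  have wi: "integrable lborel w" unfolding w_def by (rule integrable_gaussian[OF \<sigma>])
  \<comment> \<open>\<open>h p * e k p\<close> is the integrand of \<open>F k * cnj (F k)\<close>,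
    written as a double integral over \<open>p = (x, y)\<close>.\<close>
  define e where "e = (\<lambda>(k::real) (p::real\<times>real). exp (\<i> * of_real (k * (s * (fst p - snd p)))))"
  have em[measurable]: "case_prod e \<in> borel_measurable (lborel \<Otimes>\<^sub>M (lborel \<Otimes>\<^sub>M lborel))"
    unfolding e_def by measurable
  have ne: "cmod (e k p) = 1" for k p by (simp add: e_def)
  define h where "h = (\<lambda>p::real\<times>real. f (fst p) * cnj (f (snd p)))"
  have [measurable]: "(\<lambda>x. cnj (f x)) \<in> borel_measurable borel"
    using borel_measurable_integrable[OF integrable_cnj[OF f]] by simp
  have hm[measurable]: "h \<in> borel_measurable (lborel \<Otimes>\<^sub>M lborel)" unfolding h_def by measurable
  have hi: "integrable (lborel \<Otimes>\<^sub>M lborel) h"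
    by (rule lborel_pair.Fubini_integrable) (use f in \<open>auto simp: h_def norm_mult\<close>)
  interpret Q: pair_sigma_finite "lborel :: real measure" "lborel \<Otimes>\<^sub>M (lborel :: real measure)"
    by unfold_locales
  have fs: "integrable lborel (\<lambda>x. exp (\<i> * of_real (k * (s * x))) * f x)" for k
    by (rule Bochner_Integration.integrable_bound[OF f]) (auto simp: norm_mult)
  define a where "a = (\<lambda>x. (cmod (f x))\<^sup>2)"
  have am[measurable]: "a \<in> borel_measurable borel" unfolding a_def by measurable
  have Gy: "integrable lborel (\<lambda>y. G (x - y))" "(LINT y|lborel. G (x - y)) = 2 * pi" for x
    using integral_gaussian_shift[OF \<sigma>, of x] by (auto simp: G_def power2_commute power_mult_distrib)
  have G': "G (x - y) = G (y - x)" for x y by (simp add: G_def power2_commute power_mult_distrib)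
  have i1: "integrable (lborel \<Otimes>\<^sub>M lborel) (\<lambda>(x, y). a x / 2 * G (x - y))"
    by (rule lborel_pair.Fubini_integrable) (use f2 G0 Gy in \<open>auto simp: abs_mult a_def\<close>)
  have i2: "integrable (lborel \<Otimes>\<^sub>M lborel) (\<lambda>(x, y). a y / 2 * G (x - y))"
    using lborel_pair.integrable_product_swap[OF i1] by (simp add: G')
  have i12: "integrable (lborel \<Otimes>\<^sub>M lborel) (\<lambda>p. (a (fst p) / 2 + a (snd p) / 2) * G (fst p - snd p))"
    using Bochner_Integration.integrable_add[OF i1 i2] by (simp add: case_prod_beta algebra_simps)
  have I12: "(\<integral>p. (a (fst p) / 2 + a (snd p) / 2) * G (fst p - snd p) \<partial>(lborel \<Otimes>\<^sub>M lborel)) =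
     2 * pi * (LINT x|lborel. a x)"
  proof -
    have "(\<integral>(x, y). a x / 2 * G (x - y) \<partial>(lborel \<Otimes>\<^sub>M lborel)) = pi * (LINT x|lborel. a x)"
      by (subst lborel_pair.integral_fst[OF i1, symmetric]) (simp add: Gy)
    moreover have "(\<integral>(x, y). a y / 2 * G (x - y) \<partial>(lborel \<Otimes>\<^sub>M lborel)) = pi * (LINT x|lborel. a x)"
      by (subst lborel_pair.integral_snd[OF i2, symmetric]) (simp add: Gy G')
    ultimately show ?thesis
      using Bochner_Integration.integral_add[OF i1 i2] by (simp add: case_prod_beta algebra_simps)
  qed
  have he: "integrable (lborel \<Otimes>\<^sub>M lborel) (\<lambda>p. h p * e k p)" for k
    by (rule Bochner_Integration.integrable_bound[OF hi]) (auto simp: norm_mult ne e_def)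
  have Fk: "of_real ((cmod (F k))\<^sup>2) = (\<integral>p. h p * e k p \<partial>(lborel \<Otimes>\<^sub>M lborel))" for k
  proof -
    from lborel_pair.integral_fst'[OF he[of k]]
    have "(\<integral>p. h p * e k p \<partial>(lborel \<Otimes>\<^sub>M lborel)) = (LINT x|lborel. LINT y|lborel. h (x,y) * e k (x,y))" by simp
    also have "\<dots> = (LINT x|lborel. LINT y|lborel. (exp (\<i> * of_real (k * (s * x))) * f x) *
          cnj (exp (\<i> * of_real (k * (s * y))) * f y))"
      by (intro Bochner_Integration.integral_cong refl)
         (simp add: h_def e_def exp_cnj algebra_simps flip: exp_add)
    also have "\<dots> = F k * cnj (F k)"
      by (simp only: integral_mult_right_zero integral_mult_left_zero Bochner_Integration.integral_cnj F_def)
    finally show ?thesis by (simp only: complex_norm_square)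
  qed
  \<comment> \<open>Absolute integrability in three variables: the weight handles \<open>k\<close>,
    the integrability of \<open>f\<close> handles both components of \<open>p\<close>, and
    \<open>e\<close> has modulus one.\<close>
  have ig: "integrable (lborel \<Otimes>\<^sub>M (lborel \<Otimes>\<^sub>M lborel)) (\<lambda>(k,p). of_real (w k) * (h p * e k p))"
  proof (rule Q.Fubini_integrable)
    show "(\<lambda>(k,p). of_real (w k) * (h p * e k p)) \<in> borel_measurable (lborel \<Otimes>\<^sub>M (lborel \<Otimes>\<^sub>M lborel))"
      unfolding e_def by measurable
    show "AE k in lborel. integrable (lborel \<Otimes>\<^sub>M lborel) (\<lambda>p. case (k, p) of (k,p) \<Rightarrow> of_real (w k) * (h p * e k p))"
      using he by (auto intro!: AE_I2 integrable_mult_right)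
    have "integrable lborel (\<lambda>k. w k * (\<integral>p. norm (h p) \<partial>(lborel \<Otimes>\<^sub>M lborel)))"
      using wi by (intro integrable_mult_left)
    thus "integrable lborel (\<lambda>k. \<integral>p. norm (case (k, p) of (k,p) \<Rightarrow> of_real (w k) * (h p * e k p)) \<partial>(lborel \<Otimes>\<^sub>M lborel))"
      using w0 by (simp add: norm_mult ne)
  qed
  have wF: "integrable lborel (\<lambda>k. of_real (w k) * of_real ((cmod (F k))\<^sup>2) :: complex)"
    unfolding Fk using Q.integrable_fst'[OF ig] by simp
  hence wF': "integrable lborel (\<lambda>k. w k * (cmod (F k))\<^sup>2)"
    by (simp only: of_real_mult[symmetric] complex_of_real_integrable_eq)
  have "(of_real (LINT k|lborel. w k * (cmod (F k))\<^sup>2) :: complex) =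
     (\<integral>k. \<integral>p. of_real (w k) * (h p * e k p) \<partial>(lborel \<Otimes>\<^sub>M lborel) \<partial>lborel)"
    unfolding integral_complex_of_real[symmetric] by (simp only: of_real_mult Fk integral_mult_right_zero)
  also have "\<dots> = (\<integral>p. (LINT k|lborel. of_real (w k) * (h p * e k p)) \<partial>(lborel \<Otimes>\<^sub>M lborel))"
    using Q.Fubini_integral[OF ig] by simp
  also have "\<dots> = (\<integral>p. h p * of_real (G (fst p - snd p)) \<partial>(lborel \<Otimes>\<^sub>M lborel))"
  proof (intro Bochner_Integration.integral_cong refl)
    fix p :: "real \<times> real"
    have "(LINT k|lborel. of_real (w k) * (h p * e k p)) = h p * (LINT k|lborel. exp (\<i> * of_real (k * (s * (fst p - snd p)))) * of_real (w k))"
      unfolding integral_mult_right_zero[symmetric] by (simp add: e_def mult_ac)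
    also have "\<dots> = h p * of_real (G (s * (fst p - snd p)))"
      unfolding w_def G_def by (subst fourier_gaussian[OF \<sigma>]) simp
    \<comment> \<open>\<open>G\<close> is even, so the sign \<open>s\<close> disappears.\<close>
    also have "G (s * (fst p - snd p)) = G (fst p - snd p)"
    proof -
      have "s\<^sup>2 = 1" using s by (metis power2_abs one_power2)
      thus ?thesis by (simp add: G_def power_mult_distrib)
    qed
    finally show "(LINT k|lborel. of_real (w k) * (h p * e k p)) = h p * of_real (G (fst p - snd p))" .
  qed
  also have "cmod \<dots> \<le> (\<integral>p. cmod (f (fst p)) * cmod (f (snd p)) * G (fst p - snd p) \<partial>(lborel \<Otimes>\<^sub>M lborel))"
    by (rule order_trans[OF integral_norm_bound]) (simp add: h_def norm_mult G0)
  also have "\<dots> \<le> (\<integral>p. (a (fst p) / 2 + a (snd p) / 2) * G (fst p - snd p) \<partial>(lborel \<Otimes>\<^sub>M lborel))"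
  proof (rule integral_mono)
    show le: "cmod (f (fst p)) * cmod (f (snd p)) * G (fst p - snd p) \<le>
      (a (fst p) / 2 + a (snd p) / 2) * G (fst p - snd p)" for p
    proof (rule mult_right_mono[OF _ G0])
      show "cmod (f (fst p)) * cmod (f (snd p)) \<le> a (fst p) / 2 + a (snd p) / 2"
        using sum_squares_bound[of "cmod (f (fst p))" "cmod (f (snd p))"] by (simp add: a_def)
    qed
    have "norm (cmod (f (fst p)) * cmod (f (snd p)) * G (fst p - snd p)) \<le>
        norm ((a (fst p) / 2 + a (snd p) / 2) * G (fst p - snd p))" for p
      using le[of p] G0 by (simp add: abs_mult a_def abs_of_nonneg)
    thus "integrable (lborel \<Otimes>\<^sub>M lborel) (\<lambda>p. cmod (f (fst p)) * cmod (f (snd p)) * G (fst p - snd p))"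
      by (intro Bochner_Integration.integrable_bound[OF i12] AE_I2) auto
  qed (rule i12)
  also note I12
  finally have "(LINT k|lborel. w k * (cmod (F k))\<^sup>2) \<le> 2 * pi * (LINT x|lborel. (cmod (f x))\<^sup>2)"
    by (simp add: a_def)
  thus ?thesis
    by (subst nn_integral_eq_integral)
      (use wF' in \<open>auto simp: w_def mult_ac intro!: ennreal_leI\<close>)
qed


text \<open>The sign \<open>s\<close> lets one inequality serve the transform
  (\<open>s = - 1\<close>) and the inverse transform (\<open>s = 1\<close>). The Gaussian bound does
  not involve the width, so the widths \<open>Suc m\<close> may tend to infinity. The constant
  \<open>2 * pi\<close> is that of Plancherel's identity.\<close>

lemma plancherel_le:
  fixes f :: "real \<Rightarrow> complex" and s :: real
  assumes f: "integrable lborel f" and f2: "integrable lborel (\<lambda>x. (cmod (f x))\<^sup>2)"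
    and s: "\<bar>s\<bar> = 1"
  shows "(\<integral>\<^sup>+k. ennreal ((cmod (LINT x|lborel. exp (\<i> * of_real (k * (s * x))) * f x))\<^sup>2) \<partial>lborel)
    \<le> ennreal (2 * pi) * (\<integral>\<^sup>+x. ennreal ((cmod (f x))\<^sup>2) \<partial>lborel)"
proof -
  define F where "F = (\<lambda>k. LINT x|lborel. exp (\<i> * of_real (k * (s * x))) * f x)"
  note [measurable] = borel_measurable_integrable[OF f]
  have [measurable]: "F \<in> borel_measurable borel" unfolding F_def by measurable
  define u where "u = (\<lambda>(m::nat) k. ennreal ((cmod (F k))\<^sup>2 * exp (- (k / real (Suc m))\<^sup>2 / 2)))"
  have "(\<integral>\<^sup>+k. ennreal ((cmod (F k))\<^sup>2) \<partial>lborel) = (\<integral>\<^sup>+k. liminf (\<lambda>m. u m k) \<partial>lborel)"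
  proof (rule nn_integral_cong)
    fix k
    have "(\<lambda>m. k / real (Suc m)) \<longlonglongrightarrow> 0" by real_asymp
    hence "(\<lambda>m. (cmod (F k))\<^sup>2 * exp (- (k / real (Suc m))\<^sup>2 / 2)) \<longlonglongrightarrow> (cmod (F k))\<^sup>2 * exp (- 0\<^sup>2 / 2)"
      by (intro tendsto_intros) auto
    hence "(\<lambda>m. u m k) \<longlonglongrightarrow> ennreal ((cmod (F k))\<^sup>2)"
      unfolding u_def by (intro tendsto_ennrealI) simp
    thus "ennreal ((cmod (F k))\<^sup>2) = liminf (\<lambda>m. u m k)"
      by (intro lim_imp_Liminf[symmetric]) auto
  qed
  also have "\<dots> \<le> liminf (\<lambda>m. integral\<^sup>N lborel (u m))"
    by (rule nn_integral_liminf) (simp add: u_def)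
  also have "\<dots> \<le> liminf (\<lambda>m. ennreal (2 * pi * (LINT x|lborel. (cmod (f x))\<^sup>2)))"
    using plancherel_gaussian[OF f f2 s, of "real (Suc m)" for m]
    by (intro Liminf_mono always_eventually allI) (simp add: u_def F_def)
  also have "\<dots> = ennreal (2 * pi * (LINT x|lborel. (cmod (f x))\<^sup>2))"
    by (simp add: Liminf_const)
  also have "\<dots> = ennreal (2 * pi) * (\<integral>\<^sup>+x. ennreal ((cmod (f x))\<^sup>2) \<partial>lborel)"
    by (subst nn_integral_eq_integral[OF f2]) (simp_all add: ennreal_mult)
  finally show ?thesis by (simp add: F_def)
qed

section \<open>The Fourier transform on \<open>L\<^sup>2\<close>\<close>

text \<open>The squared norm takes values in \<open>ennreal\<close>, so it makes sense before
  integrability is known, and finiteness becomes a property to be proved. \<open>L2_tendsto\<close>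
  is convergence of this quantity to 0.\<close>

definition l2sq :: "(real \<Rightarrow> complex) \<Rightarrow> ennreal" where
  "l2sq f = (\<integral>\<^sup>+x. ennreal ((cmod (f x))\<^sup>2) \<partial>lborel)"

text \<open>\<open>s = - 1\<close> gives the truncations behind \<open>fourier_L2\<close>,
  \<open>s = 1\<close> those of the inverse transform without the factor
  \<open>1 / (2 * pi)\<close>.\<close>

definition trunc_fourier :: "real \<Rightarrow> (real \<Rightarrow> complex) \<Rightarrow> real \<Rightarrow> real \<Rightarrow> complex" where
  "trunc_fourier s f R k = (LINT x:{-R..R}|lborel. exp (\<i> * of_real (k * (s * x))) * f x)"

text \<open>A triangle inequality up to the constant 2, from
  \<open>(a + b)\<^sup>2 \<le> 2 * a\<^sup>2 + 2 * b\<^sup>2\<close>. It is enough because only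
  finiteness and convergence to 0 of \<open>l2sq\<close> are at stake.\<close>

lemma l2sq_add_le:
  assumes [measurable]: "f \<in> borel_measurable borel" "g \<in> borel_measurable borel"
  shows "l2sq (\<lambda>x. f x + g x) \<le> 2 * l2sq f + 2 * l2sq g"
proof -
  have *: "(cmod (a + b))\<^sup>2 \<le> 2 * (cmod a)\<^sup>2 + 2 * (cmod b)\<^sup>2" for a b
  proof -
    have "(cmod (a + b))\<^sup>2 \<le> (cmod a + cmod b)\<^sup>2"
      by (intro power_mono norm_triangle_ineq) auto
    also have "\<dots> \<le> 2 * (cmod a)\<^sup>2 + 2 * (cmod b)\<^sup>2"
      using sum_squares_bound[of "cmod a" "cmod b"] by (simp add: power2_sum)
    finally show ?thesis .
  qed
  have "l2sq (\<lambda>x. f x + g x) \<le> (\<integral>\<^sup>+x. 2 * ennreal ((cmod (f x))\<^sup>2) + 2 * ennreal ((cmod (g x))\<^sup>2) \<partial>lborel)"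
    unfolding l2sq_def
  proof (rule nn_integral_mono)
    fix x
    have "ennreal ((cmod (f x + g x))\<^sup>2) \<le> ennreal (2 * (cmod (f x))\<^sup>2 + 2 * (cmod (g x))\<^sup>2)"
      by (rule ennreal_leI[OF *])
    thus "ennreal ((cmod (f x + g x))\<^sup>2) \<le> 2 * ennreal ((cmod (f x))\<^sup>2) + 2 * ennreal ((cmod (g x))\<^sup>2)"
      by (simp add: ennreal_plus ennreal_mult)
  qed
  thus ?thesis by (simp add: l2sq_def nn_integral_add nn_integral_cmult)
qed

lemma l2sq_diff_commute: "l2sq (\<lambda>x. f x - g x) = l2sq (\<lambda>x. g x - f x)"
  by (simp add: l2sq_def norm_minus_commute)

lemma l2sq_triangle:
  assumes [measurable]: "f \<in> borel_measurable borel" "g \<in> borel_measurable borel" "h \<in> borel_measurable borel"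
  shows "l2sq (\<lambda>x. f x - h x) \<le> 2 * l2sq (\<lambda>x. f x - g x) + 2 * l2sq (\<lambda>x. g x - h x)"
  using l2sq_add_le[of "\<lambda>x. f x - g x" "\<lambda>x. g x - h x"] by simp

lemma l2sq_cong_AE: "AE x in lborel. f x = g x \<Longrightarrow> l2sq f = l2sq g"
  unfolding l2sq_def by (intro nn_integral_cong_AE) auto

lemma l2sq_eq_0:
  assumes "f \<in> borel_measurable borel" "l2sq f = 0"
  shows "AE x in lborel. f x = 0"
  using assms unfolding l2sq_def by (subst (asm) nn_integral_0_iff_AE) auto

lemma l2sq_cmult:
  assumes [measurable]: "f \<in> borel_measurable borel"
  shows "l2sq (\<lambda>x. c * f x) = ennreal ((cmod c)\<^sup>2) * l2sq f"
  unfolding l2sq_def by (simp add: norm_mult power_mult_distrib ennreal_mult nn_integral_cmult)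

lemma integrable_cmod_sq_iff:
  assumes [measurable]: "f \<in> borel_measurable borel"
  shows "integrable lborel (\<lambda>x. (cmod (f x))\<^sup>2) \<longleftrightarrow> l2sq f < \<infinity>"
  by (simp add: integrable_iff_bounded l2sq_def)

lemma square_integrable_on_iff:
  "square_integrable_on f S \<longleftrightarrow> square_integrable_on (\<lambda>x. indicator S x *\<^sub>R f x) UNIV"
proof -
  have "indicator S x *\<^sub>R (cmod (f x))\<^sup>2 = (cmod (indicator S x *\<^sub>R f x))\<^sup>2" for x
    by (auto simp: indicator_def)
  thus ?thesis
    by (simp add: square_integrable_on_def set_borel_measurable_def set_integrable_def)
qed

lemma square_integrable_UNIV_iff:
  "square_integrable_on f UNIV \<longleftrightarrow> f \<in> borel_measurable borel \<and> l2sq f < \<infinity>"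
  using integrable_cmod_sq_iff[of f]
  by (auto simp: square_integrable_on_def set_borel_measurable_def set_integrable_def)

lemma square_integrable_UNIV_D:
  assumes "square_integrable_on f UNIV"
  shows "f \<in> borel_measurable borel" "l2sq f < \<infinity>" "integrable lborel (\<lambda>x. (cmod (f x))\<^sup>2)"
  using assms integrable_cmod_sq_iff[of f] by (auto simp: square_integrable_UNIV_iff)

text \<open>\<open>t \<le> 1 + t\<^sup>2\<close> bounds \<open>cmod (f x)\<close> by a function that
  is integrable on every set of finite measure.\<close>

lemma square_integrable_imp_integrable:
  assumes "square_integrable_on f UNIV" and A: "A \<in> sets borel" "emeasure lborel A < \<infinity>"
  shows "set_integrable lborel A f"
proof -
  note [measurable] = square_integrable_UNIV_D(1)[OF assms(1)] A(1)
  have "set_integrable lborel A (\<lambda>x. 1 + (cmod (f x))\<^sup>2)"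
    using square_integrable_UNIV_D(3)[OF assms(1)] A
    by (intro set_integral_add)
      (auto simp: set_integrable_def real_scaleR_def[symmetric] simp del: real_scaleR_def
        intro!: integrable_mult_indicator)
  thus ?thesis
  proof (rule set_integrable_bound)
    have "x \<le> 1 + x\<^sup>2" for x :: real
      using sum_squares_bound[of x 1] by (smt (verit) mult_cancel_left1 one_power2 zero_le_power2)
    thus "AE x in lborel. x \<in> A \<longrightarrow> cmod (f x) \<le> norm (1 + (cmod (f x))\<^sup>2)"
      by (auto simp: abs_of_nonneg)
  qed (simp add: set_borel_measurable_def)
qed

lemma trunc_fourier_measurable [measurable]:
  assumes [measurable]: "f \<in> borel_measurable borel"
  shows "trunc_fourier s f R \<in> borel_measurable borel"
  unfolding trunc_fourier_def set_lebesgue_integral_def by measurable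

definition l2_tail :: "(real \<Rightarrow> complex) \<Rightarrow> real \<Rightarrow> ennreal" where
  "l2_tail f R = l2sq (\<lambda>x. indicator (- {-R..R}) x *\<^sub>R f x)"

lemma l2_tail_tendsto_0:
  assumes "square_integrable_on f UNIV"
  shows "(l2_tail f \<longlongrightarrow> 0) at_top"
proof -
  note [measurable] = square_integrable_UNIV_D(1)[OF assms]
  have "((\<lambda>R. \<integral>x. indicator (- {-R..R}) x * (cmod (f x))\<^sup>2 \<partial>lborel) \<longlongrightarrow> (\<integral>x. 0 \<partial>(lborel :: real measure))) at_top"
  proof (rule integral_dominated_convergence_at_top)
    show "integrable lborel (\<lambda>x. (cmod (f x))\<^sup>2)" by (rule square_integrable_UNIV_D(3)[OF assms])
    show "AE x in lborel. ((\<lambda>R. indicator (- {-R..R}) x * (cmod (f x))\<^sup>2) \<longlongrightarrow> 0) at_top"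
    proof (rule AE_I2, rule tendsto_eventually)
      fix x :: real
      show "\<forall>\<^sub>F R in at_top. indicator (- {-R..R}) x * (cmod (f x))\<^sup>2 = 0"
        using eventually_ge_at_top[of "\<bar>x\<bar>"] by eventually_elim (auto simp: indicator_def)
    qed
  qed (auto intro!: always_eventually simp: indicator_def)
  hence "((\<lambda>R. ennreal (\<integral>x. indicator (- {-R..R}) x * (cmod (f x))\<^sup>2 \<partial>lborel)) \<longlongrightarrow> ennreal 0) at_top"
    by (intro tendsto_ennrealI) simp
  moreover have "ennreal (\<integral>x. indicator (- {-R..R}) x * (cmod (f x))\<^sup>2 \<partial>lborel) = l2_tail f R" for R
  proof -
    have "integrable lborel (\<lambda>x. indicator (- {-R..R}) x *\<^sub>R (cmod (f x))\<^sup>2)"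
      using square_integrable_UNIV_D(3)[OF assms] by (intro integrable_mult_indicator) auto
    thus ?thesis unfolding l2_tail_def l2sq_def
      by (subst nn_integral_eq_integral[symmetric])
        (auto simp: indicator_def intro!: nn_integral_cong)
  qed
  ultimately show ?thesis by simp
qed

text \<open>The difference of two truncations is the transform of \<open>f\<close> cut to
  \<open>R < \<bar>x\<bar> \<le> R'\<close>. That set is bounded, so the cut function lies in L1 as
  well as in L2 and \<open>plancherel_le\<close> applies. The estimate is the Cauchy property of the
  truncations.\<close>

lemma l2sq_trunc_fourier_diff_le:
  assumes f: "square_integrable_on f UNIV" and s: "\<bar>s\<bar> = 1" and R: "R \<le> R'"
  shows "l2sq (\<lambda>k. trunc_fourier s f R' k - trunc_fourier s f R k) \<le> ennreal (2 * pi) * l2_tail f R"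
proof -
  note [measurable] = square_integrable_UNIV_D(1)[OF f]
  define A where "A = {-R'..R'} - {-R..R}"
  have [measurable]: "A \<in> sets borel" by (simp add: A_def)
  have fin: "emeasure lborel A < \<infinity>"
    using emeasure_mono[of A "{-R'..R'}" lborel] by (cases "-R' \<le> R'") (auto simp: A_def less_top[symmetric] top_unique)
  define g where "g = (\<lambda>x. indicator A x *\<^sub>R f x)"
  have gi: "integrable lborel g"
    using square_integrable_imp_integrable[OF f _ fin] by (simp add: set_integrable_def g_def)
  have "integrable lborel (\<lambda>x. indicator A x *\<^sub>R (cmod (f x))\<^sup>2)"
    using square_integrable_UNIV_D(3)[OF f] by (intro integrable_mult_indicator) auto
  moreover have "(\<lambda>x. indicator A x *\<^sub>R (cmod (f x))\<^sup>2) = (\<lambda>x. (cmod (g x))\<^sup>2)"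
    by (auto simp: g_def indicator_def)
  ultimately have g2: "integrable lborel (\<lambda>x. (cmod (g x))\<^sup>2)" by simp
  have si: "set_integrable lborel {-M..M} (\<lambda>x. exp (\<i> * of_real (k * (s * x))) * f x)" for M k
    by (rule set_integrable_bound[OF square_integrable_imp_integrable[OF f, of "{-M..M}"]])
      (auto simp: norm_mult set_borel_measurable_def emeasure_lborel_Icc_eq)
  have eq: "trunc_fourier s f R' k - trunc_fourier s f R k =
      (LINT x|lborel. exp (\<i> * of_real (k * (s * x))) * g x)" for k
  proof -
    define e where "e = (\<lambda>x. exp (\<i> * of_real (k * (s * x))) * f x)"
    have "trunc_fourier s f R' k - trunc_fourier s f R k =
        (LINT x|lborel. indicator {-R'..R'} x *\<^sub>R e x - indicator {-R..R} x *\<^sub>R e x)"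
      unfolding trunc_fourier_def set_lebesgue_integral_def e_def
      by (rule Bochner_Integration.integral_diff[symmetric]; rule si[unfolded set_integrable_def])
    also have "\<dots> = (LINT x|lborel. exp (\<i> * of_real (k * (s * x))) * g x)"
      by (rule Bochner_Integration.integral_cong) (use R in \<open>auto simp: e_def g_def A_def indicator_def\<close>)
    finally show ?thesis .
  qed
  have "l2sq (\<lambda>k. trunc_fourier s f R' k - trunc_fourier s f R k) \<le> ennreal (2 * pi) * l2sq g"
    unfolding eq using plancherel_le[OF gi g2 s] by (simp add: l2sq_def)
  also have "l2sq g \<le> l2_tail f R"
    unfolding l2_tail_def l2sq_def by (intro nn_integral_mono ennreal_leI) (auto simp: g_def A_def indicator_def)
  finally show ?thesis by (simp add: mult_left_mono)
qed

lemma l2sq_trunc_fourier_finite: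
  assumes f: "square_integrable_on f UNIV" and s: "\<bar>s\<bar> = 1"
  shows "l2sq (trunc_fourier s f R) < \<infinity>"
proof -
  note [measurable] = square_integrable_UNIV_D(1)[OF f]
  show ?thesis
  proof (cases "0 \<le> R")
    case True
    \<comment> \<open>At \<open>R = - 1\<close> the interval of integration is empty, so the Cauchy
      estimate against this truncation bounds the norm itself.\<close>
    have "trunc_fourier s f (-1) k = 0" for k by (simp add: trunc_fourier_def set_lebesgue_integral_def)
    hence "l2sq (trunc_fourier s f R) \<le> ennreal (2 * pi) * l2_tail f (-1)"
      using l2sq_trunc_fourier_diff_le[OF f s, of "-1" R] True by simp
    also have "l2_tail f (-1) = l2sq f" by (simp add: l2_tail_def)
    also have "ennreal (2 * pi) * l2sq f < \<infinity>"
      using square_integrable_UNIV_D(2)[OF f] by (simp add: ennreal_mult_less_top)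
    finally show ?thesis .
  qed (simp add: trunc_fourier_def set_lebesgue_integral_def l2sq_def)
qed

text \<open>Fatou's lemma along \<open>r\<close> turns the Cauchy bound \<open>T R\<close> into a
  bound for the distance from \<open>U R\<close> to the pointwise limit. It serves twice: with an
  abstract subsequence to construct the transform, and with an explicit pointwise limit to identify
  the solution.\<close>

lemma L2_tendsto_of_pointwise:
  fixes U :: "real \<Rightarrow> real \<Rightarrow> complex"
  assumes Um: "\<And>R. U R \<in> borel_measurable borel" and fin: "\<And>R. l2sq (U R) < \<infinity>"
    and cauchy: "\<And>R R'. R \<le> R' \<Longrightarrow> l2sq (\<lambda>x. U R' x - U R x) \<le> T R" and T: "(T \<longlongrightarrow> 0) at_top"
    and r: "filterlim r at_top sequentially"
    and lim: "AE x in lborel. (\<lambda>m. U (r m) x) \<longlonglongrightarrow> u x" and um: "u \<in> borel_measurable borel"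
  shows "square_integrable_on u UNIV" "L2_tendsto U u"
proof -
  note [measurable] = Um um
  have le: "l2sq (\<lambda>x. U R x - u x) \<le> T R" for R
  proof -
    have "l2sq (\<lambda>x. U R x - u x) = (\<integral>\<^sup>+x. liminf (\<lambda>m. ennreal ((cmod (U R x - U (r m) x))\<^sup>2)) \<partial>lborel)"
      unfolding l2sq_def
    proof (rule nn_integral_cong_AE, use lim in eventually_elim)
      case (elim x)
      hence "(\<lambda>m. ennreal ((cmod (U R x - U (r m) x))\<^sup>2)) \<longlonglongrightarrow> ennreal ((cmod (U R x - u x))\<^sup>2)"
        by (intro tendsto_ennrealI tendsto_intros)
      thus ?case by (intro lim_imp_Liminf[symmetric]) auto
    qed
    also have "\<dots> \<le> liminf (\<lambda>m. l2sq (\<lambda>x. U R x - U (r m) x))"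
      unfolding l2sq_def by (rule nn_integral_liminf) measurable
    also have "\<dots> \<le> liminf (\<lambda>m. T R)"
    proof (rule Liminf_mono)
      show "\<forall>\<^sub>F m in sequentially. l2sq (\<lambda>x. U R x - U (r m) x) \<le> T R"
        using r[unfolded filterlim_at_top, rule_format, of R]
        by eventually_elim (metis cauchy l2sq_diff_commute)
    qed
    finally show ?thesis by (simp add: Liminf_const)
  qed
  show "L2_tendsto U u"
    unfolding L2_tendsto_def l2sq_def[symmetric]
    by (rule tendsto_sandwich[OF _ _ tendsto_const T]) (auto simp: le)
  have "\<forall>\<^sub>F R in at_top. T R < 1" using T by (rule order_tendstoD) simp
  then obtain R where "T R < 1" by (metis eventually_happens' trivial_limit_at_top_linorder)
  hence "l2sq (\<lambda>x. u x - U R x) < \<infinity>"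
    using le[of R] by (subst l2sq_diff_commute) (metis ennreal_one_less_top infinity_ennreal_def order_le_less_trans order_less_trans)
  hence "2 * l2sq (\<lambda>x. u x - U R x) + 2 * l2sq (U R) < \<infinity>"
    using fin[of R] by (simp add: ennreal_mult_less_top)
  hence "l2sq u < \<infinity>"
    using l2sq_add_le[of "\<lambda>x. u x - U R x" "U R"] by (simp add: order_le_less_trans)
  thus "square_integrable_on u UNIV" by (simp add: square_integrable_UNIV_iff)
qed


lemma trunc_fourier_L2_tendsto:
  assumes f: "square_integrable_on f UNIV" and s: "\<bar>s\<bar> = 1"
    and r: "filterlim r at_top sequentially"
    and lim: "AE x in lborel. (\<lambda>m. trunc_fourier s f (r m) x) \<longlonglongrightarrow> u x" and um: "u \<in> borel_measurable borel"
  shows "square_integrable_on u UNIV \<and> L2_tendsto (trunc_fourier s f) u"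
proof -
  note [measurable] = square_integrable_UNIV_D(1)[OF f]
  have "((\<lambda>R. ennreal (2 * pi) * l2_tail f R) \<longlongrightarrow> ennreal (2 * pi) * 0) at_top"
    by (intro ennreal_tendsto_cmult l2_tail_tendsto_0[OF f]) simp
  thus ?thesis
    using L2_tendsto_of_pointwise[of "trunc_fourier s f" "\<lambda>R. ennreal (2 * pi) * l2_tail f R" r u]
      l2sq_trunc_fourier_finite[OF f s] l2sq_trunc_fourier_diff_le[OF f s] r lim um by auto
qed

lemma mult_le_weighted_squares:
  fixes x w e :: real
  assumes "0 < e"
  shows "x * w \<le> x\<^sup>2 / e + e * w\<^sup>2"
proof -
  have "2 * (x / sqrt e) * (sqrt e * w) \<le> (x / sqrt e)\<^sup>2 + (sqrt e * w)\<^sup>2" by (rule sum_squares_bound)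
  hence "2 * (x * w) \<le> x\<^sup>2 / e + e * w\<^sup>2" using assms by (simp add: power_divide power_mult_distrib)
  moreover have "0 \<le> x\<^sup>2 / e + e * w\<^sup>2" using assms by simp
  ultimately show ?thesis by linarith
qed

text \<open>
  Against a Gaussian weight an \<open>L\<^sup>2\<close>-Cauchy sequence is Cauchy in \<open>L\<^sup>1\<close>, hence has an almost
  everywhere convergent subsequence.
\<close>

lemma trunc_fourier_AE_subseq:
  assumes f: "square_integrable_on f UNIV" and s: "\<bar>s\<bar> = 1"
  obtains r :: "nat \<Rightarrow> real" and u where "filterlim r at_top sequentially"
    "AE x in lborel. (\<lambda>m. trunc_fourier s f (r m) x) \<longlonglongrightarrow> u x" "u \<in> borel_measurable borel"
proof -
  note [measurable] = square_integrable_UNIV_D(1)[OF f]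
  define w where "w = (\<lambda>k::real. exp (- (k / 2)\<^sup>2 / 2))"
  have [measurable]: "w \<in> borel_measurable borel" unfolding w_def by measurable
  have w0: "0 < w k" for k by (simp add: w_def)
  have wi: "integrable lborel (\<lambda>k. (w k)\<^sup>2)"
  proof -
    have "(\<lambda>k. (w k)\<^sup>2) = (\<lambda>k. exp (- (k / sqrt 2)\<^sup>2 / 2))"
      by (auto simp: w_def power_divide simp flip: exp_of_nat_mult)
    thus ?thesis using integrable_gaussian[of "sqrt 2"] by simp
  qed
  define W where "W = (LINT k|lborel. (w k)\<^sup>2)"
  have W0: "0 \<le> W" by (simp add: W_def)
  define U where "U = trunc_fourier s f"
  have [measurable]: "U R \<in> borel_measurable borel" for R unfolding U_def by measurable
  have key: "integrable lborel (\<lambda>k. g k * of_real (w k))"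
      "(LINT k|lborel. cmod (g k * of_real (w k))) \<le> enn2real (l2sq g) / e + e * W"
    if [measurable]: "g \<in> borel_measurable borel" and g: "l2sq g < \<infinity>" and e: "0 < e" for g :: "real \<Rightarrow> complex" and e :: real
  proof -
    have g2: "integrable lborel (\<lambda>k. (cmod (g k))\<^sup>2)" using g by (simp add: integrable_cmod_sq_iff)
    hence b: "integrable lborel (\<lambda>k. (cmod (g k))\<^sup>2 / e + e * (w k)\<^sup>2)" using wi by simp
    have le: "cmod (g k * of_real (w k)) \<le> (cmod (g k))\<^sup>2 / e + e * (w k)\<^sup>2" for k
      using mult_le_weighted_squares[OF e, of "cmod (g k)" "w k"] w0[of k] by (simp add: norm_mult)
    moreover have "0 \<le> (cmod (g k))\<^sup>2 / e + e * (w k)\<^sup>2" for k using e by simp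
    ultimately show i: "integrable lborel (\<lambda>k. g k * of_real (w k))"
      by (intro Bochner_Integration.integrable_bound[OF b] AE_I2) (auto simp del: norm_mult)
    have "(LINT k|lborel. cmod (g k * of_real (w k))) \<le> (LINT k|lborel. (cmod (g k))\<^sup>2 / e + e * (w k)\<^sup>2)"
      by (rule integral_mono[OF integrable_norm[OF i] b le])
    also have "\<dots> = (LINT k|lborel. (cmod (g k))\<^sup>2) / e + e * W"
      using g2 wi by (simp add: W_def)
    also have "(LINT k|lborel. (cmod (g k))\<^sup>2) = enn2real (l2sq g)"
      unfolding l2sq_def by (subst nn_integral_eq_integral[OF g2]) auto
    finally show "(LINT k|lborel. cmod (g k * of_real (w k))) \<le> enn2real (l2sq g) / e + e * W" .
  qed
  define S where "S = (\<lambda>(m::nat) k. U (real m) k * of_real (w k))"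
  obtain q where q: "strict_mono q" and cau: "AE k in lborel. Cauchy (\<lambda>m. S (q m) k)"
  proof (rule cauchy_L1_AE_cauchy_subseq)
    show "integrable lborel (S m)" for m
      using key(1)[of "U (real m)" 1] l2sq_trunc_fourier_finite[OF f s] by (simp add: S_def U_def)
    fix \<epsilon> :: real assume \<epsilon>: "0 < \<epsilon>"
    \<comment> \<open>This weight keeps the Gaussian term \<open>e * W\<close> below
      \<open>\<epsilon> / 2\<close>. The other term is then \<open>l2sq g / e\<close>, whence the
      threshold \<open>\<epsilon> * e / 2\<close>.\<close>
    define e where "e = \<epsilon> / (2 * (W + 1))"
    have e: "0 < e" and eW: "e * W < \<epsilon> / 2" using \<epsilon> W0 by (auto simp: e_def field_simps)
    have "((\<lambda>R. ennreal (2 * pi) * l2_tail f R) \<longlongrightarrow> ennreal (2 * pi) * 0) at_top"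
      by (intro ennreal_tendsto_cmult l2_tail_tendsto_0[OF f]) simp
    moreover have "ennreal (2 * pi) * 0 < ennreal (\<epsilon> * e / 2)" using \<epsilon> e by (simp add: ennreal_zero_less_mult_iff)
    ultimately have "\<forall>\<^sub>F R in at_top. ennreal (2 * pi) * l2_tail f R < ennreal (\<epsilon> * e / 2)"
      by (rule order_tendstoD)
    then obtain R0 where R0: "\<And>R. R0 \<le> R \<Longrightarrow> ennreal (2 * pi) * l2_tail f R < ennreal (\<epsilon> * e / 2)"
      by (auto simp: eventually_at_top_linorder)
    have main: "(LINT k|lborel. norm (S i k - S j k)) < \<epsilon>" if ij: "R0 \<le> real j" "j \<le> i" for i j
    proof -
      define g where "g = (\<lambda>k. U (real i) k - U (real j) k)"
      have gl: "l2sq g < ennreal (\<epsilon> * e / 2)"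
        using l2sq_trunc_fourier_diff_le[OF f s, of "real j" "real i"] R0[of "real j"] ij
        unfolding g_def U_def by (auto intro: le_less_trans)
      hence gl': "enn2real (l2sq g) / e \<le> \<epsilon> / 2"
        using e \<epsilon> enn2real_mono[of "l2sq g" "ennreal (\<epsilon> * e / 2)"] by (simp add: field_simps)
      have [measurable]: "g \<in> borel_measurable borel" unfolding g_def by measurable
      have "(LINT k|lborel. norm (S i k - S j k)) = (LINT k|lborel. cmod (g k * of_real (w k)))"
        by (simp add: S_def g_def left_diff_distrib)
      also have "\<dots> \<le> enn2real (l2sq g) / e + e * W"
        by (rule key(2)) (use gl e in \<open>auto intro: less_trans\<close>)
      finally show ?thesis using gl' eW by linarith
    qed
    show "\<exists>N. \<forall>i\<ge>N. \<forall>j\<ge>N. (LINT k|lborel. norm (S i k - S j k)) < \<epsilon>"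
    proof (intro exI allI impI)
      fix i j assume "nat \<lceil>R0\<rceil> \<le> i" "nat \<lceil>R0\<rceil> \<le> j"
      hence ij: "R0 \<le> real i" "R0 \<le> real j" by linarith+
      show "(LINT k|lborel. norm (S i k - S j k)) < \<epsilon>"
        using main[OF ij(1), of j] main[OF ij(2), of i] by (cases "j \<le> i") (simp_all add: norm_minus_commute)
    qed
  qed blast
  define r where "r = (\<lambda>m. real (q m))"
  define u where "u = (\<lambda>k. lim (\<lambda>m. U (r m) k))"
  show thesis
  proof
    show "filterlim r at_top sequentially"
      unfolding r_def using filterlim_subseq[OF q] filterlim_real_sequentially
      by (rule filterlim_compose[rotated])
    show "u \<in> borel_measurable borel" unfolding u_def by (rule borel_measurable_lim_metric) measurable
    show "AE x in lborel. (\<lambda>m. trunc_fourier s f (r m) x) \<longlonglongrightarrow> u x"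
      using cau
    proof eventually_elim
      case (elim k)
      hence "convergent (\<lambda>m. S (q m) k)" by (rule Cauchy_convergent)
      hence "convergent (\<lambda>m. S (q m) k * of_real (1 / w k))"
        by (intro convergent_mult convergent_const)
      hence "convergent (\<lambda>m. U (r m) k)" using w0[of k] by (simp add: S_def r_def)
      thus ?case by (simp add: u_def U_def convergent_LIMSEQ_iff)
    qed
  qed
qed

text \<open>\<open>SOME\<close> asks only for the existence of a limit. The chosen representative
  enters later arguments through these two properties alone, so the choice is immaterial.\<close>

lemma fourier_L2:
  assumes f: "square_integrable_on f UNIV"
  shows "square_integrable_on (fourier_L2 f) UNIV" "L2_tendsto (trunc_fourier (-1) f) (fourier_L2 f)"
proof -
  obtain r u where "filterlim r at_top sequentially"
    "AE x in lborel. (\<lambda>m. trunc_fourier (-1) f (r m) x) \<longlonglongrightarrow> u x" "u \<in> borel_measurable borel"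
    using trunc_fourier_AE_subseq[OF f, of "-1"] by auto
  hence "square_integrable_on u UNIV \<and> L2_tendsto (trunc_fourier (-1) f) u"
    by (intro trunc_fourier_L2_tendsto[OF f]) auto
  moreover have "trunc_fourier (-1) f = (\<lambda>R k. LINT x:{-R..R}|lborel. exp (- \<i> * of_real k * of_real x) * f x)"
    by (auto simp: trunc_fourier_def fun_eq_iff mult_ac)
  ultimately have "square_integrable_on (fourier_L2 f) UNIV \<and> L2_tendsto (trunc_fourier (-1) f) (fourier_L2 f)"
    unfolding fourier_L2_def by (simp only:) (rule someI[of "\<lambda>F. square_integrable_on F UNIV \<and> L2_tendsto _ F"])
  thus "square_integrable_on (fourier_L2 f) UNIV" "L2_tendsto (trunc_fourier (-1) f) (fourier_L2 f)" by auto
qed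

lemma is_inverse_fourier_L2_iff:
  "is_inverse_fourier_L2 G u \<longleftrightarrow> square_integrable_on u UNIV \<and>
     L2_tendsto (\<lambda>R x. 1 / (2 * of_real pi) * trunc_fourier 1 G R x) u"
  by (simp add: is_inverse_fourier_L2_def trunc_fourier_def mult_ac)

section \<open>Oscillatory integrals with polynomial phase\<close>

text \<open>\<open>F\<close> is a primitive of the oscillating factor and \<open>h\<close> the
  amplitude. The real function \<open>g\<close> dominates the variation of \<open>h\<close>, so the
  integral of \<open>F * h'\<close> costs at most \<open>M * (g b - g a)\<close>; the other two
  terms are boundary values.\<close>

lemma integral_by_parts_bound:
  fixes F f h h' :: "real \<Rightarrow> complex" and g g' :: "real \<Rightarrow> real"
  assumes ab: "a \<le> b"
    and F: "\<And>x. x \<in> {a..b} \<Longrightarrow> (F has_vector_derivative f x) (at x within {a..b})"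
    and h: "\<And>x. x \<in> {a..b} \<Longrightarrow> (h has_vector_derivative h' x) (at x within {a..b})"
    and g: "\<And>x. x \<in> {a..b} \<Longrightarrow> (g has_vector_derivative g' x) (at x within {a..b})"
    and cf: "continuous_on {a..b} f" and ch: "continuous_on {a..b} h'"
    and M: "\<And>x. x \<in> {a..b} \<Longrightarrow> norm (F x) \<le> M"
    and le: "\<And>x. x \<in> {a..b} \<Longrightarrow> norm (h' x) \<le> g' x"
  shows "norm (integral {a..b} (\<lambda>x. f x * h x)) \<le> M * (norm (h a) + norm (h b) + g b - g a)"
proof -
  have cF: "continuous_on {a..b} F" and chh: "continuous_on {a..b} h"
    by (rule continuous_on_vector_derivative[OF F], assumption)
      (rule continuous_on_vector_derivative[OF h], assumption)
  have "((\<lambda>x. F x * h' x + f x * h x) has_integral F b * h b - F a * h a) {a..b}"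
    by (rule fundamental_theorem_of_calculus[OF ab has_vector_derivative_mult[OF F h]])
  hence "integral {a..b} (\<lambda>x. F x * h' x + f x * h x) = F b * h b - F a * h a"
    by (rule integral_unique)
  moreover have i1: "(\<lambda>x. F x * h' x) integrable_on {a..b}"
    by (intro integrable_continuous_interval continuous_on_mult cF ch)
  moreover have i2: "(\<lambda>x. f x * h x) integrable_on {a..b}"
    by (intro integrable_continuous_interval continuous_on_mult cf chh)
  ultimately have eq: "integral {a..b} (\<lambda>x. f x * h x) =
      F b * h b - F a * h a - integral {a..b} (\<lambda>x. F x * h' x)"
    by (simp add: Henstock_Kurzweil_Integration.integral_add algebra_simps)
  have gi: "(g' has_integral g b - g a) {a..b}"
    by (rule fundamental_theorem_of_calculus[OF ab g])
  have "norm (integral {a..b} (\<lambda>x. F x * h' x)) \<le> integral {a..b} (\<lambda>x. M * g' x)"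
  proof (rule integral_norm_bound_integral[OF i1])
    show "(\<lambda>x. M * g' x) integrable_on {a..b}" using gi by (intro integrable_on_mult_right) auto
    fix x assume x: "x \<in> {a..b}"
    have "0 \<le> M" using M[OF x] norm_ge_zero order_trans by blast
    thus "norm (F x * h' x) \<le> M * g' x"
      using M[OF x] le[OF x] by (auto simp: norm_mult intro!: mult_mono)
  qed
  also have "\<dots> = M * (g b - g a)" using gi by (simp add: integral_unique)
  finally have *: "norm (integral {a..b} (\<lambda>x. F x * h' x)) \<le> M * (g b - g a)" .
  have "norm (F b * h b) \<le> M * norm (h b)" "norm (F a * h a) \<le> M * norm (h a)"
    using M ab by (auto simp: norm_mult intro!: mult_right_mono)
  hence "norm (F b * h b - F a * h a - integral {a..b} (\<lambda>x. F x * h' x)) \<le> M * norm (h b) + M * norm (h a) + M * (g b - g a)"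
    using * norm_triangle_ineq4 by (smt (verit, best))
  thus ?thesis unfolding eq by (simp add: algebra_simps)
qed

lemma has_vector_derivative_cis_poly [derivative_intros]:
  "((\<lambda>x. cis (poly p x)) has_vector_derivative \<i> * of_real (poly (pderiv p) x) * cis (poly p x)) (at x within S)"
proof -
  have "((\<lambda>x. poly p x) has_derivative (*) (poly (pderiv p) x)) (at x within S)"
    using poly_DERIV[of p x] by (auto simp: has_field_derivative_def intro: has_derivative_at_withinI)
  from has_derivative_cis[OF this] show ?thesis
    by (simp add: has_vector_derivative_def scaleR_conv_of_real mult_ac)
qed

lemma continuous_on_cis_poly [continuous_intros]: "continuous_on S (\<lambda>x. cis (poly p x))"
  by (intro continuous_intros)

text \<open>The integrand is \<open>(\<i> * p' * cis p) * (- \<i> / p')\<close>, where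
  \<open>p'\<close> is the derivative of \<open>p\<close>; the first factor has the bounded
  primitive \<open>cis p\<close>, so one integrates by parts. As \<open>p'\<close> is monotone,
  \<open>1 / p'\<close> has variation at most 1; each boundary term is at most 1 as well, whence 3.
  The sign \<open>\<sigma>\<close> records whether \<open>p'\<close> increases or decreases.\<close>

lemma van_der_corput_first:
  fixes p :: "real poly" and \<sigma> :: real
  assumes ab: "a \<le> b" and \<sigma>: "\<bar>\<sigma>\<bar> = 1"
    and p1: "\<And>x. x \<in> {a..b} \<Longrightarrow> 1 \<le> poly (pderiv p) x"
    and p2: "\<And>x. x \<in> {a..b} \<Longrightarrow> 0 \<le> \<sigma> * poly (pderiv (pderiv p)) x"
  shows "norm (integral {a..b} (\<lambda>x. cis (poly p x))) \<le> 3"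
proof -
  define d where "d = poly (pderiv p)"
  define d' where "d' = poly (pderiv (pderiv p))"
  have d0: "d x \<noteq> 0" if "x \<in> {a..b}" for x using p1[OF that] by (simp add: d_def)
  have dd: "(d has_vector_derivative d' x) (at x within {a..b})" for x
    unfolding d_def d'_def
    using poly_DERIV has_field_derivative_at_within has_real_derivative_iff_has_vector_derivative by blast
  have g: "((\<lambda>x. - \<sigma> / d x) has_vector_derivative \<sigma> * d' x / (d x)\<^sup>2) (at x within {a..b})" if "x \<in> {a..b}" for x
  proof -
    have "(d has_real_derivative d' x) (at x within {a..b})"
      using dd by (simp add: has_real_derivative_iff_has_vector_derivative)
    hence "((\<lambda>x. - \<sigma> / d x) has_real_derivative \<sigma> * d' x / (d x)\<^sup>2) (at x within {a..b})"
      using d0[OF that] by (auto intro!: derivative_eq_intros simp: power2_eq_square)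
    thus ?thesis by (simp add: has_real_derivative_iff_has_vector_derivative)
  qed
  have h: "((\<lambda>x. - \<i> / of_real (d x)) has_vector_derivative \<i> * of_real (d' x / (d x)\<^sup>2)) (at x within {a..b})"
    if "x \<in> {a..b}" for x
  proof -
    have "((\<lambda>x. inverse (d x)) has_real_derivative - d' x / (d x)\<^sup>2) (at x within {a..b})"
      using DERIV_inverse'[OF dd[of x, folded has_real_derivative_iff_has_vector_derivative] d0[OF that]]
      by (simp add: power2_eq_square field_simps)
    from has_vector_derivative_mult_right[OF has_vector_derivative_of_real[OF this], of "-\<i>"]
    show ?thesis by (simp add: divide_inverse)
  qed
  have "norm (integral {a..b} (\<lambda>x. (\<i> * of_real (d x) * cis (poly p x)) * (- \<i> / of_real (d x))))
     \<le> 1 * (norm (- \<i> / of_real (d a)) + norm (- \<i> / of_real (d b)) + (- \<sigma> / d b) - (- \<sigma> / d a))"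
  proof (rule integral_by_parts_bound[OF ab _ h g])
    show "continuous_on {a..b} (\<lambda>x. \<i> * complex_of_real (d x) * cis (poly p x))"
      unfolding d_def by (intro continuous_intros)
    show "continuous_on {a..b} (\<lambda>x. \<i> * complex_of_real (d' x / (d x)\<^sup>2))"
      using d0 unfolding d_def d'_def by (intro continuous_intros) auto
    show "cmod (\<i> * complex_of_real (d' x / (d x)\<^sup>2)) \<le> \<sigma> * d' x / (d x)\<^sup>2" if "x \<in> {a..b}" for x
      using p2[OF that] \<sigma> by (auto simp: norm_mult norm_divide norm_power d'_def[symmetric] abs_if divide_right_mono split: if_splits)
  qed (auto simp: d_def intro!: derivative_eq_intros has_vector_derivative_cis_poly)
  also have "integral {a..b} (\<lambda>x. (\<i> * of_real (d x) * cis (poly p x)) * (- \<i> / of_real (d x))) =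
      integral {a..b} (\<lambda>x. cis (poly p x))"
    by (rule Henstock_Kurzweil_Integration.integral_cong) (use d0 in \<open>auto simp: complex_eq_iff\<close>)
  also have "1 * (norm (- \<i> / of_real (d a)) + norm (- \<i> / of_real (d b)) + (- \<sigma> / d b) - (- \<sigma> / d a)) \<le> 3"
  proof -
    have "1 \<le> d a" "1 \<le> d b" using p1 ab by (auto simp: d_def)
    hence n: "norm (- \<i> / of_real (d a) :: complex) = 1 / d a" "norm (- \<i> / of_real (d b) :: complex) = 1 / d b"
      and "1 / d a \<le> 1" "1 / d b \<le> 1" "0 \<le> 1 / d a" "0 \<le> 1 / d b" by (auto simp: norm_divide)
    moreover have "- \<sigma> / d b - (- \<sigma> / d a) \<le> 1"
    proof -
      have "\<sigma> * u - \<sigma> * v \<le> 1" if "0 \<le> u" "0 \<le> v" "u \<le> 1" "v \<le> 1" for u v :: real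
      proof -
        have "\<sigma> = 1 \<or> \<sigma> = -1" using \<sigma> by linarith
        thus ?thesis using that by auto
      qed
      from this[of "1 / d a" "1 / d b"] show ?thesis using calculation by simp
    qed
    moreover have "1 * (A + B + C - D) \<le> 3" if "A \<le> 1" "B \<le> 1" "C - D \<le> 1" for A B C D :: real
      using that by simp
    ultimately show ?thesis unfolding n by blast
  qed
  finally show ?thesis .
qed

text \<open>\<open>c\<close> is the zero of \<open>q\<close> or, if \<open>q\<close> keeps its sign,
  the endpoint where \<open>\<bar>q\<bar>\<close> is smallest. Slope at least 1 makes
  \<open>\<bar>q\<bar>\<close> at least the distance to \<open>c\<close>.\<close>

lemma increasing_crossing:
  fixes q q' :: "real \<Rightarrow> real"
  assumes ab: "a \<le> b"
    and q: "\<And>x. x \<in> {a..b} \<Longrightarrow> (q has_real_derivative q' x) (at x)"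
    and q': "\<And>x. x \<in> {a..b} \<Longrightarrow> 1 \<le> q' x"
  obtains c where "c \<in> {a..b}" "\<And>x. x \<in> {a..b} \<Longrightarrow> c + 1 \<le> x \<Longrightarrow> 1 \<le> q x"
    "\<And>x. x \<in> {a..b} \<Longrightarrow> x \<le> c - 1 \<Longrightarrow> q x \<le> - 1"
proof -
  have grow: "v - u \<le> q v - q u" if "a \<le> u" "u \<le> v" "v \<le> b" for u v
  proof (cases "u = v")
    case False
    hence "u < v" using that by simp
    moreover have "(q has_real_derivative q' x) (at x)" if "u \<le> x" "x \<le> v" for x
      using q[of x] that \<open>a \<le> u\<close> \<open>v \<le> b\<close> by simp
    ultimately obtain z where z: "u < z" "z < v" "q v - q u = (v - u) * q' z"
      using MVT2[of u v q q'] by blast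
    have "1 \<le> q' z" using q'[of z] z that by simp
    thus ?thesis using z that mult_left_mono[of 1 "q' z" "v - u"] by simp
  qed auto
  have cont: "continuous_on {a..b} q"
    by (rule DERIV_continuous_on, rule has_field_derivative_at_within[OF q])
  consider "0 \<le> q a" | "q b \<le> 0" | "q a < 0" "0 < q b" by linarith
  thus thesis
  proof cases
    case 1
    show ?thesis
    proof (rule that[of a])
      show "1 \<le> q x" if "x \<in> {a..b}" "a + 1 \<le> x" for x using 1 grow[of a x] that by simp
    qed (use ab in auto)
  next
    case 2
    show ?thesis
    proof (rule that[of b])
      show "q x \<le> - 1" if "x \<in> {a..b}" "x \<le> b - 1" for x using 2 grow[of x b] that by simp
    qed (use ab in auto)
  next
    case 3
    then obtain c where c: "a \<le> c" "c \<le> b" "q c = 0"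
      using IVT'[of q a 0 b] ab cont by auto
    show ?thesis
    proof (rule that[of c])
      show "1 \<le> q x" if "x \<in> {a..b}" "c + 1 \<le> x" for x using c grow[of c x] that by simp
      show "q x \<le> - 1" if "x \<in> {a..b}" "x \<le> c - 1" for x using c grow[of x c] that by simp
    qed (use c in auto)
  qed
qed

lemma integral_split_crossing:
  fixes f :: "real \<Rightarrow> complex" and q q' :: "real \<Rightarrow> real"
  assumes ab: "a \<le> b"
    and q: "\<And>x. x \<in> {a..b} \<Longrightarrow> (q has_real_derivative q' x) (at x)"
    and q': "\<And>x. x \<in> {a..b} \<Longrightarrow> 1 \<le> q' x"
    and f: "continuous_on {a..b} f" and f1: "\<And>x. x \<in> {a..b} \<Longrightarrow> norm (f x) \<le> 1"
    and left: "\<And>u. u \<in> {a..b} \<Longrightarrow> (\<And>x. x \<in> {a..u} \<Longrightarrow> q x \<le> - 1) \<Longrightarrow> norm (integral {a..u} f) \<le> C"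
    and right: "\<And>u. u \<in> {a..b} \<Longrightarrow> (\<And>x. x \<in> {u..b} \<Longrightarrow> 1 \<le> q x) \<Longrightarrow> norm (integral {u..b} f) \<le> C"
    and C: "0 \<le> C"
  shows "norm (integral {a..b} f) \<le> 2 * C + 2"
proof -
  obtain c where c: "c \<in> {a..b}" and r: "\<And>x. x \<in> {a..b} \<Longrightarrow> c + 1 \<le> x \<Longrightarrow> 1 \<le> q x"
    and l: "\<And>x. x \<in> {a..b} \<Longrightarrow> x \<le> c - 1 \<Longrightarrow> q x \<le> - 1"
    using increasing_crossing[OF ab q q'] by blast
  define u where "u = max a (c - 1)"
  define v where "v = min b (c + 1)"
  have uv: "a \<le> u" "u \<le> v" "v \<le> b" "v - u \<le> 2" using c by (auto simp: u_def v_def)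
  have int: "f integrable_on {x..y}" if "a \<le> x" "y \<le> b" for x y
    by (rule integrable_continuous_interval, rule continuous_on_subset[OF f]) (use that in auto)
  have "integral {a..u} f + integral {u..v} f + integral {v..b} f = integral {a..b} f"
    using uv by (simp add: Henstock_Kurzweil_Integration.integral_combine int)
  moreover have "norm (integral {a..u} f) \<le> C"
  proof (cases "u = a")
    case False
    show ?thesis by (rule left) (use False uv l in \<open>auto simp: u_def\<close>)
  qed (simp add: C)
  moreover have "norm (integral {v..b} f) \<le> C"
  proof (cases "v = b")
    case False
    show ?thesis by (rule right) (use False uv r in \<open>auto simp: v_def\<close>)
  qed (simp add: C)
  moreover have "norm (integral {u..v} f) \<le> 2"
  proof -
    have "norm (integral {u..v} f) \<le> 1 * (v - u)"
      by (rule integral_bound) (use uv f1 in \<open>auto intro: continuous_on_subset[OF f]\<close>)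
    thus ?thesis using uv by simp
  qed
  ultimately show ?thesis
    by (smt (verit, best) norm_triangle_ineq)
qed

text \<open>Negating the phase conjugates the integral, so the case of a derivative at most -1
  reduces to that of a derivative at least 1.\<close>

lemma norm_integral_cis_minus:
  "norm (integral S (\<lambda>x. cis (poly (- p) x))) = norm (integral S (\<lambda>x. cis (poly p x)))"
proof -
  have "integral S (\<lambda>x. cis (poly (- p) x)) = cnj (integral S (\<lambda>x. cis (poly p x)))"
    by (simp add: Henstock_Kurzweil_Integration.integral_cnj cis_cnj)
  thus ?thesis by simp
qed

lemma higher_pderiv_minus: "(pderiv ^^ k) (- p) = - (pderiv ^^ k) (p :: real poly)"
  using higher_pderiv_smult[of k "-1" p] by simp

text \<open>
  If a function has derivative at least 1, it lies in \<open>[-1, 1]\<close> only on an interval of length at most 2;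
  off that interval the induction hypothesis applies.
\<close>

lemma van_der_corput:
  "\<exists>C\<ge>0. \<forall>(p::real poly) a b. a \<le> b \<longrightarrow> (\<forall>x\<in>{a..b}. 1 \<le> poly ((pderiv ^^ Suc (Suc k)) p) x) \<longrightarrow>
      norm (integral {a..b} (\<lambda>x. cis (poly p x))) \<le> C"
proof (induction k)
  case 0
  show ?case
  proof (intro exI[of _ 8] conjI allI impI)
    fix p :: "real poly" and a b :: real
    assume ab: "a \<le> b" and p: "\<forall>x\<in>{a..b}. 1 \<le> poly ((pderiv ^^ Suc (Suc 0)) p) x"
    have p2: "1 \<le> poly (pderiv (pderiv p)) x" if "x \<in> {a..b}" for x using p that by simp
    have "norm (integral {a..b} (\<lambda>x. cis (poly p x))) \<le> 2 * 3 + 2"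
    proof (rule integral_split_crossing[OF ab, of "poly (pderiv p)" "poly (pderiv (pderiv p))"])
      fix u assume u: "u \<in> {a..b}" and q: "\<And>x. x \<in> {a..u} \<Longrightarrow> poly (pderiv p) x \<le> - 1"
      have "norm (integral {a..u} (\<lambda>x. cis (poly (- p) x))) \<le> 3"
      \<comment> \<open>On this piece \<open>- p\<close> has derivative at least 1, and that
        derivative decreases because the second derivative of \<open>p\<close> is positive; hence
        the sign \<open>- 1\<close>.\<close>
      proof (rule van_der_corput_first[of a u "-1"])
        show "1 \<le> poly (pderiv (- p)) x" if "x \<in> {a..u}" for x
          using q[OF that] by (simp add: pderiv_minus)
        show "0 \<le> - 1 * poly (pderiv (pderiv (- p))) x" if "x \<in> {a..u}" for x
          using p2[of x] that u by (simp add: pderiv_minus)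
      qed (use u in auto)
      thus "norm (integral {a..u} (\<lambda>x. cis (poly p x))) \<le> 3" by (simp only: norm_integral_cis_minus)
    next
      fix u assume u: "u \<in> {a..b}" and q: "\<And>x. x \<in> {u..b} \<Longrightarrow> 1 \<le> poly (pderiv p) x"
      show "norm (integral {u..b} (\<lambda>x. cis (poly p x))) \<le> 3"
      proof (rule van_der_corput_first[of u b 1])
        show "0 \<le> 1 * poly (pderiv (pderiv p)) x" if "x \<in> {u..b}" for x
          using p2[of x] that u by simp
      qed (use u q in auto)
    next
      show "(poly (pderiv p) has_real_derivative poly (pderiv (pderiv p)) x) (at x)" for x by (rule poly_DERIV)
      show "continuous_on {a..b} (\<lambda>x. cis (poly p x))" by (rule continuous_on_cis_poly)
    qed (use p2 in auto)
    thus "norm (integral {a..b} (\<lambda>x. cis (poly p x))) \<le> 8" by simp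
  qed simp
next
  case (Suc k)
  then obtain C where C: "0 \<le> C" and IH: "\<And>(p::real poly) a b. a \<le> b \<Longrightarrow>
      (\<And>x. x \<in> {a..b} \<Longrightarrow> 1 \<le> poly ((pderiv ^^ Suc (Suc k)) p) x) \<Longrightarrow>
      norm (integral {a..b} (\<lambda>x. cis (poly p x))) \<le> C" by blast
  show ?case
  proof (intro exI[of _ "2 * C + 2"] conjI allI impI)
    fix p :: "real poly" and a b :: real
    assume ab: "a \<le> b" and p: "\<forall>x\<in>{a..b}. 1 \<le> poly ((pderiv ^^ Suc (Suc (Suc k))) p) x"
    define q where "q = (pderiv ^^ Suc (Suc k)) p"
    show "norm (integral {a..b} (\<lambda>x. cis (poly p x))) \<le> 2 * C + 2"
    proof (rule integral_split_crossing[OF ab, of "poly q" "poly (pderiv q)"])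
      fix u assume u: "u \<in> {a..b}" and q: "\<And>x. x \<in> {a..u} \<Longrightarrow> poly q x \<le> - 1"
      have "norm (integral {a..u} (\<lambda>x. cis (poly (- p) x))) \<le> C"
      proof (rule IH)
        show "1 \<le> poly ((pderiv ^^ Suc (Suc k)) (- p)) x" if "x \<in> {a..u}" for x
          using q[OF that] unfolding higher_pderiv_minus q_def[symmetric] by simp
      qed (use u in auto)
      thus "norm (integral {a..u} (\<lambda>x. cis (poly p x))) \<le> C" by (simp only: norm_integral_cis_minus)
    next
      fix u assume u: "u \<in> {a..b}" and q: "\<And>x. x \<in> {u..b} \<Longrightarrow> 1 \<le> poly q x"
      show "norm (integral {u..b} (\<lambda>x. cis (poly p x))) \<le> C"
        by (rule IH) (use u q in \<open>simp_all only: q_def[symmetric] atLeastAtMost_iff\<close>)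
    next
      show "(poly q has_real_derivative poly (pderiv q) x) (at x)" for x by (rule poly_DERIV)
      show "continuous_on {a..b} (\<lambda>x. cis (poly p x))" by (rule continuous_on_cis_poly)
      show "1 \<le> poly (pderiv q) x" if "x \<in> {a..b}" for x using p that by (simp add: q_def)
    qed (use C in auto)
  qed (use C in auto)
qed

section \<open>Truncated oscillatory integrals with kernel 1 / (i k), their tails and their
  dependence on the phase\<close>

text \<open>This is the exponent of a jump term at time \<open>t\<close>: \<open>d\<close> stands
  for the position relative to the node, \<open>b j\<close> for
  \<open>\<omega> j * t\<close>.\<close>

definition phase :: "nat \<Rightarrow> real \<Rightarrow> (nat \<Rightarrow> real) \<Rightarrow> real \<Rightarrow> real" where
  "phase n d b x = d * x - (\<Sum>j=2..n. b j * x ^ j)"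

text \<open>
  \<open>osc n d b a B\<close> is the integral of \<open>exp (\<i> * phase n d b k) / (\<i> * k)\<close> over \<open>a < |k| < B\<close>.
\<close>

definition osc :: "nat \<Rightarrow> real \<Rightarrow> (nat \<Rightarrow> real) \<Rightarrow> real \<Rightarrow> real \<Rightarrow> complex" where
  "osc n d b a B = integral {a..B}
     (\<lambda>x. (cis (phase n d b x) - cis (phase n d b (- x))) / (\<i> * of_real x))"

text \<open>Both ends go to infinity together, as in the symmetric truncation of the inverse
  transform.\<close>

definition osc_lim :: "nat \<Rightarrow> real \<Rightarrow> (nat \<Rightarrow> real) \<Rightarrow> real \<Rightarrow> complex" where
  "osc_lim n d b a = Lim at_top (osc n d b a)"

lemma continuous_on_phase [continuous_intros]:
  "continuous_on S f \<Longrightarrow> continuous_on S (\<lambda>x. phase n d b (f x))"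
  unfolding phase_def by (intro continuous_intros)

lemma phase_minus: "phase n d b (- x) = phase n (- d) (\<lambda>j. (- 1) ^ j * b j) x"
  unfolding phase_def by (simp add: power_minus[of x] mult_ac)

lemma phase_poly:
  assumes "2 \<le> n"
  obtains p :: "real poly" where "\<And>x. poly p x = phase n d b x" "(pderiv ^^ n) p = [:- (fact n * b n):]"
proof
  define p where "p = monom d 1 - (\<Sum>j=2..n. monom (b j) j)"
  show "poly p x = phase n d b x" for x
    by (simp add: p_def phase_def poly_sum poly_monom)
  have "coeff ((pderiv ^^ n) p) i = coeff [:- (fact n * b n):] i" for i
  proof -
    have "coeff p (i + n) = (if i = 0 then - b n else 0)"
      using assms by (auto simp: p_def coeff_sum)
    thus ?thesis
      by (auto simp: coeff_higher_pderiv pochhammer_fact coeff_pCons split: nat.splits)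
  qed
  thus "(pderiv ^^ n) p = [:- (fact n * b n):]" by (intro poly_eqI)
qed

text \<open>The \<open>n\<close>-th derivative of the phase is the constant
  \<open>- (fact n * b n)\<close>, whatever \<open>d\<close> and the lower coefficients are. Van der
  Corput's constant therefore depends on \<open>n\<close> only, and this is the source of all
  uniformity in position and time.\<close>

lemma integral_cis_phase_bound:
  assumes "2 \<le> n"
  shows "\<exists>C\<ge>0. \<forall>d b u v. u \<le> v \<longrightarrow> 1 \<le> \<bar>b n\<bar> \<longrightarrow> norm (integral {u..v} (\<lambda>x. cis (phase n d b x))) \<le> C"
proof -
  obtain m where n: "n = Suc (Suc m)" using assms by (metis Suc_le_D numeral_2_eq_2 Suc_le_mono)
  obtain C where C: "0 \<le> C" and vdc: "\<And>(p::real poly) a b. a \<le> b \<Longrightarrow>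
      (\<And>x. x \<in> {a..b} \<Longrightarrow> 1 \<le> poly ((pderiv ^^ n) p) x) \<Longrightarrow>
      norm (integral {a..b} (\<lambda>x. cis (poly p x))) \<le> C"
    using van_der_corput[of m] unfolding n by blast
  show ?thesis
  proof (intro exI[of _ C] conjI allI impI C)
    fix d :: real and b :: "nat \<Rightarrow> real" and u v :: real
    assume uv: "u \<le> v" and b: "1 \<le> \<bar>b n\<bar>"
    obtain p :: "real poly" where p: "\<And>x. poly p x = phase n d b x" "(pderiv ^^ n) p = [:- (fact n * b n):]"
      using phase_poly[OF assms] by blast
    have "1 * 1 \<le> fact n * \<bar>b n\<bar>" using b by (intro mult_mono) auto
    hence "1 \<le> - (fact n * b n) \<or> 1 \<le> fact n * b n" by (auto simp: abs_if split: if_splits)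
    hence "norm (integral {u..v} (\<lambda>x. cis (poly p x))) \<le> C"
    proof
      assume "1 \<le> - (fact n * b n)"
      thus ?thesis by (intro vdc uv) (simp add: p)
    next
      assume "1 \<le> fact n * b n"
      hence "norm (integral {u..v} (\<lambda>x. cis (poly (- p) x))) \<le> C"
        by (intro vdc uv) (simp add: higher_pderiv_minus p)
      thus ?thesis by (simp only: norm_integral_cis_minus)
    qed
    thus "norm (integral {u..v} (\<lambda>x. cis (phase n d b x))) \<le> C" by (simp add: p)
  qed
qed

text \<open>Integration by parts with amplitude \<open>1 / x\<close>: the boundary values
  \<open>1 / a\<close> and \<open>1 / B\<close> and the variation \<open>1 / a - 1 / B\<close> add
  up to \<open>2 / a\<close>.\<close>

lemma integral_over_x_bound:
  fixes f :: "real \<Rightarrow> complex"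
  assumes a: "0 < a" "a \<le> B" and f: "continuous_on {a..B} f"
    and M: "\<And>x. x \<in> {a..B} \<Longrightarrow> norm (integral {a..x} f) \<le> M"
  shows "norm (integral {a..B} (\<lambda>x. f x / of_real x)) \<le> 2 * M / a"
proof -
  have "norm (integral {a..B} (\<lambda>x. f x * of_real (inverse x))) \<le>
     M * (norm (of_real (inverse a) :: complex) + norm (of_real (inverse B) :: complex) + (- inverse B) - (- inverse a))"
  proof (rule integral_by_parts_bound[where F = "\<lambda>x. integral {a..x} f"
      and h' = "\<lambda>x. - of_real (inverse (x\<^sup>2))" and g' = "\<lambda>x. inverse (x\<^sup>2)"])
    show "((\<lambda>x. integral {a..x} f) has_vector_derivative f x) (at x within {a..B})" if "x \<in> {a..B}" for x
      by (rule integral_has_vector_derivative[OF f that])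
    have inv: "((\<lambda>x. inverse x) has_real_derivative - inverse (x\<^sup>2)) (at x within {a..B})" if "x \<in> {a..B}" for x
      using that a by (auto intro!: derivative_eq_intros simp: power2_eq_square)
    show "((\<lambda>x. complex_of_real (inverse x)) has_vector_derivative - of_real (inverse (x\<^sup>2))) (at x within {a..B})"
      if "x \<in> {a..B}" for x
      using has_vector_derivative_of_real[OF inv[OF that]] by (simp only: of_real_minus)
    show "((\<lambda>x. - inverse x) has_vector_derivative inverse (x\<^sup>2)) (at x within {a..B})" if "x \<in> {a..B}" for x
      using DERIV_minus[OF inv[OF that]] by (simp add: has_real_derivative_iff_has_vector_derivative)
    show "continuous_on {a..B} (\<lambda>x. - complex_of_real (inverse (x\<^sup>2)))"
      using a by (intro continuous_intros) auto
  qed (use a f M in \<open>auto simp: norm_inverse norm_power\<close>)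
  also have "\<dots> = 2 * M / a" using a by (simp add: norm_inverse divide_inverse algebra_simps)
  finally show ?thesis by (simp add: divide_inverse)
qed

text \<open>Reflection turns the phase into another one of the same family with the same
  \<open>\<bar>b n\<bar>\<close>, so estimates on the positive half-line cover both halves.\<close>

lemma osc_halves:
  assumes a: "0 < a"
  shows "osc n d b a B = (integral {a..B} (\<lambda>x. cis (phase n d b x) / of_real x) -
    integral {a..B} (\<lambda>x. cis (phase n (- d) (\<lambda>j. (- 1) ^ j * b j) x) / of_real x)) / \<i>"
proof -
  have i: "(\<lambda>x. cis (phase n d b x) / of_real x) integrable_on {a..B}" for d b
    using a by (intro integrable_continuous_interval continuous_intros) auto
  have "osc n d b a B = integral {a..B} (\<lambda>x. (cis (phase n d b x) / of_real x -
     cis (phase n (- d) (\<lambda>j. (- 1) ^ j * b j) x) / of_real x) * (1 / \<i>))"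
    unfolding osc_def phase_minus
    by (intro Henstock_Kurzweil_Integration.integral_cong) (simp only: diff_divide_distrib left_diff_distrib times_divide_times_eq mult_1_right mult.commute[of \<i>])
  thus ?thesis by (simp add: Henstock_Kurzweil_Integration.integral_diff[OF i i])
qed

text \<open>The measure dk / k is scale invariant, so a substitution changes coefficients and
  endpoints but produces no prefactor.\<close>

lemma osc_scale:
  assumes s: "0 < s"
  shows "osc n d b a B = osc n (d / s) (\<lambda>j. b j / s ^ j) (s * a) (s * B)"
proof -
  define g where "g = (\<lambda>x. (cis (phase n (d / s) (\<lambda>j. b j / s ^ j) x) -
      cis (phase n (d / s) (\<lambda>j. b j / s ^ j) (- x))) / (\<i> * of_real x))"
  have ph: "phase n (d / s) (\<lambda>j. b j / s ^ j) (s * x) = phase n d b x" for x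
    using s by (simp add: phase_def power_mult_distrib)
  have "(\<lambda>x. x / s) ` {s * a..s * B} = {a..B}"
    using s by (auto simp: image_iff field_simps intro!: bexI[of _ "s * _"])
  hence "integral {a..B} (\<lambda>x. g (s * x)) = (1 / s) *\<^sub>R integral {s * a..s * B} g"
    using integral_stretch_real[of s "s * a" "s * B" g] s by simp
  moreover have "integral {a..B} (\<lambda>x. g (s * x)) = integral {a..B} (\<lambda>x. (1 / s) *\<^sub>R
     ((cis (phase n d b x) - cis (phase n d b (- x))) / (\<i> * of_real x)))"
    using s ph ph[of "- x" for x]
    by (intro Henstock_Kurzweil_Integration.integral_cong) (simp add: g_def scaleR_conv_of_real mult_ac)
  ultimately show ?thesis using s by (simp add: osc_def g_def)
qed

lemma osc_combine:
  assumes "0 < a" "a \<le> u" "u \<le> B"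
  shows "osc n d b a B = osc n d b a u + osc n d b u B"
  unfolding osc_def
  by (rule Henstock_Kurzweil_Integration.integral_combine[symmetric])
    (use assms in \<open>auto intro!: integrable_continuous_interval continuous_intros\<close>)

lemma half_tail_bound:
  assumes "2 \<le> n"
  shows "\<exists>C\<ge>0. \<forall>d b a B. 1 \<le> \<bar>b n\<bar> \<longrightarrow> 0 < a \<longrightarrow> a \<le> B \<longrightarrow>
    norm (integral {a..B} (\<lambda>x. cis (phase n d b x) / of_real x)) \<le> C / a"
proof -
  obtain C where C: "0 \<le> C" and le: "\<And>d b u v. u \<le> v \<Longrightarrow> 1 \<le> \<bar>b n\<bar> \<Longrightarrow>
      norm (integral {u..v} (\<lambda>x. cis (phase n d b x))) \<le> C"
    using integral_cis_phase_bound[OF assms] by blast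
  show ?thesis
  proof (intro exI[of _ "2 * C"] conjI allI impI)
    fix d :: real and b :: "nat \<Rightarrow> real" and a B :: real
    assume "1 \<le> \<bar>b n\<bar>" "0 < a" "a \<le> B"
    thus "norm (integral {a..B} (\<lambda>x. cis (phase n d b x) / of_real x)) \<le> 2 * C / a"
      by (intro integral_over_x_bound continuous_intros) (auto intro: le)
  qed (use C in auto)
qed

text \<open>Scaling by \<open>s\<close> normalises the leading coefficient to modulus 1 and moves
  the cut to \<open>s * a\<close>. Hence the tail beyond \<open>K / s\<close> is at most
  \<open>C / K\<close>, for every time and position.\<close>

lemma osc_tail_bound:
  assumes "2 \<le> n"
  shows "\<exists>C\<ge>0. \<forall>d b a B s. 0 < s \<longrightarrow> \<bar>b n\<bar> = s ^ n \<longrightarrow> 0 < a \<longrightarrow> a \<le> B \<longrightarrow> norm (osc n d b a B) \<le> C / (s * a)"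
proof -
  obtain C where C: "0 \<le> C" and half: "\<And>d b a B. 1 \<le> \<bar>b n\<bar> \<Longrightarrow> 0 < a \<Longrightarrow> a \<le> B \<Longrightarrow>
      norm (integral {a..B} (\<lambda>x. cis (phase n d b x) / of_real x)) \<le> C / a"
    using half_tail_bound[OF assms] by blast
  have unit: "norm (osc n d b a B) \<le> 2 * C / a" if "0 < a" "a \<le> B" "1 \<le> \<bar>b n\<bar>" for d a B and b :: "nat \<Rightarrow> real"
  proof -
    have "\<bar>(- 1) ^ n * b n\<bar> = \<bar>b n\<bar>" by (simp add: abs_mult)
    hence "norm (osc n d b a B) \<le> C / a + C / a"
      unfolding osc_halves[OF that(1)] norm_divide norm_ii div_by_1
      using half[of b a B d] half[of "\<lambda>j. (- 1) ^ j * b j" a B "- d"] that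
      by (intro order_trans[OF norm_triangle_ineq4] add_mono) simp_all
    thus ?thesis by simp
  qed
  show ?thesis
  proof (intro exI[of _ "2 * C"] conjI allI impI)
    fix d :: real and b :: "nat \<Rightarrow> real" and a B s :: real
    assume s: "0 < s" "\<bar>b n\<bar> = s ^ n" "0 < a" "a \<le> B"
    show "norm (osc n d b a B) \<le> 2 * C / (s * a)"
      unfolding osc_scale[OF s(1), of n d b a B] by (rule unit) (use s in \<open>auto simp: abs_mult\<close>)
  qed (use C in auto)
qed

text \<open>At \<open>t = 0\<close> the leading coefficient vanishes and only the offset oscillates,
  so \<open>d \<noteq> 0\<close> takes over the role of van der Corput's lemma. Each half
  contributes \<open>4 / (\<bar>d\<bar> * a)\<close>.\<close>

lemma osc_linear_bound:
  assumes d: "d \<noteq> 0" and a: "0 < a" "a \<le> B"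
  shows "norm (osc n d (\<lambda>_. 0) a B) \<le> 8 / (\<bar>d\<bar> * a)"
proof -
  have half: "norm (integral {a..B} (\<lambda>x. cis (phase n d (\<lambda>_. 0) x) / of_real x)) \<le> 2 * (2 / \<bar>d\<bar>) / a"
    if d: "d \<noteq> 0" for d
  proof (rule integral_over_x_bound[OF a])
    show "continuous_on {a..B} (\<lambda>x. cis (phase n d (\<lambda>_. 0) x))" by (intro continuous_intros)
    fix x assume x: "x \<in> {a..B}"
    have "((\<lambda>x. cis (d * x)) has_integral cis (d * x) / (\<i> * of_real d) - cis (d * a) / (\<i> * of_real d)) {a..x}"
    proof (rule fundamental_theorem_of_calculus)
      fix u
      have "((\<lambda>x. cis (poly [:0, d:] x)) has_vector_derivative \<i> * of_real (poly (pderiv [:0, d:]) u) * cis (poly [:0, d:] u)) (at u within {a..x})"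
        by (rule has_vector_derivative_cis_poly)
      hence "((\<lambda>x. cis (d * x)) has_vector_derivative \<i> * of_real d * cis (d * u)) (at u within {a..x})"
        by (simp add: pderiv_pCons mult_ac)
      from has_vector_derivative_divide[OF this, of "\<i> * of_real d"]
      show "((\<lambda>x. cis (d * x) / (\<i> * of_real d)) has_vector_derivative cis (d * u)) (at u within {a..x})"
        using d by simp
    qed (use x in auto)
    hence "integral {a..x} (\<lambda>x. cis (phase n d (\<lambda>_. 0) x)) = cis (d * x) / (\<i> * of_real d) - cis (d * a) / (\<i> * of_real d)"
      by (simp add: phase_def integral_unique)
    also have "norm \<dots> \<le> 1 / \<bar>d\<bar> + 1 / \<bar>d\<bar>"
      by (rule order_trans[OF norm_triangle_ineq4]) (simp add: norm_divide norm_mult)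
    finally show "norm (integral {a..x} (\<lambda>x. cis (phase n d (\<lambda>_. 0) x))) \<le> 2 / \<bar>d\<bar>" by simp
  qed
  have "norm (osc n d (\<lambda>_. 0) a B) \<le> 2 * (2 / \<bar>d\<bar>) / a + 2 * (2 / \<bar>- d\<bar>) / a"
    unfolding osc_halves[OF a(1)] norm_divide norm_ii div_by_1 using half[OF d] half[of "- d"] d
    by (intro order_trans[OF norm_triangle_ineq4] add_mono) simp_all
  thus ?thesis using a d by (simp add: field_simps)
qed

lemma norm_cis_diff_le: "norm (cis x - cis y) \<le> \<bar>x - y\<bar>"
proof -
  have "cis x - cis y = cis y * (exp (\<i> * of_real (x - y)) - 1)"
    by (simp add: cis_conv_exp algebra_simps flip: exp_add)
  moreover have "norm (exp (\<i> * of_real (x - y)) - 1 :: complex) \<le> \<bar>x - y\<bar>"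
    using iexp_approx1[of "x - y" 0] by simp
  ultimately show ?thesis by (simp add: norm_mult)
qed

text \<open>The factor \<open>\<bar>x\<bar>\<close> in the phase bound cancels the kernel
  \<open>1 / x\<close>, so the estimate does not degenerate as \<open>a\<close> tends to 0. The
  factor 2 accounts for the two half-lines.\<close>

lemma osc_diff_le:
  assumes a: "0 < a" "a \<le> B"
    and D: "\<And>x. \<bar>x\<bar> \<le> B \<Longrightarrow> \<bar>phase n d b x - phase n d' b' x\<bar> \<le> D * \<bar>x\<bar>"
  shows "norm (osc n d b a B - osc n d' b' a B) \<le> 2 * D * (B - a)"
proof -
  define f where "f = (\<lambda>d b x. (cis (phase n d b x) - cis (phase n d b (- x))) / (\<i> * of_real x))"
  have i: "f d b integrable_on {a..B}" for d b
    unfolding f_def using a by (intro integrable_continuous_interval continuous_intros) auto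
  have "osc n d b a B - osc n d' b' a B = integral {a..B} (\<lambda>x. f d b x - f d' b' x)"
    unfolding Henstock_Kurzweil_Integration.integral_diff[OF i i] by (simp add: osc_def f_def)
  also have "norm \<dots> \<le> 2 * D * (B - a)"
  proof (rule integral_bound)
    show "continuous_on {a..B} (\<lambda>x. f d b x - f d' b' x)"
      unfolding f_def using a by (intro continuous_intros) auto
    fix x assume x: "x \<in> {a..B}"
    have "f d b x - f d' b' x = ((cis (phase n d b x) - cis (phase n d' b' x)) -
        (cis (phase n d b (- x)) - cis (phase n d' b' (- x)))) / (\<i> * of_real x)"
      by (simp add: f_def diff_divide_distrib)
    also have "norm \<dots> \<le> (D * \<bar>x\<bar> + D * \<bar>- x\<bar>) / \<bar>x\<bar>"
    proof -
      have "norm (cis (phase n d b x) - cis (phase n d' b' x)) \<le> D * \<bar>x\<bar>"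
        using norm_cis_diff_le[of "phase n d b x" "phase n d' b' x"] D[of x] a x by simp
      moreover have "norm (cis (phase n d b (- x)) - cis (phase n d' b' (- x))) \<le> D * \<bar>- x\<bar>"
        using norm_cis_diff_le[of "phase n d b (- x)" "phase n d' b' (- x)"] D[of "- x"] a x by simp
      ultimately show ?thesis
        unfolding norm_divide norm_mult norm_ii norm_of_real mult_1
        by (intro divide_right_mono[OF order_trans[OF norm_triangle_ineq4 add_mono]]) auto
    qed
    also have "\<dots> = 2 * D" using x a by simp
    finally show "norm (f d b x - f d' b' x) \<le> 2 * D" .
  qed (use a in auto)
  finally show ?thesis .
qed

text \<open>The Cauchy rate survives in the limit; an explicit rate is what makes the later limits
  uniform in the parameters of \<open>f\<close>.\<close>

lemma tail_limit:
  fixes f :: "real \<Rightarrow> complex"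
  assumes a: "0 < a" and K: "\<And>B B'. a \<le> B \<Longrightarrow> B \<le> B' \<Longrightarrow> norm (f B' - f B) \<le> K / B"
  shows "(f \<longlongrightarrow> Lim at_top f) at_top" "\<And>B. a \<le> B \<Longrightarrow> norm (Lim at_top f - f B) \<le> K / B"
proof -
  have z: "((\<lambda>B. K / B) \<longlongrightarrow> 0) at_top" by real_asymp
  have "Cauchy (\<lambda>m. f (real m))"
  proof (rule metric_CauchyI)
    fix e :: real assume "0 < e"
    hence "\<forall>\<^sub>F B in at_top. K / B < e / 2" using z by (intro order_tendstoD) auto
    with eventually_ge_at_top[of a] have "\<forall>\<^sub>F B in at_top. K / B < e / 2 \<and> a \<le> B"
      by eventually_elim simp
    from eventually_compose_filterlim[OF this filterlim_real_sequentially]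
    obtain m0 where m0: "K / real m0 < e / 2" "a \<le> real m0"
      unfolding eventually_sequentially by blast
    show "\<exists>M. \<forall>m\<ge>M. \<forall>n\<ge>M. dist (f (real m)) (f (real n)) < e"
    proof (intro exI[of _ m0] allI impI)
      fix m n assume "m0 \<le> m" "m0 \<le> n"
      hence "dist (f (real m)) (f (real m0)) \<le> K / real m0" "dist (f (real n)) (f (real m0)) \<le> K / real m0"
        using K[of "real m0"] m0 by (auto simp: dist_norm)
      thus "dist (f (real m)) (f (real n)) < e"
        using m0 dist_triangle2[of "f (real m)" "f (real n)" "f (real m0)"] by linarith
    qed
  qed
  then obtain L where L: "(\<lambda>m. f (real m)) \<longlonglongrightarrow> L" by (auto simp: Cauchy_convergent_iff convergent_def)
  have bound: "norm (L - f B) \<le> K / B" if "a \<le> B" for B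
  proof (rule tendsto_upperbound)
    show "(\<lambda>m. norm (f (real m) - f B)) \<longlonglongrightarrow> norm (L - f B)" by (intro tendsto_intros L)
    show "\<forall>\<^sub>F m in sequentially. norm (f (real m) - f B) \<le> K / B"
      using eventually_compose_filterlim[OF eventually_ge_at_top[of B] filterlim_real_sequentially]
      by eventually_elim (use K that in auto)
  qed auto
  have "(f \<longlongrightarrow> L) at_top"
  proof (rule LIM_zero_cancel, rule Lim_null_comparison[OF _ z])
    show "\<forall>\<^sub>F B in at_top. norm (f B - L) \<le> K / B"
      using eventually_ge_at_top[of a] by eventually_elim (use bound in \<open>simp add: norm_minus_commute\<close>)
  qed
  moreover from this have "Lim at_top f = L" by (intro tendsto_Lim) auto
  ultimately show "(f \<longlongrightarrow> Lim at_top f) at_top" "\<And>B. a \<le> B \<Longrightarrow> norm (Lim at_top f - f B) \<le> K / B"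
    using bound by auto
qed


lemma osc_lim_bound:
  assumes "2 \<le> n"
  shows "\<exists>C\<ge>0. \<forall>d b a s. 0 < s \<longrightarrow> \<bar>b n\<bar> = s ^ n \<longrightarrow> 0 < a \<longrightarrow>
    (osc n d b a \<longlongrightarrow> osc_lim n d b a) at_top \<and>
    (\<forall>B\<ge>a. norm (osc_lim n d b a - osc n d b a B) \<le> C / (s * B))"
proof -
  obtain C where C: "0 \<le> C" and le: "\<And>d b a B s. 0 < s \<Longrightarrow> \<bar>b n\<bar> = s ^ n \<Longrightarrow> 0 < a \<Longrightarrow> a \<le> B \<Longrightarrow>
      norm (osc n d b a B) \<le> C / (s * a)"
    using osc_tail_bound[OF assms] by blast
  show ?thesis
  proof (intro exI[of _ C] conjI allI impI C)
    fix d :: real and b :: "nat \<Rightarrow> real" and a s :: real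
    assume s: "0 < s" "\<bar>b n\<bar> = s ^ n" and a: "0 < a"
    have cauchy: "norm (osc n d b a B' - osc n d b a B) \<le> (C / s) / B" if "a \<le> B" "B \<le> B'" for B B'
      using osc_combine[of a B B' n d b] le[of s b B B' d, OF s] a that by simp
    note tail_limit[OF a cauchy, folded osc_lim_def]
    thus "(osc n d b a \<longlongrightarrow> osc_lim n d b a) at_top"
      "\<And>B. a \<le> B \<Longrightarrow> norm (osc_lim n d b a - osc n d b a B) \<le> C / (s * B)" by simp_all
  qed
qed

lemma osc_lim_linear:
  assumes d: "d \<noteq> 0" and a: "0 < a" and aB: "a \<le> B"
  shows "norm (osc_lim n d (\<lambda>_. 0) a - osc n d (\<lambda>_. 0) a B) \<le> 8 / (\<bar>d\<bar> * B)"
proof -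
  have cauchy: "norm (osc n d (\<lambda>_. 0) a B' - osc n d (\<lambda>_. 0) a B) \<le> (8 / \<bar>d\<bar>) / B" if "a \<le> B" "B \<le> B'" for B B'
    using osc_combine[of a B B' n d "\<lambda>_. 0"] osc_linear_bound[of d B B' n] a d that by simp
  show ?thesis using tail_limit(2)[OF a cauchy, folded osc_lim_def] aB by simp
qed

lemma osc_diff_le_d:
  assumes a: "0 < a" "a \<le> B"
  shows "norm (osc n d b a B - osc n d' b a B) \<le> 2 * \<bar>d - d'\<bar> * (B - a)"
proof (rule osc_diff_le[OF a])
  show "\<bar>phase n d b x - phase n d' b x\<bar> \<le> \<bar>d - d'\<bar> * \<bar>x\<bar>" for x
    by (simp add: phase_def abs_mult flip: left_diff_distrib)
qed

text \<open>The truncations are Lipschitz in \<open>d\<close> and the tail bound does not involve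
  \<open>d\<close>, so the limit is uniform. For \<open>t > 0\<close> each jump term is thereby
  continuous in the position.\<close>

lemma continuous_osc_lim:
  assumes n: "2 \<le> n" and b: "b n \<noteq> 0" and a: "0 < a"
  shows "continuous_on UNIV (\<lambda>d. osc_lim n d b a)"
proof -
  define s where "s = root n \<bar>b n\<bar>"
  have s: "0 < s" "\<bar>b n\<bar> = s ^ n" using n b by (auto simp: s_def real_root_gt_zero)
  obtain C where C: "\<And>d B. a \<le> B \<Longrightarrow> norm (osc_lim n d b a - osc n d b a B) \<le> C / (s * B)"
    using osc_lim_bound[OF n] s a by blast
  have "uniform_limit UNIV (\<lambda>B d. osc n d b a B) (\<lambda>d. osc_lim n d b a) at_top"
    unfolding uniform_limit_iff
  proof (intro allI impI)
    fix e :: real assume e: "0 < e"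
    have "((\<lambda>B. C / (s * B)) \<longlongrightarrow> 0) at_top" using s by real_asymp
    hence "\<forall>\<^sub>F B in at_top. C / (s * B) < e" using e by (rule order_tendstoD)
    thus "\<forall>\<^sub>F B in at_top. \<forall>d\<in>UNIV. dist (osc n d b a B) (osc_lim n d b a) < e"
      using eventually_ge_at_top[of a]
    proof eventually_elim
      case (elim B)
      thus ?case using C[of B] by (auto simp: dist_norm norm_minus_commute intro: le_less_trans)
    qed
  qed
  moreover have "\<forall>\<^sub>F B in at_top. continuous_on UNIV (\<lambda>d. osc n d b a B)"
    using eventually_ge_at_top[of a]
  proof eventually_elim
    case (elim B)
    have "(2 * (B - a))-lipschitz_on UNIV (\<lambda>d. osc n d b a B)"
    proof (rule lipschitz_onI)
      show "dist (osc n x b a B) (osc n y b a B) \<le> 2 * (B - a) * dist x y" for x y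
        using osc_diff_le_d[OF a elim, of n x b y] by (simp add: dist_norm dist_real_def algebra_simps)
    qed (use elim in auto)
    thus ?case by (rule lipschitz_on_continuous_on)
  qed
  ultimately show ?thesis by (intro uniform_limit_theorem) auto
qed

section \<open>The contour integral\<close>

text \<open>The leading coefficient of \<varpi> is thus a real sign, and the integrand of the
  contour integral is purely oscillatory on the real axis, up to the factor 1 / (i k).\<close>

lemma exp_Arg_of_real:
  assumes "w \<noteq> 0"
  shows "exp (\<i> * of_real (Arg (of_real w))) = of_real (sgn w)"
proof (cases "0 < w")
  case True
  thus ?thesis by (simp add: Arg_of_real)
next
  case False
  hence "w < 0" using assms by simp
  thus ?thesis by (simp add: Arg_of_real)
qed

text \<open>
  Off the negative imaginary axis \<open>exp (\<i> k y - \<i> \<sigma> k^n) / (\<i> k)\<close> has a primitive \<open>\<Phi>\<close>, namely the primitive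
  of an entire function plus \<open>Ln (- \<i> k) / \<i>\<close>. Hence the contour integral is \<open>\<Phi> B - \<Phi> (- A)\<close>, and the
  half residue \<open>- pi\<close> is the jump of the logarithm between the positive and the negative axis.
\<close>

lemma I_zero_eq_osc_lim:
  fixes n :: nat and \<sigma> y s r :: real
  assumes n: "2 \<le> n" and \<sigma>: "\<bar>\<sigma>\<bar> = 1" and r: "0 < r" and s: "0 < s" "s \<le> 1"
  defines "b \<equiv> (\<lambda>j. if j = n then \<sigma> else 0)"
  shows "norm (2 * of_real pi * I_zero r (monom (of_real \<sigma>) n) y 1 + of_real pi - osc_lim n y b s)
    \<le> 2 * s * (\<bar>y\<bar> + 1)"
proof -
  define E where "E = (\<lambda>k::complex. exp (\<i> * k * of_real y - \<i> * (of_real \<sigma> * k ^ n)))"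
  define ph where "ph = phase n y b"
  have ph: "ph x = y * x - \<sigma> * x ^ n" for x
  proof -
    have "(\<Sum>j=2..n. b j * x ^ j) = (\<Sum>j=2..n. if j = n then \<sigma> * x ^ n else 0)"
      by (intro sum.cong) (auto simp: b_def)
    thus ?thesis using n by (simp add: ph_def phase_def)
  qed
  have Ex: "E (of_real x) = cis (ph x)" for x
    by (simp add: E_def ph cis_conv_exp algebra_simps)
  have dE: "(E has_field_derivative (\<i> * of_real y - \<i> * of_real \<sigma> * of_nat n * k ^ (n - 1)) * E k) (at k)" for k
    unfolding E_def by (auto intro!: derivative_eq_intros simp: algebra_simps)
  have holE: "E holomorphic_on UNIV" using dE by (auto simp: holomorphic_on_open)
  have E0: "E 0 = 1" using n by (simp add: E_def power_0_left)
  have dE0: "deriv E 0 = \<i> * of_real y" using dE[of 0] n E0 by (intro DERIV_imp_deriv) (simp add: power_0_left)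
  \<comment> \<open>The difference quotient of \<open>E\<close> at 0 is entire;
    \<open>E k / k = h k + 1 / k\<close> isolates the pole, whose residue is
    \<open>E 0 = 1\<close>.\<close>
  define h where "h = (\<lambda>z. if z = 0 then deriv E 0 else (E z - E 0) / (z - 0))"
  have holh: "h holomorphic_on UNIV" unfolding h_def by (rule pole_lemma[OF holE]) auto
  obtain H where H: "\<And>z. (H has_field_derivative h z) (at z)"
    using holomorphic_convex_primitive'[OF _ _ holh] by auto
  \<comment> \<open>The factor \<open>- \<i>\<close> puts the branch cut of \<open>Ln\<close> on the
    negative imaginary axis, away from the upper semicircle and from the pieces on the real
    axis.\<close>
  define L where "L = {k::complex. - \<i> * k \<notin> \<real>\<^sub>\<le>\<^sub>0}"
  define \<Phi> where "\<Phi> = (\<lambda>k. (H k + Ln (- \<i> * k)) / \<i>)"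
  have d\<Phi>: "(\<Phi> has_field_derivative E k / (\<i> * k)) (at k)" if "k \<in> L" for k
  proof -
    have k0: "k \<noteq> 0" using that by (auto simp: L_def)
    have "((\<lambda>k. Ln (- \<i> * k)) has_field_derivative 1 / k) (at k)"
      using that k0 by (auto intro!: derivative_eq_intros simp: L_def divide_simps)
    from DERIV_cdivide[OF DERIV_add[OF H[of k] this], of \<i>]
    have "(\<Phi> has_field_derivative (h k + 1 / k) / \<i>) (at k)" unfolding \<Phi>_def .
    also have "h k + 1 / k = E k / k"
      using k0 by (simp add: h_def E0 diff_divide_distrib)
    also have "E k / k / \<i> = E k / (\<i> * k)"
      by (simp only: divide_divide_eq_left mult.commute)
    finally show ?thesis .
  qed
  have real_L: "of_real x \<in> L" if "x \<noteq> 0" for x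
    using that by (auto simp: L_def complex_nonpos_Reals_iff)
  have upper_L: "k \<in> L" if "0 \<le> Im k" "k \<noteq> 0" for k
    using that by (auto simp: L_def complex_nonpos_Reals_iff complex_eq_iff)
  have ci: "contour_integral (indented_path r A B) (\<lambda>k. E k / (\<i> * k)) = \<Phi> (of_real B) - \<Phi> (of_real (- A))"
    if AB: "r < A" "r < B" for A B
  proof -
    have fin: "pathfinish (part_circlepath 0 r pi 0) = of_real r"
      and st: "pathstart (part_circlepath 0 r pi 0) = - of_real r"
      by (simp_all add: exp_pi_i)
    have vp: "valid_path (indented_path r A B)"
      unfolding indented_path_def
      by (intro valid_path_join valid_path_linepath valid_path_part_circlepath) (simp_all add: fin st)
    have im: "path_image (indented_path r A B) \<subseteq> L"
    proof -
      have "path_image (indented_path r A B) \<subseteq> closed_segment (of_real (- A)) (of_real (- r)) \<union>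
         path_image (part_circlepath 0 r pi 0) \<union> closed_segment (of_real r) (of_real B)"
        unfolding indented_path_def
        by (intro order_trans[OF path_image_join_subset] Un_least) (auto intro: order_trans[OF path_image_join_subset])
      also have "\<dots> \<subseteq> L"
      proof (intro Un_least)
        show "closed_segment (of_real (- A)) (of_real (- r)) \<subseteq> L"
          using AB r by (auto simp: closed_segment_of_real closed_segment_eq_real_ivl intro!: real_L simp del: of_real_minus)
        show "closed_segment (of_real r) (of_real B) \<subseteq> L"
          using AB r by (auto simp: closed_segment_of_real closed_segment_eq_real_ivl intro!: real_L)
        show "path_image (part_circlepath 0 r pi 0) \<subseteq> L"
        proof
          fix k assume "k \<in> path_image (part_circlepath 0 r pi 0)"
          moreover have "closed_segment pi 0 = {0..pi}"
            by (simp add: closed_segment_eq_real_ivl not_le)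
          ultimately have "k \<in> (\<lambda>x. of_real r * cis x) ` {0..pi}"
            by (simp add: path_image_part_circlepath')
          then obtain x where x: "x \<in> {0..pi}" "k = of_real r * cis x" by blast
          have "0 \<le> Im k" using x r by (auto intro!: mult_nonneg_nonneg sin_ge_zero)
          thus "k \<in> L" using x r by (intro upper_L) auto
        qed
      qed
      finally show ?thesis .
    qed
    have "((\<lambda>k. E k / (\<i> * k)) has_contour_integral (\<Phi> (pathfinish (indented_path r A B)) - \<Phi> (pathstart (indented_path r A B)))) (indented_path r A B)"
      by (rule contour_integral_primitive[OF _ vp im]) (use d\<Phi> has_field_derivative_at_within in blast)
    thus ?thesis by (simp add: contour_integral_unique indented_path_def)
  qed
  have FTC: "((\<lambda>x. cis (ph (c * x)) / (\<i> * of_real x)) has_integral \<Phi> (of_real (c * v)) - \<Phi> (of_real (c * u))) {u..v}"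
    if "0 < u" "u \<le> v" "c \<noteq> 0" for u v c
  proof (rule fundamental_theorem_of_calculus)
    fix x assume x: "x \<in> {u..v}"
    hence "of_real (c * x) \<in> L" using that by (intro real_L) auto
    note d\<Phi>[OF this]
    moreover have "((\<lambda>x. complex_of_real (c * x)) has_vector_derivative of_real c) (at x within {u..v})"
      by (intro has_vector_derivative_of_real derivative_eq_intros) auto
    ultimately have "(\<Phi> \<circ> (\<lambda>x. complex_of_real (c * x)) has_vector_derivative of_real c * (E (of_real (c * x)) / (\<i> * of_real (c * x)))) (at x within {u..v})"
      by (intro field_vector_diff_chain_within) (auto intro: has_field_derivative_at_within)
    thus "((\<lambda>x. \<Phi> (of_real (c * x))) has_vector_derivative cis (ph (c * x)) / (\<i> * of_real x)) (at x within {u..v})"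
      using that x Ex[of "c * x"] by (simp add: o_def)
  qed (use that in auto)
  obtain C where C: "\<And>d b' u v. 1 \<le> \<bar>b' n\<bar> \<Longrightarrow> 0 < u \<Longrightarrow> u \<le> v \<Longrightarrow>
      norm (integral {u..v} (\<lambda>x. cis (phase n d b' x) / of_real x)) \<le> C / u"
    using half_tail_bound[OF n] by blast
  \<comment> \<open>The ends of the contour are independent, so \<open>\<Phi>\<close> must have a
    limit along each half-axis separately; the tail bound for one half-line gives both.\<close>
  have lim: "((\<lambda>B. \<Phi> (of_real (c * B))) \<longlongrightarrow> Lim at_top (\<lambda>B. \<Phi> (of_real (c * B)))) at_top" if c: "c = 1 \<or> c = -1" for c
  proof (rule tail_limit(1)[of 1])
    fix u v :: real assume uv: "1 \<le> u" "u \<le> v"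
    define b' where "b' = (if c = 1 then b else (\<lambda>j. (- 1) ^ j * b j))"
    have b': "1 \<le> \<bar>b' n\<bar>" using \<sigma> by (auto simp: b'_def b_def abs_mult)
    have "ph (c * x) = phase n (c * y) b' x" for x
      using c by (auto simp: b'_def ph_def phase_minus)
    moreover have "integral {u..v} (\<lambda>x. cis (ph (c * x)) / (\<i> * of_real x)) =
       integral {u..v} (\<lambda>x. cis (ph (c * x)) / of_real x) / \<i>"
      by (subst integral_divide[symmetric]) (simp only: divide_divide_eq_left mult.commute)
    moreover have "\<Phi> (of_real (c * v)) - \<Phi> (of_real (c * u)) = integral {u..v} (\<lambda>x. cis (ph (c * x)) / (\<i> * of_real x))"
      using FTC[of u v c] uv c by (auto simp: integral_unique)
    ultimately show "norm (\<Phi> (of_real (c * v)) - \<Phi> (of_real (c * u))) \<le> C / u"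
      using C[of b' u v "c * y", OF b'] uv by (simp add: norm_mult norm_divide)
  qed simp
  define P where "P = Lim at_top (\<lambda>B. \<Phi> (of_real (1 * B)))"
  define N where "N = Lim at_top (\<lambda>B. \<Phi> (of_real (-1 * B)))"
  have Plim: "((\<lambda>B. \<Phi> (of_real B)) \<longlongrightarrow> P) at_top" using lim[of 1] by (simp add: P_def)
  have Nlim: "((\<lambda>B. \<Phi> (of_real (- B))) \<longlongrightarrow> N) at_top" using lim[of "-1"] by (simp add: N_def)
  have "((\<lambda>(A, B). contour_integral (indented_path r A B) (\<lambda>k. E k / (\<i> * k))) \<longlongrightarrow> P - N) (at_top \<times>\<^sub>F at_top)"
  proof (rule Lim_transform_eventually)
    have "((\<lambda>z. \<Phi> (of_real (snd z)) - \<Phi> (of_real (- fst z))) \<longlongrightarrow> P - N) (at_top \<times>\<^sub>F at_top)"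
      by (intro tendsto_diff filterlim_compose[OF Plim] filterlim_compose[OF Nlim] filterlim_fst filterlim_snd)
    thus "((\<lambda>(A, B). \<Phi> (of_real B) - \<Phi> (of_real (- A))) \<longlongrightarrow> P - N) (at_top \<times>\<^sub>F at_top)"
      by (simp add: case_prod_unfold)
    have "\<forall>\<^sub>F z in at_top \<times>\<^sub>F at_top. r < fst z \<and> r < snd z"
      by (intro eventually_conj eventually_compose_filterlim[OF eventually_gt_at_top filterlim_fst]
         eventually_compose_filterlim[OF eventually_gt_at_top filterlim_snd])
    thus "\<forall>\<^sub>F z in at_top \<times>\<^sub>F at_top. (case z of (A, B) \<Rightarrow> \<Phi> (of_real B) - \<Phi> (of_real (- A))) =
       (case z of (A, B) \<Rightarrow> contour_integral (indented_path r A B) (\<lambda>k. E k / (\<i> * k)))"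
      by eventually_elim (auto simp: ci)
  qed
  hence "Lim (at_top \<times>\<^sub>F at_top) (\<lambda>(A, B). contour_integral (indented_path r A B) (\<lambda>k. E k / (\<i> * k))) = P - N"
    by (intro tendsto_Lim) (auto simp: prod_filter_eq_bot)
  hence I: "2 * of_real pi * I_zero r (monom (of_real \<sigma>) n) y 1 = P - N"
    by (simp add: I_zero_def E_def poly_monom mult_ac)
  have "osc n y b s B = (\<Phi> (of_real B) - \<Phi> (of_real (- B))) - (\<Phi> (of_real s) - \<Phi> (of_real (- s)))" if "s \<le> B" for B
    using has_integral_diff[OF FTC[of s B 1] FTC[of s B "-1"]] that s
    by (simp add: osc_def ph_def integral_unique diff_divide_distrib)
  hence "\<forall>\<^sub>F B in at_top. (\<Phi> (of_real B) - \<Phi> (of_real (- B))) - (\<Phi> (of_real s) - \<Phi> (of_real (- s))) = osc n y b s B"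
    by (intro eventually_mono[OF eventually_ge_at_top[of s]]) simp
  from Lim_transform_eventually[OF tendsto_diff[OF tendsto_diff[OF Plim Nlim] tendsto_const] this]
  have osc: "osc_lim n y b s = P - N - (\<Phi> (of_real s) - \<Phi> (of_real (- s)))"
    unfolding osc_lim_def by (intro tendsto_Lim) auto
  have "Ln (- \<i> * of_real s) = of_real (ln s) - \<i> * of_real pi / 2"
    "Ln (- \<i> * of_real (- s)) = of_real (ln s) + \<i> * of_real pi / 2"
    using s Ln_times_of_real[of s "- \<i>"] Ln_times_of_real[of s "\<i>"] by (simp_all add: mult.commute Ln_of_real)
  hence Ls: "Ln (- \<i> * of_real s) - Ln (- \<i> * of_real (- s)) = - (\<i> * of_real pi)"
    by (simp only:) (simp add: field_simps)
  have "\<Phi> (of_real s) - \<Phi> (of_real (- s)) = (H (of_real s) - H (of_real (- s)) +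
      (Ln (- \<i> * of_real s) - Ln (- \<i> * of_real (- s)))) / \<i>"
    by (simp only: \<Phi>_def diff_divide_distrib add_divide_distrib) (simp only: algebra_simps)
  hence \<Phi>s: "\<Phi> (of_real s) - \<Phi> (of_real (- s)) = (H (of_real s) - H (of_real (- s))) / \<i> - of_real pi"
    unfolding Ls by (simp only: add_divide_distrib) simp
  \<comment> \<open>\<open>osc_lim\<close> with cut \<open>s\<close> omits \<open>[- s, s]\<close>.
    Once the logarithm is split off, this gap costs the integral of \<open>h\<close>, which is
    bounded there by \<open>\<bar>y\<bar> + 1\<close> because \<open>s \<le> 1\<close>.\<close>
  have "((\<lambda>x. h (of_real x)) has_integral H (of_real s) - H (of_real (- s))) {- s..s}"
  proof (rule fundamental_theorem_of_calculus)
    fix x assume x: "x \<in> {- s..s}"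
    show "((\<lambda>x. H (of_real x)) has_vector_derivative h (of_real x)) (at x within {- s..s})"
      by (rule has_vector_derivative_real_field[OF H])
  qed (use s in auto)
  moreover have "norm (h (of_real x)) \<le> \<bar>y\<bar> + 1" if x: "x \<in> {- s..s}" for x
  proof (cases "x = 0")
    case True
    thus ?thesis by (simp add: h_def dE0 norm_mult)
  next
    case False
    have "norm (cis (ph x) - cis 0) \<le> \<bar>ph x\<bar>" using norm_cis_diff_le[of "ph x" 0] by simp
    also have "\<bar>ph x\<bar> \<le> \<bar>y * x\<bar> + \<bar>\<sigma> * x ^ n\<bar>" unfolding ph by (rule abs_triangle_ineq4)
    also have "\<dots> = \<bar>y\<bar> * \<bar>x\<bar> + 1 * (\<bar>x\<bar> ^ (n - 1) * \<bar>x\<bar>)"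
      using \<sigma> n power_minus_mult[of n "\<bar>x\<bar>"] by (simp add: abs_mult power_abs)
    also have "\<dots> \<le> \<bar>y\<bar> * \<bar>x\<bar> + 1 * (1 * \<bar>x\<bar>)"
      using x s by (intro add_mono mult_left_mono mult_right_mono power_le_one) auto
    finally have "norm (cis (ph x) - 1) \<le> (\<bar>y\<bar> + 1) * \<bar>x\<bar>" by (simp add: algebra_simps)
    thus ?thesis using False by (simp add: h_def Ex E0 norm_divide divide_le_eq)
  qed
  ultimately have "norm (H (of_real s) - H (of_real (- s))) \<le> (\<bar>y\<bar> + 1) * measure lborel {- s..s}"
    by (intro has_integral_bound_real[of _ "{}"]) auto
  hence "norm (H (of_real s) - H (of_real (- s))) \<le> 2 * s * (\<bar>y\<bar> + 1)"
    using s by (simp add: algebra_simps)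
  thus ?thesis unfolding I osc \<Phi>s by (simp add: norm_divide norm_mult)
qed

section \<open>Short-time limits of the oscillatory integrals\<close>

text \<open>It bounds the non-linear part of the phase divided by \<open>k\<close>, for
  \<open>\<bar>k\<bar> \<le> x\<close>. With differences of coefficients it is the constant
  \<open>D\<close> that \<open>osc_diff_le\<close> asks for.\<close>

definition phase_slope :: "nat \<Rightarrow> (nat \<Rightarrow> real) \<Rightarrow> real \<Rightarrow> real" where
  "phase_slope n b x = (\<Sum>j=2..n. \<bar>b j\<bar> * x ^ (j - 1))"

lemma phase_slope_nonneg: "0 \<le> x \<Longrightarrow> 0 \<le> phase_slope n b x"
  unfolding phase_slope_def by (intro sum_nonneg) auto

lemma phase_diff_le:
  assumes "\<bar>x\<bar> \<le> B"
  shows "\<bar>phase n d b x - phase n d b' x\<bar> \<le> phase_slope n (\<lambda>j. b j - b' j) B * \<bar>x\<bar>"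
proof -
  have "phase n d b x - phase n d b' x = - (\<Sum>j=2..n. (b j - b' j) * x ^ j)"
    by (simp add: phase_def sum_subtractf left_diff_distrib)
  also have "\<bar>\<dots>\<bar> \<le> (\<Sum>j=2..n. \<bar>(b j - b' j) * x ^ j\<bar>)"
    unfolding abs_minus_cancel by (rule sum_abs)
  also have "\<dots> \<le> (\<Sum>j=2..n. (\<bar>b j - b' j\<bar> * B ^ (j - 1)) * \<bar>x\<bar>)"
  proof (rule sum_mono)
    fix j assume j: "j \<in> {2..n}"
    hence "\<bar>x ^ j\<bar> = \<bar>x\<bar> ^ (j - 1) * \<bar>x\<bar>" using power_minus_mult[of j "\<bar>x\<bar>"] by (simp add: power_abs)
    also have "\<dots> \<le> B ^ (j - 1) * \<bar>x\<bar>" using assms by (intro mult_right_mono power_mono) auto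
    finally show "\<bar>(b j - b' j) * x ^ j\<bar> \<le> (\<bar>b j - b' j\<bar> * B ^ (j - 1)) * \<bar>x\<bar>"
      by (simp add: abs_mult mult.assoc mult_left_mono)
  qed
  finally show ?thesis by (simp add: phase_slope_def sum_distrib_right)
qed

lemma osc_diff_le_b:
  assumes a: "0 < a" "a \<le> B"
  shows "norm (osc n d b a B - osc n d b' a B) \<le> 2 * phase_slope n (\<lambda>j. b j - b' j) B * (B - a)"
  by (rule osc_diff_le[OF a phase_diff_le])

lemma ex_small_quotient:
  fixes C e :: real
  assumes "0 < e"
  obtains K where "1 \<le> K" "C / K < e"
proof -
  have "((\<lambda>K. C / K) \<longlongrightarrow> 0) at_top" by real_asymp
  hence "\<forall>\<^sub>F K in at_top. C / K < e" using assms by (rule order_tendstoD)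
  hence "\<forall>\<^sub>F K in at_top. C / K < e \<and> 1 \<le> K" using eventually_ge_at_top by (rule eventually_conj)
  from eventually_happens'[OF trivial_limit_at_top_linorder this] show thesis using that by blast
qed

lemma scale_tendsto_0: "((\<lambda>t. root n \<bar>w * t\<bar>) \<longlongrightarrow> 0) (at_right 0)"
proof -
  have "((\<lambda>t. root n \<bar>w * t\<bar>) \<longlongrightarrow> root n \<bar>w * 0\<bar>) (at_right 0)"
    by (intro tendsto_intros)
  thus ?thesis by simp
qed

lemma scale_pos:
  assumes "0 < n" "w \<noteq> 0" "0 < t"
  shows "0 < root n \<bar>w * t\<bar>" "root n \<bar>w * t\<bar> ^ n = \<bar>w\<bar> * t"
  using assms by (auto simp: real_root_gt_zero abs_mult)

text \<open>With \<open>s\<close> the scale, \<open>t = s ^ n / \<bar>w\<bar>\<close>, so a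
  coefficient of degree \<open>j\<close> becomes of order \<open>s ^ (n - j)\<close> after
  rescaling.\<close>

lemma scale_quotient:
  assumes "0 < n" "w \<noteq> 0" "0 < t" "j \<le> n"
  shows "t / root n \<bar>w * t\<bar> ^ j = root n \<bar>w * t\<bar> ^ (n - j) / \<bar>w\<bar>"
proof -
  let ?s = "root n \<bar>w * t\<bar>"
  have "\<bar>w\<bar> * t = ?s ^ (n - j) * ?s ^ j"
    using scale_pos(2)[OF assms(1-3)] assms(4) by (simp flip: power_add)
  thus ?thesis using scale_pos(1)[OF assms(1-3)] assms(2) by (simp add: field_simps)
qed

text \<open>Under the scaling \<open>k = \<kappa> / s\<close> the coefficients of the lower powers tend to 0.\<close>

lemma osc_lim_rescaled:
  fixes w :: "nat \<Rightarrow> real"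
  assumes n: "2 \<le> n" and w: "w n \<noteq> 0"
  defines "b \<equiv> (\<lambda>j. if j = n then sgn (w n) else 0)"
  assumes e: "0 < e"
  shows "\<forall>\<^sub>F t in at_right 0. \<forall>y. norm (osc_lim n (y * root n \<bar>w n * t\<bar>) (\<lambda>j. w j * t) 1 - osc_lim n y b (root n \<bar>w n * t\<bar>)) < e"
proof -
  define S where "S = (\<lambda>t. root n \<bar>w n * t\<bar>)"
  have n0: "0 < n" using n by simp
  have Spos: "0 < S t" and Spow: "S t ^ n = \<bar>w n\<bar> * t" if "0 < t" for t
    using scale_pos[OF n0 w that] by (simp_all only: S_def)
  have Slim: "(S \<longlongrightarrow> 0) (at_right 0)" unfolding S_def by (rule scale_tendsto_0)
  obtain C where C0: "0 \<le> C" and C: "\<And>d b a s. 0 < s \<Longrightarrow> \<bar>b n\<bar> = s ^ n \<Longrightarrow> 0 < a \<Longrightarrow>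
    (osc n d b a \<longlongrightarrow> osc_lim n d b a) at_top \<and>
    (\<forall>B\<ge>a. norm (osc_lim n d b a - osc n d b a B) \<le> C / (s * B))"
    using osc_lim_bound[OF n] by blast
  \<comment> \<open>After rescaling both leading coefficients have modulus 1, so both tails beyond
    \<open>K\<close> are at most \<open>C / K\<close>, uniformly in \<open>t\<close> and
    \<open>y\<close>.\<close>
  obtain K where K: "1 \<le> K" "C / K < e / 4" using ex_small_quotient[of "e / 4" C] e by auto
  define c where "c = (\<lambda>t j. w j * t / S t ^ j)"
  define D where "D = (\<lambda>t. phase_slope n (\<lambda>j. c t j - b j) K)"
  have cj: "((\<lambda>t. c t j - b j) \<longlongrightarrow> 0) (at_right 0)" if j: "j \<in> {2..n}" for j
  proof (cases "j = n")
    case True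
    have "\<forall>\<^sub>F t in at_right 0. 0 = c t j - b j"
      using eventually_at_right_less[of 0]
    proof eventually_elim
      case (elim t)
      thus ?case using w by (simp add: True c_def b_def Spow sgn_if)
    qed
    thus ?thesis by (rule Lim_transform_eventually[OF tendsto_const])
  next
    case False
    have "((\<lambda>t. w j / \<bar>w n\<bar> * S t ^ (n - j)) \<longlongrightarrow> w j / \<bar>w n\<bar> * 0 ^ (n - j)) (at_right 0)"
      by (intro tendsto_intros Slim)
    moreover have "(0::real) ^ (n - j) = 0" using False j by (simp add: power_0_left)
    moreover have "\<forall>\<^sub>F t in at_right 0. w j / \<bar>w n\<bar> * S t ^ (n - j) = c t j - b j"
      using eventually_at_right_less[of 0]
    proof eventually_elim
      case (elim t)
      have "t / S t ^ j = S t ^ (n - j) / \<bar>w n\<bar>" using scale_quotient[OF n0 w elim] j by (simp add: S_def)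
      thus ?case using False by (simp add: c_def b_def flip: times_divide_eq_right)
    qed
    ultimately show ?thesis by (auto intro: Lim_transform_eventually)
  qed
  have "(D \<longlongrightarrow> (\<Sum>j=2..n. \<bar>0\<bar> * K ^ (j - 1))) (at_right 0)"
    unfolding D_def phase_slope_def by (intro tendsto_intros cj)
  hence "((\<lambda>t. 2 * D t * (K - S t)) \<longlongrightarrow> 2 * 0 * (K - 0)) (at_right 0)"
    by (intro tendsto_intros Slim) simp
  hence "\<forall>\<^sub>F t in at_right 0. 2 * D t * (K - S t) < e / 4"
    using e by (intro order_tendstoD) auto
  moreover have "\<forall>\<^sub>F t in at_right 0. S t < 1" using Slim by (rule order_tendstoD) simp
  ultimately show ?thesis
    using eventually_at_right_less[of 0]
  proof eventually_elim
    case (elim t)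
    show ?case
    proof
      fix y
      have st: "0 < S t" "S t \<le> K" using Spos[OF \<open>0 < t\<close>] elim K by auto
      have wt: "\<bar>w n * t\<bar> = S t ^ n" using Spow[OF \<open>0 < t\<close>] \<open>0 < t\<close> by (simp add: abs_mult)
      have "\<bar>c t n\<bar> = 1 ^ n" using wt st by (simp add: c_def abs_mult)
      note lc = C[of 1 "c t", OF _ this, of "S t" y]
      have "\<bar>b n\<bar> = 1 ^ n" using w by (simp add: b_def abs_sgn_eq)
      note lb = C[of 1 b, OF _ this, of "S t" y]
      \<comment> \<open>The cut 1 becomes \<open>S t\<close>, which shrinks to 0. The comparison on
        \<open>[S t, K]\<close> survives because the bound in \<open>osc_diff_le_b\<close> stays
        finite as its lower endpoint tends to 0.\<close>
      have "osc n (y * S t) (\<lambda>j. w j * t) 1 = (\<lambda>B. osc n y (c t) (S t) (S t * B))"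
        using osc_scale[OF st(1), of n "y * S t" "\<lambda>j. w j * t" 1] st by (auto simp: c_def)
      moreover have "((\<lambda>B. osc n y (c t) (S t) (S t * B)) \<longlongrightarrow> osc_lim n y (c t) (S t)) at_top"
        by (rule filterlim_compose[OF conjunct1[OF lc]])
          (use st in \<open>auto intro!: filterlim_tendsto_pos_mult_at_top[OF tendsto_const] filterlim_ident\<close>)
      ultimately have eq: "osc_lim n (y * S t) (\<lambda>j. w j * t) 1 = osc_lim n y (c t) (S t)"
        unfolding osc_lim_def[of n "y * S t"] by (intro tendsto_Lim) auto
      have "norm (osc_lim n y (c t) (S t) - osc n y (c t) (S t) K) \<le> C / (1 * K)"
        "norm (osc_lim n y b (S t) - osc n y b (S t) K) \<le> C / (1 * K)"
        using lc lb st by auto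
      moreover have "norm (osc n y (c t) (S t) K - osc n y b (S t) K) \<le> 2 * D t * (K - S t)"
        unfolding D_def by (rule osc_diff_le_b) (use st in auto)
      ultimately have lt: "norm (osc_lim n y (c t) (S t) - osc n y (c t) (S t) K) +
           norm (osc n y (c t) (S t) K - osc n y b (S t) K) + norm (osc n y b (S t) K - osc_lim n y b (S t)) < e"
        using K elim(1) e by (simp add: norm_minus_commute)
      have tri: "norm (p - u) \<le> norm (p - q) + norm (q - r) + norm (r - u)" for p q r u :: complex
        using norm_triangle_ineq[of "p - q" "q - u"] norm_triangle_ineq[of "q - r" "r - u"] by simp
      have "root n \<bar>w n * t\<bar> = S t" by (simp add: S_def)
      thus "norm (osc_lim n (y * root n \<bar>w n * t\<bar>) (\<lambda>j. w j * t) 1 - osc_lim n y b (root n \<bar>w n * t\<bar>)) < e"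
        using le_less_trans[OF tri lt] eq by simp
    qed
  qed
qed

text \<open>For \<open>R\<close> of order \<open>1 / s\<close> the bound of
  \<open>osc_diff_le\<close> is only O(1). Instead \<open>cis (d * x)\<close> is integrated by parts
  against the amplitude \<open>(cis p - 1) / x\<close>, with \<open>p\<close> the non-linear part of
  the phase. Size and variation of the amplitude are controlled by \<open>phase_slope n b R\<close>,
  which is O(s) in the application, and the oscillation contributes
  \<open>1 / \<bar>d\<bar>\<close>.\<close>

lemma half_linear_diff:
  assumes d: "d \<noteq> 0" and R: "1 \<le> R"
  shows "norm (integral {1..R} (\<lambda>x. cis (phase n d b x) / of_real x) -
    integral {1..R} (\<lambda>x. cis (phase n d (\<lambda>_. 0) x) / of_real x)) \<le> 5 / \<bar>d\<bar> * phase_slope n b R"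
proof -
  define p where "p = - (\<Sum>j=2..n. monom (b j) j)"
  have p: "poly p x = - (\<Sum>j=2..n. b j * x ^ j)" for x by (simp add: p_def poly_sum poly_monom)
  have p': "poly (pderiv p) x = - (\<Sum>j=2..n. of_nat j * b j * x ^ (j - 1))" for x
    
  proof -
    have "pderiv (\<Sum>j=2..n. monom (b j) j) = (\<Sum>j=2..n. pderiv (monom (b j) j))"
      using higher_pderiv_sum[of 1 "\<lambda>j. monom (b j) j" "{2..n}"] by simp
    thus ?thesis by (simp add: p_def pderiv_minus pderiv_monom poly_sum poly_monom)
  qed
  have ph: "cis (phase n d b x) = cis (d * x) * cis (poly p x)" for x
    by (simp add: phase_def p cis_mult)
  have ple: "\<bar>poly p x\<bar> \<le> phase_slope n b x * x" if "1 \<le> x" for x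
    using phase_diff_le[of x x n 0 b "\<lambda>_. 0"] that by (simp add: phase_def p)
  \<comment> \<open>\<open>g\<close> is a primitive of the majorant \<open>g'\<close> of
    \<open>norm h'\<close>. The coefficient \<open>j + 1\<close> is 1 from differentiating
    \<open>1 / x\<close> plus \<open>j\<close> from differentiating the phase; the quotient
    \<open>(j + 1) / (j - 1)\<close> is at most 3, and with two boundary terms this makes the factor
    5.\<close>
  define g where "g = (\<lambda>x::real. \<Sum>j=2..n. \<bar>b j\<bar> * ((real j + 1) / (real j - 1)) * x ^ (j - 1))"
  define g' where "g' = (\<lambda>x::real. \<Sum>j=2..n. \<bar>b j\<bar> * (real j + 1) * x ^ (j - 2))"
  define h where "h = (\<lambda>x. (cis (poly p x) - 1) * of_real (inverse x))"
  define h' where "h' = (\<lambda>x. (cis (poly p x) - 1) * - of_real (inverse (x\<^sup>2)) +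
     (\<i> * of_real (poly (pderiv p) x) * cis (poly p x) - 0) * of_real (inverse x))"
  have hle: "norm (h x) \<le> phase_slope n b x" if "1 \<le> x" for x
  proof -
    have "norm (cis (poly p x) - 1) \<le> phase_slope n b x * x"
      using norm_cis_diff_le[of "poly p x" 0] ple[OF that] by simp
    thus ?thesis using that by (simp add: h_def norm_mult norm_divide norm_inverse divide_simps)
  qed
  have "norm (integral {1..R} (\<lambda>x. cis (poly [:0, d:] x) * h x)) \<le> 1 / \<bar>d\<bar> * (norm (h 1) + norm (h R) + g R - g 1)"
  proof (rule integral_by_parts_bound[OF R, where F = "\<lambda>x. cis (poly [:0, d:] x) / (\<i> * of_real d)" and h' = h' and g' = g'])
    show "((\<lambda>x. cis (poly [:0, d:] x) / (\<i> * of_real d)) has_vector_derivative cis (poly [:0, d:] x)) (at x within {1..R})" for x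
      using has_vector_derivative_divide[OF has_vector_derivative_cis_poly[of "[:0, d:]" x "{1..R}"], of "\<i> * of_real d"] d
      by (simp add: pderiv_pCons)
    have inv: "((\<lambda>x. complex_of_real (inverse x)) has_vector_derivative - of_real (inverse (x\<^sup>2))) (at x within {1..R})"
      if "x \<in> {1..R}" for x
    proof -
      have "((\<lambda>x. inverse x) has_real_derivative - inverse (x\<^sup>2)) (at x within {1..R})"
        using that by (auto intro!: derivative_eq_intros simp: power2_eq_square)
      from has_vector_derivative_of_real[OF this] show ?thesis by (simp only: of_real_minus)
    qed
    show "(h has_vector_derivative h' x) (at x within {1..R})" if "x \<in> {1..R}" for x
      unfolding h_def h'_def
      by (intro has_vector_derivative_mult has_vector_derivative_diff has_vector_derivative_cis_poly
          has_vector_derivative_const inv that)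
    show "(g has_vector_derivative g' x) (at x within {1..R})" for x
      unfolding has_real_derivative_iff_has_vector_derivative[symmetric] g_def g'_def
    proof (rule DERIV_sum)
      fix j assume j: "j \<in> {2..n}"
      have "((\<lambda>x. \<bar>b j\<bar> * ((real j + 1) / (real j - 1)) * x ^ (j - 1)) has_real_derivative
          \<bar>b j\<bar> * ((real j + 1) / (real j - 1)) * (real (j - 1) * x ^ (j - 1 - 1))) (at x within {1..R})"
        using j by (auto intro!: derivative_eq_intros)
      also have "\<bar>b j\<bar> * ((real j + 1) / (real j - 1)) * (real (j - 1) * x ^ (j - 1 - 1)) = \<bar>b j\<bar> * (real j + 1) * x ^ (j - 2)"
      proof -
        have "real (j - 1) = real j - 1" "real j - 1 \<noteq> 0" "j - 1 - 1 = j - 2" using j by auto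
        thus ?thesis by simp
      qed
      finally show "((\<lambda>x. \<bar>b j\<bar> * ((real j + 1) / (real j - 1)) * x ^ (j - 1)) has_real_derivative
          \<bar>b j\<bar> * (real j + 1) * x ^ (j - 2)) (at x within {1..R})" .
    qed
    show "continuous_on {1..R} (\<lambda>x. cis (poly [:0, d:] x))" by (rule continuous_on_cis_poly)
    show "continuous_on {1..R} h'" unfolding h'_def by (intro continuous_intros) auto
    show "norm (cis (poly [:0, d:] x) / (\<i> * of_real d)) \<le> 1 / \<bar>d\<bar>" for x by (simp add: norm_divide norm_mult)
    show "norm (h' x) \<le> g' x" if x: "x \<in> {1..R}" for x
    proof -
      have x1: "1 \<le> x" using x by simp
      have "norm (cis (poly p x) - 1) \<le> phase_slope n b x * x"
        using norm_cis_diff_le[of "poly p x" 0] ple[OF x1] by simp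
      hence "norm ((cis (poly p x) - 1) * - of_real (inverse (x\<^sup>2))) \<le> phase_slope n b x * x * inverse (x\<^sup>2)"
        unfolding norm_mult norm_minus_cancel norm_of_real
        using x1 phase_slope_nonneg[of x n b] by (intro mult_mono) auto
      also have "\<dots> = (\<Sum>j=2..n. \<bar>b j\<bar> * x ^ (j - 2))"
      proof -
        have "x ^ (j - 1) * x * inverse (x\<^sup>2) = x ^ (j - 2)" if j: "j \<in> {2..n}" for j
        proof -
          have "x ^ (j - 1) = x ^ (j - 2) * x" using power_minus_mult[of "j - 1" x] j by (simp add: numeral_2_eq_2)
          moreover have "x \<noteq> 0" using x1 by simp
          ultimately show ?thesis by (simp only:) (simp add: power2_eq_square field_simps)
        qed
        thus ?thesis unfolding phase_slope_def sum_distrib_right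
          by (intro sum.cong) (auto simp: mult.assoc)
      qed
      finally have 1: "norm ((cis (poly p x) - 1) * - of_real (inverse (x\<^sup>2))) \<le> (\<Sum>j=2..n. \<bar>b j\<bar> * x ^ (j - 2))" .
      have "norm ((\<i> * of_real (poly (pderiv p) x) * cis (poly p x) - 0) * of_real (inverse x)) = \<bar>poly (pderiv p) x\<bar> * inverse x"
        using x1 by (simp add: norm_mult norm_inverse)
      also have "\<dots> \<le> (\<Sum>j=2..n. real j * \<bar>b j\<bar> * x ^ (j - 1)) * inverse x"
        unfolding p' abs_minus_cancel using x1
        by (intro mult_right_mono order_trans[OF sum_abs] sum_mono) (auto simp: abs_mult)
      also have "\<dots> = (\<Sum>j=2..n. real j * \<bar>b j\<bar> * x ^ (j - 2))"
      proof -
        have "x ^ (j - 1) * inverse x = x ^ (j - 2)" if j: "j \<in> {2..n}" for j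
        proof -
          have "x ^ (j - 1) = x ^ (j - 2) * x" using power_minus_mult[of "j - 1" x] j by (simp add: numeral_2_eq_2)
          moreover have "x \<noteq> 0" using x1 by simp
          ultimately show ?thesis by (simp only:) (simp add: field_simps)
        qed
        thus ?thesis unfolding sum_distrib_right
          by (intro sum.cong) (auto simp: mult.assoc)
      qed
      finally have 2: "norm ((\<i> * of_real (poly (pderiv p) x) * cis (poly p x) - 0) * of_real (inverse x)) \<le>
         (\<Sum>j=2..n. real j * \<bar>b j\<bar> * x ^ (j - 2))" .
      have "g' x = (\<Sum>j=2..n. \<bar>b j\<bar> * x ^ (j - 2)) + (\<Sum>j=2..n. real j * \<bar>b j\<bar> * x ^ (j - 2))"
        unfolding g'_def sum.distrib[symmetric] by (intro sum.cong) (auto simp: algebra_simps)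
      thus ?thesis unfolding h'_def using norm_triangle_le[OF add_mono[OF 1 2]] by simp
    qed
  qed
  also have "\<dots> \<le> 1 / \<bar>d\<bar> * (phase_slope n b R + phase_slope n b R + 3 * phase_slope n b R)"
  proof (intro mult_left_mono)
    have "norm (h 1) \<le> phase_slope n b 1" by (rule hle) simp
    also have "\<dots> \<le> phase_slope n b R"
      unfolding phase_slope_def using R by (intro sum_mono mult_left_mono power_mono) auto
    finally have "norm (h 1) \<le> phase_slope n b R" .
    moreover have "norm (h R) \<le> phase_slope n b R" by (rule hle[OF R])
    moreover have "0 \<le> g 1" unfolding g_def by (intro sum_nonneg) auto
    moreover have "g R \<le> 3 * phase_slope n b R"
      unfolding g_def phase_slope_def sum_distrib_left
    proof (rule sum_mono)
      fix j assume j: "j \<in> {2..n}"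
      hence "(real j + 1) / (real j - 1) \<le> 3" by (auto simp: divide_simps)
      hence "\<bar>b j\<bar> * R ^ (j - 1) * ((real j + 1) / (real j - 1)) \<le> \<bar>b j\<bar> * R ^ (j - 1) * 3"
        using R by (intro mult_left_mono) auto
      thus "\<bar>b j\<bar> * ((real j + 1) / (real j - 1)) * R ^ (j - 1) \<le> 3 * (\<bar>b j\<bar> * R ^ (j - 1))"
        by (simp only: mult_ac)
    qed
    ultimately show "norm (h 1) + norm (h R) + g R - g 1 \<le> phase_slope n b R + phase_slope n b R + 3 * phase_slope n b R"
      by linarith
  qed simp
  also have "\<dots> = 5 / \<bar>d\<bar> * phase_slope n b R" by simp
  also have "integral {1..R} (\<lambda>x. cis (poly [:0, d:] x) * h x) = integral {1..R} (\<lambda>x. cis (phase n d b x) / of_real x - cis (phase n d (\<lambda>_. 0) x) / of_real x)"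
  proof (rule Henstock_Kurzweil_Integration.integral_cong)
    fix x
    have "cis (phase n d (\<lambda>_. 0) x) = cis (d * x)" by (simp add: phase_def)
    thus "cis (poly [:0, d:] x) * h x = cis (phase n d b x) / of_real x - cis (phase n d (\<lambda>_. 0) x) / of_real x"
      unfolding ph h_def by (simp add: divide_inverse algebra_simps)
  qed
  also have "\<dots> = integral {1..R} (\<lambda>x. cis (phase n d b x) / of_real x) - integral {1..R} (\<lambda>x. cis (phase n d (\<lambda>_. 0) x) / of_real x)"
    by (rule Henstock_Kurzweil_Integration.integral_diff) (auto intro!: integrable_continuous_interval continuous_intros)
  finally show ?thesis .
qed

lemma osc_linear_diff:
  assumes d: "d \<noteq> 0" and R: "1 \<le> R"
  shows "norm (osc n d b 1 R - osc n d (\<lambda>_. 0) 1 R) \<le> 10 / \<bar>d\<bar> * phase_slope n b R"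
proof -
  define I where "I = (\<lambda>d b. integral {1..R} (\<lambda>x. cis (phase n d b x) / of_real x))"
  define b' where "b' = (\<lambda>j. (- 1) ^ j * b j)"
  have sl: "phase_slope n b' R = phase_slope n b R" by (simp add: phase_slope_def b'_def abs_mult)
  have "osc n d b 1 R - osc n d (\<lambda>_. 0) 1 R = ((I d b - I d (\<lambda>_. 0)) - (I (- d) b' - I (- d) (\<lambda>_. 0))) / \<i>"
    by (simp add: osc_halves I_def b'_def divide_inverse algebra_simps)
  also have "norm \<dots> \<le> 5 / \<bar>d\<bar> * phase_slope n b R + 5 / \<bar>- d\<bar> * phase_slope n b' R"
    unfolding norm_divide norm_ii div_by_1 I_def
    by (intro order_trans[OF norm_triangle_ineq4 add_mono] half_linear_diff) (use d R in auto)
  also have "\<dots> = 10 / \<bar>d\<bar> * phase_slope n b R" by (simp add: sl)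
  finally show ?thesis .
qed

section \<open>Functions with a weak derivative\<close>

lemma set_lebesgue_integral_continuous_FTC:
  fixes F f :: "real \<Rightarrow> complex"
  assumes "a \<le> b" "\<And>x. (F has_vector_derivative f x) (at x)" "continuous_on UNIV f"
  shows "(LINT x:{a..b}|lborel. f x) = F b - F a"
  unfolding set_lebesgue_integral_def
  by (rule integral_FTC_atLeastAtMost)
    (use assms in \<open>auto intro: has_vector_derivative_at_within continuous_on_subset\<close>)

text \<open>Integration by parts against a primitive of a merely integrable \<open>g\<close>,
  obtained from Fubini's theorem on the triangle \<open>a \<le> y \<le> x \<le> b\<close>.\<close>

lemma primitive_times_derivative:
  fixes g \<phi> \<phi>' :: "real \<Rightarrow> complex"
  assumes g: "set_integrable lborel {a..b} g"
    and \<phi>: "\<And>x. (\<phi> has_vector_derivative \<phi>' x) (at x)" and c: "continuous_on UNIV \<phi>'"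
  shows "(LINT x:{a..b}|lborel. \<phi>' x * (LINT y:{a..x}|lborel. g y)) =
     (LINT y:{a..b}|lborel. g y * (\<phi> b - \<phi> y))"
proof -
  have [measurable]: "\<phi>' \<in> borel_measurable borel" by (rule borel_measurable_continuous_onI[OF c])
  define k where "k = (\<lambda>y. indicator {a..b} y *\<^sub>R g y)"
  have ki: "integrable lborel k" using g by (simp add: set_integrable_def k_def)
  note [measurable] = borel_measurable_integrable[OF ki]
  define p where "p = (\<lambda>x. indicator {a..b} x *\<^sub>R \<phi>' x)"
  have pi: "integrable lborel p"
    using borel_integrable_atLeastAtMost'[OF continuous_on_subset[OF c], of a b] by (simp add: set_integrable_def p_def)
  note [measurable] = borel_measurable_integrable[OF pi]
  define f where "f = (\<lambda>x y. (if y \<le> x then 1 else 0) * (p x * k y))"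
  have fm[measurable]: "case_prod f \<in> borel_measurable (lborel \<Otimes>\<^sub>M lborel)"
    unfolding f_def by measurable
  have "integrable (lborel \<Otimes>\<^sub>M lborel) (\<lambda>(x, y). p x * k y)"
    by (rule lborel_pair.Fubini_integrable) (use pi ki in \<open>auto simp: norm_mult\<close>)
  hence fi: "integrable (lborel \<Otimes>\<^sub>M lborel) (case_prod f)"
    by (rule Bochner_Integration.integrable_bound) (auto simp: f_def norm_mult)
  have "(LINT x:{a..b}|lborel. \<phi>' x * (LINT y:{a..x}|lborel. g y)) = (LINT x|lborel. LINT y|lborel. f x y)"
    unfolding set_lebesgue_integral_def[of _ "{a..b}"]
  proof (rule Bochner_Integration.integral_cong)
    fix x :: real
    show "indicator {a..b} x *\<^sub>R (\<phi>' x * (LINT y:{a..x}|lborel. g y)) = (LINT y|lborel. f x y)"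
    proof (cases "x \<in> {a..b}")
      case True
      have "(LINT y|lborel. f x y) = (LINT y|lborel. \<phi>' x * (indicator {a..x} y *\<^sub>R g y))"
        by (rule Bochner_Integration.integral_cong) (use True in \<open>auto simp: f_def p_def k_def indicator_def\<close>)
      also have "\<dots> = \<phi>' x * (LINT y:{a..x}|lborel. g y)"
        by (simp only: integral_mult_right_zero set_lebesgue_integral_def)
      finally show ?thesis using True by simp
    next
      case False
      thus ?thesis by (simp add: f_def p_def)
    qed
  qed simp
  also have "\<dots> = (LINT y|lborel. LINT x|lborel. f x y)"
    using lborel_pair.Fubini_integral[OF fi] by simp
  also have "\<dots> = (LINT y:{a..b}|lborel. g y * (\<phi> b - \<phi> y))"
    unfolding set_lebesgue_integral_def[of _ "{a..b}"]
  proof (rule Bochner_Integration.integral_cong)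
    fix y :: real
    show "(LINT x|lborel. f x y) = indicator {a..b} y *\<^sub>R (g y * (\<phi> b - \<phi> y))"
    proof (cases "y \<in> {a..b}")
      case True
      have "(LINT x|lborel. f x y) = (LINT x|lborel. g y * (indicator {y..b} x *\<^sub>R \<phi>' x))"
        by (rule Bochner_Integration.integral_cong) (use True in \<open>auto simp: f_def p_def k_def indicator_def\<close>)
      also have "\<dots> = g y * (LINT x:{y..b}|lborel. \<phi>' x)"
        by (simp only: integral_mult_right_zero set_lebesgue_integral_def)
      also have "(LINT x:{y..b}|lborel. \<phi>' x) = \<phi> b - \<phi> y"
        by (rule set_lebesgue_integral_continuous_FTC[OF _ \<phi> c]) (use True in auto)
      finally show ?thesis using True by simp
    next
      case False
      thus ?thesis by (simp add: f_def k_def)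
    qed
  qed simp
  finally show ?thesis .
qed

text \<open>Mean value zero makes the primitive vanish on both sides of \<open>[u, v]\<close>, so
  that \<open>\<eta>\<close> is the derivative of an admissible test function.\<close>

lemma compactly_supported_primitive:
  fixes \<eta> :: "real \<Rightarrow> real"
  assumes uv: "u \<le> v" and c: "continuous_on UNIV \<eta>" and s: "\<And>x. x \<notin> {u..v} \<Longrightarrow> \<eta> x = 0"
    and z: "(LINT x:{u..v}|lborel. complex_of_real (\<eta> x)) = 0"
  obtains \<phi> where "\<And>x. (\<phi> has_real_derivative \<eta> x) (at x)" "\<And>x. x \<notin> {u..v} \<Longrightarrow> \<phi> x = 0" "\<phi> v = 0"
proof -
  have "\<exists>F. \<forall>x :: real. -\<infinity> < ereal x \<longrightarrow> ereal x < \<infinity> \<longrightarrow> (F has_vector_derivative \<eta> x) (at x)"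
    by (rule einterval_antiderivative) (use c in \<open>auto simp: continuous_on_eq_continuous_at\<close>)
  then obtain F where F: "\<And>x. (F has_real_derivative \<eta> x) (at x)"
    by (auto simp: has_real_derivative_iff_has_vector_derivative)
  define \<phi> where "\<phi> = (\<lambda>x. F x - F u)"
  have d: "(\<phi> has_real_derivative \<eta> x) (at x)" for x
    unfolding \<phi>_def using F by (auto intro!: derivative_eq_intros)
  have const: "\<phi> x = \<phi> y" if xy: "x < y" "y \<le> u \<or> v \<le> x" for x y
  proof -
    obtain w where w: "x < w" "w < y" "\<phi> y - \<phi> x = (y - x) * \<eta> w"
      using MVT2[OF xy(1), of \<phi> \<eta>] d by blast
    moreover have "\<eta> w = 0" using w xy uv by (intro s) auto
    ultimately show ?thesis by simp
  qed
  have "(LINT x:{u..v}|lborel. complex_of_real (\<eta> x)) = of_real (\<phi> v) - of_real (\<phi> u)"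
    by (rule set_lebesgue_integral_continuous_FTC[OF uv])
      (use d c in \<open>auto intro!: has_vector_derivative_of_real continuous_intros\<close>)
  hence v0: "\<phi> v = 0" using z by (simp add: \<phi>_def flip: of_real_diff)
  show thesis
  proof (rule that[OF d _ v0])
    fix x assume "x \<notin> {u..v}"
    hence "x < u \<or> v < x" by auto
    thus "\<phi> x = 0" using const[of x u] const[of v x] v0 by (auto simp: \<phi>_def)
  qed
qed

lemma set_integrable_times_continuous:
  fixes F \<eta> :: "real \<Rightarrow> complex"
  assumes F: "set_integrable lborel {u..v} F" and \<eta>: "continuous_on UNIV \<eta>"
  shows "set_integrable lborel {u..v} (\<lambda>x. F x * \<eta> x)"
proof -
  have [measurable]: "\<eta> \<in> borel_measurable borel" by (rule borel_measurable_continuous_onI[OF \<eta>])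
  have "compact (\<eta> ` {u..v})" by (intro compact_continuous_image continuous_on_subset[OF \<eta>]) auto
  then obtain M where "\<forall>y\<in>\<eta> ` {u..v}. norm y \<le> M"
    using compact_imp_bounded bounded_iff by metis
  hence M: "\<And>x. x \<in> {u..v} \<Longrightarrow> norm (\<eta> x) \<le> M" by auto
  have "integrable lborel (\<lambda>x. (indicator {u..v} x *\<^sub>R F x) * \<eta> x)"
  proof (rule Bochner_Integration.integrable_bound)
    show "integrable lborel (\<lambda>x. of_real M * (indicator {u..v} x *\<^sub>R F x))"
      using F unfolding set_integrable_def by (rule integrable_mult_right)
    show "(\<lambda>x. (indicator {u..v} x *\<^sub>R F x) * \<eta> x) \<in> borel_measurable lborel"
      using borel_measurable_integrable[OF F[unfolded set_integrable_def]] by measurable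
    show "AE x in lborel. norm ((indicator {u..v} x *\<^sub>R F x) * \<eta> x) \<le> norm (of_real M * (indicator {u..v} x *\<^sub>R F x))"
    proof (rule AE_I2)
      fix x
      show "norm ((indicator {u..v} x *\<^sub>R F x) * \<eta> x) \<le> norm (of_real M * (indicator {u..v} x *\<^sub>R F x))"
      proof (cases "x \<in> {u..v}")
        case True
        have "norm (F x) * norm (\<eta> x) \<le> norm (F x) * \<bar>M\<bar>"
          using M[OF True] by (intro mult_left_mono) auto
        thus ?thesis using True by (simp add: norm_mult mult.commute)
      qed simp
    qed
  qed
  thus ?thesis by (simp add: set_integrable_def)
qed

text \<open>The du Bois-Reymond argument: \<open>f - G\<close> has weak derivative 0, and a
  continuous \<open>\<eta>\<close> of mean zero is the derivative of a test function.\<close>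

lemma weak_derivative_orthogonal:
  assumes w: "has_weak_derivative_on f g S" and S: "{u..v} \<subseteq> S" "S \<in> sets borel" and uv: "u \<le> v"
    and fi: "set_integrable lborel {u..v} f" and gi: "set_integrable lborel {u..v} g"
    and G: "\<And>x. x \<in> {u..v} \<Longrightarrow> G x = G u + (LINT y:{u..x}|lborel. g y)" and Gc: "continuous_on {u..v} G"
    and \<eta>: "continuous_on UNIV \<eta>" "\<And>x. x \<notin> {u..v} \<Longrightarrow> \<eta> x = 0" "(LINT x:{u..v}|lborel. complex_of_real (\<eta> x)) = 0"
  shows "(LINT x:{u..v}|lborel. (f x - G x) * of_real (\<eta> x)) = 0"
proof -
  obtain \<phi> where \<phi>: "\<And>x. (\<phi> has_real_derivative \<eta> x) (at x)" "\<And>x. x \<notin> {u..v} \<Longrightarrow> \<phi> x = 0" "\<phi> v = 0"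
    using compactly_supported_primitive[OF uv \<eta>] by blast
  have restr: "(LINT x:S|lborel. F x) = (LINT x:{u..v}|lborel. F x)" if "\<And>x. x \<notin> {u..v} \<Longrightarrow> F x = 0" for F :: "real \<Rightarrow> complex"
    unfolding set_lebesgue_integral_def
    by (rule Bochner_Integration.integral_cong) (use S that in \<open>auto simp: indicator_def\<close>)
  have "\<exists>K. compact K \<and> K \<subseteq> S \<and> (\<forall>x. x \<notin> K \<longrightarrow> \<phi> x = 0)"
    using \<phi>(2) S(1) by (intro exI[of _ "{u..v}"]) auto
  hence "(LINT x:S|lborel. f x * of_real (\<eta> x)) = - (LINT x:S|lborel. g x * of_real (\<phi> x))"
    using w[unfolded has_weak_derivative_on_def, rule_format, of \<phi> \<eta>] \<phi>(1) \<eta>(1) by blast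
  hence fe: "(LINT x:{u..v}|lborel. f x * of_real (\<eta> x)) = - (LINT x:{u..v}|lborel. g x * of_real (\<phi> x))"
    using \<phi>(2) \<eta>(2) restr[of "\<lambda>x. f x * of_real (\<eta> x)"] restr[of "\<lambda>x. g x * of_real (\<phi> x)"] by simp
  have "(LINT x:{u..v}|lborel. complex_of_real (\<eta> x) * (LINT y:{u..x}|lborel. g y)) =
     (LINT y:{u..v}|lborel. g y * (of_real (\<phi> v) - of_real (\<phi> y)))"
    by (rule primitive_times_derivative[OF gi])
      (use \<phi> \<eta> in \<open>auto intro!: has_vector_derivative_of_real continuous_intros\<close>)
  also have "\<dots> = - (LINT x:{u..v}|lborel. g x * of_real (\<phi> x))"
    using \<phi>(3) by (simp add: set_lebesgue_integral_def)
  finally have ge: "(LINT x:{u..v}|lborel. complex_of_real (\<eta> x) * (LINT y:{u..x}|lborel. g y)) =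
     - (LINT x:{u..v}|lborel. g x * of_real (\<phi> x))" .
  have ec: "continuous_on UNIV (\<lambda>x. complex_of_real (\<eta> x))" using \<eta>(1) by (intro continuous_intros)
  note prod = set_integrable_times_continuous[OF _ ec]
  have GI: "(LINT y:{u..x}|lborel. g y) = G x - G u" if "x \<in> {u..v}" for x
    using G[OF that] by (metis add_diff_cancel_left')
  have Gi: "set_integrable lborel {u..v} G" by (rule borel_integrable_atLeastAtMost'[OF Gc])
  have "(LINT x:{u..v}|lborel. G x * of_real (\<eta> x)) =
     (LINT x:{u..v}|lborel. G u * of_real (\<eta> x) + complex_of_real (\<eta> x) * (LINT y:{u..x}|lborel. g y))"
  proof (rule set_lebesgue_integral_cong, simp, intro allI impI)
    fix x assume "x \<in> {u..v}"
    from GI[OF this] show "G x * of_real (\<eta> x) = G u * of_real (\<eta> x) + complex_of_real (\<eta> x) * (LINT y:{u..x}|lborel. g y)"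
      by (simp only:) (simp add: algebra_simps)
  qed
  also have "\<dots> = (LINT x:{u..v}|lborel. G u * of_real (\<eta> x)) + (LINT x:{u..v}|lborel. complex_of_real (\<eta> x) * (LINT y:{u..x}|lborel. g y))"
  proof (rule set_integral_add)
    show "set_integrable lborel {u..v} (\<lambda>x. G u * complex_of_real (\<eta> x))"
      by (rule borel_integrable_atLeastAtMost') (use \<eta>(1) in \<open>auto intro!: continuous_intros continuous_on_subset[OF \<eta>(1)]\<close>)
    have "set_integrable lborel {u..v} (\<lambda>x. (G x - G u) * of_real (\<eta> x))"
      by (rule borel_integrable_atLeastAtMost') (use \<eta>(1) Gc in \<open>auto intro!: continuous_intros continuous_on_subset[OF \<eta>(1)]\<close>)
    thus "set_integrable lborel {u..v} (\<lambda>x. complex_of_real (\<eta> x) * (LINT y:{u..x}|lborel. g y))"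
      by (subst set_integrable_cong[OF refl refl, of _ _ "\<lambda>x. (G x - G u) * of_real (\<eta> x)"]) (use GI in \<open>simp_all add: mult.commute\<close>)
  qed
  also have "(LINT x:{u..v}|lborel. G u * complex_of_real (\<eta> x)) = 0" using \<eta>(3) by simp
  finally have "(LINT x:{u..v}|lborel. G x * of_real (\<eta> x)) = - (LINT x:{u..v}|lborel. g x * of_real (\<phi> x))"
    using ge by simp
  thus ?thesis using fe by (simp add: left_diff_distrib set_integral_diff(2)[OF prod[OF fi] prod[OF Gi]])
qed

text \<open>The trapezoid that equals 1 on \<open>[a, b]\<close> and 0 off \<open>[a - 1/m, b + 1/m]\<close>.\<close>

definition trapezoid :: "real \<Rightarrow> real \<Rightarrow> nat \<Rightarrow> real \<Rightarrow> real" where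
  "trapezoid a b m x = max 0 (1 - real m * max 0 (max (a - x) (x - b)))"

lemma trapezoid:
  shows "continuous_on UNIV (trapezoid a b m)" "0 \<le> trapezoid a b m x" "trapezoid a b m x \<le> 1"
  unfolding trapezoid_def by (auto intro!: continuous_intros)

lemma trapezoid_support:
  assumes "u < a" "b < v"
  shows "\<forall>\<^sub>F m in sequentially. \<forall>x. x \<notin> {u..v} \<longrightarrow> trapezoid a b m x = 0"
proof -
  define \<delta> where "\<delta> = min (a - u) (v - b)"
  have \<delta>: "0 < \<delta>" using assms by (simp add: \<delta>_def)
  obtain M where M: "1 / \<delta> < real M" using reals_Archimedean2 by blast
  have "trapezoid a b m x = 0" if m: "M \<le> m" and x: "x \<notin> {u..v}" for m x
  proof -
    have "\<delta> \<le> max 0 (max (a - x) (x - b))" using x assms by (auto simp: \<delta>_def)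
    moreover have "1 / \<delta> < real m" using M m by linarith
    ultimately have "(1 / \<delta>) * \<delta> \<le> real m * max 0 (max (a - x) (x - b))" using \<delta> by (intro mult_mono) auto
    thus ?thesis using \<delta> by (simp add: trapezoid_def)
  qed
  thus ?thesis unfolding eventually_sequentially by blast
qed

lemma trapezoid_tendsto: "(\<lambda>m. trapezoid a b m x) \<longlonglongrightarrow> indicator {a..b} x"
proof (cases "x \<in> {a..b}")
  case True
  hence "max 0 (max (a - x) (x - b)) = 0" by auto
  thus ?thesis using True by (simp add: trapezoid_def)
next
  case False
  have "\<forall>\<^sub>F m in sequentially. trapezoid a b m x = 0"
  proof -
    define \<delta> where "\<delta> = max 0 (max (a - x) (x - b))"
    have \<delta>: "0 < \<delta>" using False by (auto simp: \<delta>_def)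
    obtain M where M: "1 / \<delta> < real M" using reals_Archimedean2 by blast
    have "trapezoid a b m x = 0" if m: "M \<le> m" for m
    proof -
      have "1 / \<delta> < real m" using M m by linarith
      hence "1 < real m * \<delta>" using \<delta> by (simp add: field_simps)
      thus ?thesis by (simp add: trapezoid_def \<delta>_def)
    qed
    thus ?thesis unfolding eventually_sequentially by blast
  qed
  thus ?thesis using False by (auto intro: tendsto_eventually)
qed

lemma trapezoid_integral_tendsto:
  fixes k :: "real \<Rightarrow> complex"
  assumes k: "set_integrable lborel {u..v} k" and ab: "{a..b} \<subseteq> {u..v}"
  shows "(\<lambda>m. LINT x:{u..v}|lborel. k x * of_real (trapezoid a b m x)) \<longlonglongrightarrow> (LINT x:{a..b}|lborel. k x)"
proof -
  have [measurable]: "trapezoid a b m \<in> borel_measurable borel" for m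
    by (rule borel_measurable_continuous_onI[OF trapezoid(1)])
  define K where "K = (\<lambda>x. indicator {u..v} x *\<^sub>R k x)"
  have Ki: "integrable lborel K" using k by (simp add: K_def set_integrable_def)
  note [measurable] = borel_measurable_integrable[OF Ki]
  have "(\<lambda>m. LINT x|lborel. K x * of_real (trapezoid a b m x)) \<longlonglongrightarrow> (LINT x|lborel. K x * of_real (indicator {a..b} x))"
  proof (rule integral_dominated_convergence)
    show "integrable lborel (\<lambda>x. norm (K x))" using Ki by simp
    show "AE x in lborel. (\<lambda>m. K x * of_real (trapezoid a b m x)) \<longlonglongrightarrow> K x * of_real (indicator {a..b} x)"
      by (intro AE_I2 tendsto_intros trapezoid_tendsto)
    show "AE x in lborel. norm (K x * of_real (trapezoid a b m x)) \<le> norm (K x)" for m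
      using trapezoid(2,3)[of a b m] by (intro AE_I2) (simp add: norm_mult mult_left_le)
  qed measurable
  moreover have "(LINT x|lborel. K x * of_real (indicator {a..b} x)) = (LINT x:{a..b}|lborel. k x)"
    unfolding set_lebesgue_integral_def K_def
    by (rule Bochner_Integration.integral_cong) (use ab in \<open>auto simp: indicator_def\<close>)
  ultimately show ?thesis by (simp add: set_lebesgue_integral_def K_def)
qed

text \<open>Dominated convergence passes from intervals to half-lines and to the whole line.
  Half-lines are stable under intersection and generate the Borel sets, so Dynkin's argument makes
  all integrals of \<open>k\<close> over Borel sets vanish.\<close>

lemma AE_zero_of_interval_integrals:
  fixes k :: "real \<Rightarrow> complex"
  assumes k: "integrable lborel k" and z: "\<And>a b. a \<le> b \<Longrightarrow> (LINT x:{a..b}|lborel. k x) = 0"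
  shows "AE x in lborel. k x = 0"
proof (rule sigma_finite_measure.density_zero[OF lborel.sigma_finite_measure_axioms k])
  note [measurable] = borel_measurable_integrable[OF k]
  have lim: "(\<lambda>m. LINT x:{- real m..b m}|lborel. k x) \<longlonglongrightarrow> (LINT x:B|lborel. k x)"
    if "\<And>x. \<forall>\<^sub>F m in sequentially. x \<in> {- real m..b m} \<longleftrightarrow> x \<in> B" and [measurable]: "B \<in> sets borel" for b :: "nat \<Rightarrow> real" and B
    unfolding set_lebesgue_integral_def
  proof (rule integral_dominated_convergence)
    show "AE x in lborel. (\<lambda>m. indicator {- real m..b m} x *\<^sub>R k x) \<longlonglongrightarrow> indicator B x *\<^sub>R k x"
    proof (rule AE_I2, rule tendsto_eventually)
      show "\<forall>\<^sub>F m in sequentially. indicator {- real m..b m} x *\<^sub>R k x = indicator B x *\<^sub>R k x" for x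
        using that(1)[of x] by eventually_elim (simp add: indicator_def)
    qed
    show "integrable lborel (\<lambda>x. norm (k x))" using k by simp
  qed (auto simp: indicator_def)
  have z': "(LINT x:{a..b}|lborel. k x) = 0" for a b
    using z[of a b] by (cases "a \<le> b") (auto simp: set_lebesgue_integral_def)
  have half: "(LINT x:{..a}|lborel. k x) = 0" for a
  proof (rule LIMSEQ_unique[OF lim[of "\<lambda>_. a"]])
    show "\<forall>\<^sub>F m in sequentially. x \<in> {- real m..a} \<longleftrightarrow> x \<in> {..a}" for x
      using eventually_ge_at_top[of "nat \<lceil>- x\<rceil>"] by eventually_elim auto
  qed (simp_all add: z')
  have all: "(LINT x|lborel. k x) = 0"
  proof -
    have "(LINT x:UNIV|lborel. k x) = 0"
    proof (rule LIMSEQ_unique[OF lim[of "\<lambda>m. real m"]])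
      show "\<forall>\<^sub>F m in sequentially. x \<in> {- real m..real m} \<longleftrightarrow> x \<in> UNIV" for x
        using eventually_ge_at_top[of "nat \<lceil>\<bar>x\<bar>\<rceil>"] by eventually_elim auto
    qed (simp_all add: z')
    thus ?thesis by (simp add: set_lebesgue_integral_def)
  qed
  fix A :: "real set" assume "A \<in> sets lborel"
  moreover have gen: "sets borel = sigma_sets UNIV (range (\<lambda>a::real. {..a}))"
    by (subst borel_eq_atMost) simp
  ultimately have A: "A \<in> sigma_sets UNIV (range (\<lambda>a::real. {..a}))" by simp
  have int: "Int_stable (range (\<lambda>a::real. {..a}))" by (auto simp: Int_stable_def)
  have sub: "range (\<lambda>a::real. {..a}) \<subseteq> Pow UNIV" by simp
  from A show "(LINT x:A|lborel. k x) = 0"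
  proof (induction A rule: sigma_sets_induct_disjoint[OF int sub, consumes 1, case_names basic empty compl union])
    case (compl A)
    hence [measurable]: "A \<in> sets borel" using gen by simp
    have i: "integrable lborel (\<lambda>x. indicator B x *\<^sub>R k x)" if "B \<in> sets lborel" for B
      by (intro integrable_mult_indicator k that)
    have "(LINT x:A|lborel. k x) + (LINT x:UNIV - A|lborel. k x) =
        (LINT x|lborel. indicator A x *\<^sub>R k x + indicator (UNIV - A) x *\<^sub>R k x)"
      unfolding set_lebesgue_integral_def
      by (rule Bochner_Integration.integral_add[symmetric]; rule i) auto
    also have "\<dots> = (LINT x|lborel. k x)"
      by (rule Bochner_Integration.integral_cong) (auto simp: indicator_def)
    finally have "(LINT x:A|lborel. k x) + (LINT x:UNIV - A|lborel. k x) = (LINT x|lborel. k x)" .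
    thus ?case using compl all by simp
  next
    case (union A)
    hence [measurable]: "A i \<in> sets borel" for i using gen by auto
    have "(LINT x:(\<Union>i. A i)|lborel. k x) = (\<Sum>i. LINT x:A i|lborel. k x)"
      by (rule lebesgue_integral_countable_add)
        (use union k in \<open>auto simp: disjoint_family_on_def set_integrable_def intro!: integrable_mult_indicator\<close>)
    thus ?case using union by simp
  next
    case (basic A)
    thus ?case using half by auto
  qed (simp add: set_lebesgue_integral_def)
qed

text \<open>This says that \<open>f - G\<close> has the same mean over all compact subintervals. Two
  trapezoids, each multiplied by the integral of the other, differ by a function of mean zero;
  continuous trapezoids stand in for the indicators, which are too rough to test with.\<close>

lemma weak_derivative_integral_proportional:
  assumes w: "has_weak_derivative_on f g S" and S: "{u..v} \<subseteq> S" "S \<in> sets borel"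
    and a: "u < a" "a \<le> b" "b < v" and a0: "u < a0" "a0 \<le> b0" "b0 < v"
    and fi: "set_integrable lborel {u..v} f" and gi: "set_integrable lborel {u..v} g"
    and G: "\<And>x. x \<in> {u..v} \<Longrightarrow> G x = G u + (LINT y:{u..x}|lborel. g y)" and Gc: "continuous_on {u..v} G"
  shows "of_real (b0 - a0) * (LINT x:{a..b}|lborel. f x - G x) = of_real (b - a) * (LINT x:{a0..b0}|lborel. f x - G x)"
proof -
  define J where "J = (\<lambda>a b m. LINT x:{u..v}|lborel. trapezoid a b m x)"
  define h where "h = (\<lambda>x. f x - G x)"
  have hi: "set_integrable lborel {u..v} h"
    unfolding h_def by (intro set_integral_diff fi borel_integrable_atLeastAtMost'[OF Gc])
  have Jc: "(LINT x:{u..v}|lborel. complex_of_real (trapezoid a b m x)) = of_real (J a b m)" for a b m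
    unfolding J_def by (rule set_integral_complex_of_real)
  have Jlim: "(\<lambda>m. of_real (J a b m) :: complex) \<longlonglongrightarrow> of_real (b - a)" if "u < a" "a \<le> b" "b < v" for a b
  proof -
    have "(\<lambda>m. LINT x:{u..v}|lborel. 1 * complex_of_real (trapezoid a b m x)) \<longlonglongrightarrow> (LINT x:{a..b}|lborel. 1)"
      by (rule trapezoid_integral_tendsto)
        (use that in \<open>auto intro!: borel_integrable_atLeastAtMost' continuous_intros\<close>)
    moreover have "(LINT x:{a..b}|lborel. (1::complex)) = of_real (b - a)"
      using that by (simp add: set_lebesgue_integral_def scaleR_conv_of_real)
    ultimately show ?thesis by (simp add: Jc)
  qed
  define H where "H = (\<lambda>a b m. LINT x:{u..v}|lborel. h x * of_real (trapezoid a b m x))"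
  have Hlim: "H a b \<longlonglongrightarrow> (LINT x:{a..b}|lborel. h x)" if "u < a" "a \<le> b" "b < v" for a b
    unfolding H_def by (rule trapezoid_integral_tendsto[OF hi]) (use that in auto)
  have tc: "continuous_on UNIV (\<lambda>x. complex_of_real (trapezoid a b m x))" for a b m
    by (intro continuous_intros trapezoid(1))
  have ti: "set_integrable lborel {u..v} (\<lambda>x. complex_of_real (trapezoid a b m x))" for a b m
    by (rule borel_integrable_atLeastAtMost'[OF continuous_on_subset[OF tc]]) auto
  have ev: "\<forall>\<^sub>F m in sequentially. of_real (J a0 b0 m) * H a b m = of_real (J a b m) * H a0 b0 m"
    using trapezoid_support[OF a(1,3)] trapezoid_support[OF a0(1,3)]
  proof eventually_elim
    case (elim m)
    define \<eta> where "\<eta> = (\<lambda>x. J a0 b0 m * trapezoid a b m x - J a b m * trapezoid a0 b0 m x)"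
    have "(LINT x:{u..v}|lborel. h x * of_real (\<eta> x)) = 0"
      unfolding h_def
    proof (rule weak_derivative_orthogonal[OF w S _ fi gi G Gc])
      show "continuous_on UNIV \<eta>" unfolding \<eta>_def by (intro continuous_intros trapezoid(1))
      show "\<eta> x = 0" if "x \<notin> {u..v}" for x using elim that by (simp add: \<eta>_def)
      have "(LINT x:{u..v}|lborel. complex_of_real (\<eta> x)) =
        (LINT x:{u..v}|lborel. of_real (J a0 b0 m) * complex_of_real (trapezoid a b m x)) -
        (LINT x:{u..v}|lborel. of_real (J a b m) * complex_of_real (trapezoid a0 b0 m x))"
        unfolding \<eta>_def of_real_diff of_real_mult
        by (rule set_integral_diff(2)) (intro set_integrable_mult_right ti)+
      thus "(LINT x:{u..v}|lborel. complex_of_real (\<eta> x)) = 0" by (simp add: Jc)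
    qed (use a in auto)
    moreover have "(LINT x:{u..v}|lborel. h x * of_real (\<eta> x)) =
       (LINT x:{u..v}|lborel. of_real (J a0 b0 m) * (h x * of_real (trapezoid a b m x)) -
         of_real (J a b m) * (h x * of_real (trapezoid a0 b0 m x)))"
      by (simp add: \<eta>_def algebra_simps)
    moreover have "\<dots> = (LINT x:{u..v}|lborel. of_real (J a0 b0 m) * (h x * of_real (trapezoid a b m x))) -
       (LINT x:{u..v}|lborel. of_real (J a b m) * (h x * of_real (trapezoid a0 b0 m x)))"
      by (rule set_integral_diff(2)) (intro set_integrable_mult_right set_integrable_times_continuous hi tc)+
    ultimately show ?case by (simp add: H_def)
  qed
  have L: "(\<lambda>m. of_real (J a0 b0 m) * H a b m) \<longlonglongrightarrow> of_real (b0 - a0) * (LINT x:{a..b}|lborel. h x)"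
    by (intro tendsto_mult Jlim Hlim a a0)
  from Lim_transform_eventually[OF L ev]
  have "(\<lambda>m. of_real (J a b m) * H a0 b0 m) \<longlonglongrightarrow> of_real (b0 - a0) * (LINT x:{a..b}|lborel. h x)" .
  moreover have "(\<lambda>m. of_real (J a b m) * H a0 b0 m) \<longlonglongrightarrow> of_real (b - a) * (LINT x:{a0..b0}|lborel. h x)"
    by (intro tendsto_mult Jlim Hlim a a0)
  ultimately have "of_real (b0 - a0) * (LINT x:{a..b}|lborel. h x) = of_real (b - a) * (LINT x:{a0..b0}|lborel. h x)"
    by (rule LIMSEQ_unique)
  thus ?thesis by (simp only: h_def)
qed

lemma einterval_Icc_subset:
  assumes "x \<in> einterval A B" "y \<in> einterval A B"
  shows "{x..y} \<subseteq> einterval A B"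
proof
  fix z assume "z \<in> {x..y}"
  hence "ereal x \<le> ereal z" "ereal z \<le> ereal y" by auto
  moreover have "A < ereal x" "ereal y < B" using assms by (auto simp: einterval_iff)
  ultimately show "z \<in> einterval A B"
    using le_less_trans[of "ereal z" "ereal y" B] less_le_trans[of A "ereal x" "ereal z"]
    by (simp add: einterval_iff)
qed

lemma einterval_extend:
  assumes "x \<in> einterval A B"
  obtains u v where "u < x" "x < v" "u \<in> einterval A B" "v \<in> einterval A B"
proof -
  obtain e where e: "0 < e" "ball x e \<subseteq> einterval A B"
    using assms open_einterval open_contains_ball by metis
  have "x - e / 2 \<in> ball x e" "x + e / 2 \<in> ball x e" using e by (simp_all add: dist_real_def)
  hence "x - e / 2 \<in> einterval A B" "x + e / 2 \<in> einterval A B" using e(2) by blast+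
  thus thesis using that[of "x - e / 2" "x + e / 2"] e(1) by simp
qed

text \<open>The constant is the mean of \<open>f - G\<close> over one reference interval. Since all
  means agree, \<open>f - G - C\<close> integrates to zero over every compact subinterval and hence
  vanishes almost everywhere.\<close>

lemma weak_derivative_representation:
  assumes w: "has_weak_derivative_on f g (einterval A B)" and AB: "A < B"
    and fi: "\<And>u v. set_integrable lborel {u..v} f" and gi: "\<And>u v. set_integrable lborel {u..v} g"
    and G: "\<And>x y. x \<le> y \<Longrightarrow> G y - G x = (LINT z:{x..y}|lborel. g z)" and Gc: "continuous_on UNIV G"
  obtains C where "AE x in lborel. x \<in> einterval A B \<longrightarrow> f x = C + G x"
proof -
  define S where "S = einterval A B"
  note Sub = einterval_Icc_subset[of _ A B, folded S_def] and Ext = einterval_extend[of _ A B, folded S_def]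
  obtain a0 where a0: "a0 \<in> S" using einterval_nonempty[OF AB] by (auto simp: S_def)
  obtain b0 where b0: "a0 < b0" "b0 \<in> S" using Ext[OF a0] by metis
  define h where "h = (\<lambda>x. f x - G x)"
  define C where "C = (LINT x:{a0..b0}|lborel. h x) / of_real (b0 - a0)"
  have hi: "set_integrable lborel {u..v} h" for u v
    unfolding h_def by (intro set_integral_diff fi borel_integrable_atLeastAtMost' continuous_on_subset[OF Gc]) auto
  have ci: "set_integrable lborel {u..v} (\<lambda>_. C)" for u v :: real
    by (intro borel_integrable_atLeastAtMost' continuous_intros)
  have key: "(LINT x:{a..b}|lborel. h x - C) = 0" if ab: "a \<le> b" "a \<in> S" "b \<in> S" for a b
  proof -
    have "min a a0 \<in> S" "max b b0 \<in> S" using ab a0 b0 by (auto simp: min_def max_def)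
    then obtain u v where uv: "u < min a a0" "max b b0 < v" "u \<in> S" "v \<in> S" using Ext by metis
    have "of_real (b0 - a0) * (LINT x:{a..b}|lborel. f x - G x) = of_real (b - a) * (LINT x:{a0..b0}|lborel. f x - G x)"
    proof (rule weak_derivative_integral_proportional[OF w])
      show "{u..v} \<subseteq> einterval A B" using Sub[OF uv(3,4)] by (simp add: S_def)
      show "G x = G u + (LINT y:{u..x}|lborel. g y)" if "x \<in> {u..v}" for x
        using G[of u x] that by (metis add.commute atLeastAtMost_iff diff_add_cancel)
    qed (use uv ab b0 fi gi in \<open>auto intro: continuous_on_subset[OF Gc]\<close>)
    hence "(LINT x:{a..b}|lborel. h x) = of_real (b - a) * C"
      using b0 by (simp add: C_def h_def field_simps)
    moreover have "(LINT x:{a..b}|lborel. C) = of_real (b - a) * C"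
      using ab by (simp add: set_lebesgue_integral_def scaleR_conv_of_real)
    ultimately show ?thesis by (simp add: set_integral_diff(2)[OF hi ci])
  qed
  have ae: "AE x in lborel. x \<in> {p..q} \<longrightarrow> h x = C" if pq: "p \<in> S" "q \<in> S" for p q
  proof -
    define k where "k = (\<lambda>x. indicator {p..q} x *\<^sub>R (h x - C))"
    have "AE x in lborel. k x = 0"
    proof (rule AE_zero_of_interval_integrals)
      show "integrable lborel k" using set_integral_diff(1)[OF hi ci, of p q] by (simp add: k_def set_integrable_def)
      fix a b :: real assume "a \<le> b"
      have "(LINT x:{a..b}|lborel. k x) = (LINT x:{max a p..min b q}|lborel. h x - C)"
        unfolding set_lebesgue_integral_def k_def
        by (rule Bochner_Integration.integral_cong) (auto simp: indicator_def)
      also have "\<dots> = 0"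
      proof (cases "max a p \<le> min b q")
        case True
        hence "max a p \<in> {p..q}" "min b q \<in> {p..q}" by auto
        thus ?thesis using Sub[OF pq] True by (intro key) auto
      qed (simp add: set_lebesgue_integral_def)
      finally show "(LINT x:{a..b}|lborel. k x) = 0" .
    qed
    thus ?thesis by eventually_elim (auto simp: k_def)
  qed
  \<comment> \<open>Rational endpoints reduce the open interval to countably many compact ones, so
    the exceptional null sets can be united.\<close>
  have "AE x in lborel. \<forall>p\<in>\<rat> \<inter> S. \<forall>q\<in>\<rat> \<inter> S. x \<in> {p..q} \<longrightarrow> h x = C"
    by (intro AE_ball_countable' ae countable_Int1 countable_rat) auto
  hence "AE x in lborel. x \<in> einterval A B \<longrightarrow> f x = C + G x"
  proof eventually_elim
    case (elim x)
    show ?case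
    proof
      assume "x \<in> einterval A B"
      then obtain u v where uv: "u < x" "x < v" "u \<in> S" "v \<in> S" using Ext[of x] by (auto simp: S_def)
      obtain p q where pq: "p \<in> \<rat>" "u < p" "p < x" "q \<in> \<rat>" "x < q" "q < v"
        using Rats_dense_in_real[OF uv(1)] Rats_dense_in_real[OF uv(2)] by blast
      hence "p \<in> S" "q \<in> S" using Sub[OF uv(3,4)] by auto
      hence "x \<in> {p..q} \<longrightarrow> h x = C" using elim pq by blast
      thus "f x = C + G x" using pq by (auto simp: h_def algebra_simps)
    qed
  qed
  thus thesis by (rule that)
qed

lemma locally_integrable_primitive:
  fixes g :: "real \<Rightarrow> complex"
  assumes g: "\<And>u v. set_integrable lborel {u..v} g"
  obtains G where "\<And>x y. x \<le> y \<Longrightarrow> G y - G x = (LINT z:{x..y}|lborel. g z)" "continuous_on UNIV G"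
proof -
  define G where "G = (\<lambda>x::real. LBINT z=0..ereal x. g z)"
  have diff: "G y - G x = (LINT z:{x..y}|lborel. g z)" if "x \<le> y" for x y
  proof -
    have "interval_lebesgue_integrable lborel (min (ereal 0) (min (ereal x) (ereal y))) (max (ereal 0) (max (ereal x) (ereal y))) g"
    proof -
      have mm: "min (ereal 0) (min (ereal x) (ereal y)) = ereal (min 0 (min x y))"
        "max (ereal 0) (max (ereal x) (ereal y)) = ereal (max 0 (max x y))"
        by (auto simp: min_def max_def)
      have sub: "{p<..<q} \<subseteq> {p..q}" for p q :: real by auto
      have *: "interval_lebesgue_integrable lborel (ereal p) (ereal q) g" if "p \<le> q" for p q
        using that set_integrable_subset[OF g[of p q] _ sub] by (simp add: interval_lebesgue_integrable_def)
      show ?thesis unfolding mm by (rule *) linarith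
    qed
    hence "(LBINT z=ereal 0..ereal x. g z) + (LBINT z=ereal x..ereal y. g z) = (LBINT z=ereal 0..ereal y. g z)"
      by (rule interval_integral_sum)
    thus ?thesis using that unfolding G_def zero_ereal_def interval_integral_Icc[OF that, symmetric]
      by (metis add_diff_cancel_left')
  qed
  have "continuous_on UNIV G"
  proof (rule continuous_at_imp_continuous_on, rule ballI)
    fix x :: real
    have "continuous_on {x - 1..x + 1} (\<lambda>y. integral {x - 1..y} g)"
      by (intro indefinite_integral_continuous_1 set_borel_integral_eq_integral g)
    hence "continuous_on {x - 1..x + 1} (\<lambda>y. G (x - 1) + integral {x - 1..y} g)" by (intro continuous_intros)
    moreover have "G (x - 1) + integral {x - 1..y} g = G y" if "y \<in> {x - 1..x + 1}" for y
      using diff[of "x - 1" y] set_borel_integral_eq_integral(2)[OF g, of "x - 1" y] that by (simp add: algebra_simps)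
    ultimately have "continuous_on {x - 1..x + 1} G" by (rule continuous_on_eq)
    thus "isCont G x" by (rule continuous_on_interior) (auto simp: interior_atLeastAtMost_real)
  qed
  with diff show thesis by (rule that)
qed

section \<open>Piecewise weakly differentiable data\<close>

lemma square_integrable_add:
  assumes "square_integrable_on f UNIV" "square_integrable_on g UNIV"
  shows "square_integrable_on (\<lambda>x. f x + g x) UNIV"
proof -
  note [measurable] = square_integrable_UNIV_D(1)[OF assms(1)] square_integrable_UNIV_D(1)[OF assms(2)]
  have "2 * l2sq f + 2 * l2sq g < \<infinity>"
    using square_integrable_UNIV_D(2)[OF assms(1)] square_integrable_UNIV_D(2)[OF assms(2)]
    by (simp add: ennreal_mult_less_top)
  hence "l2sq (\<lambda>x. f x + g x) < \<infinity>" using l2sq_add_le[of f g] by (auto intro: le_less_trans)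
  thus ?thesis by (simp add: square_integrable_UNIV_iff)
qed

lemma square_integrable_sum:
  assumes "finite A" "\<And>i. i \<in> A \<Longrightarrow> square_integrable_on (f i) UNIV"
  shows "square_integrable_on (\<lambda>x. \<Sum>i\<in>A. f i x) UNIV"
  using assms
proof (induction A rule: finite_induct)
  case empty
  show ?case by (simp add: square_integrable_UNIV_iff l2sq_def)
next
  case (insert i A)
  hence "square_integrable_on (\<lambda>x. f i x + (\<Sum>i\<in>A. f i x)) UNIV" by (intro square_integrable_add) auto
  thus ?case using insert by simp
qed

lemma square_integrable_locally:
  assumes "square_integrable_on f UNIV"
  shows "set_integrable lborel {u..v::real} f"
  by (rule square_integrable_imp_integrable[OF assms]) (auto simp: emeasure_lborel_Icc_eq)

locale piecewise_H1 =
  fixes q0 :: "real \<Rightarrow> complex" and c :: "nat \<Rightarrow> ereal" and N :: nat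
  assumes q0: "square_integrable_on q0 UNIV"
    and c0: "c 0 = -\<infinity>" and cN: "c (Suc N) = \<infinity>" and mono: "strict_mono_on {0..Suc N} c"
    and H1: "\<And>j. j \<le> N \<Longrightarrow> has_L2_derivative_on q0 (einterval (c j) (c (Suc j)))"
begin

text \<open>\<open>real_of_ereal\<close> sends the infinite ends \<open>c 0\<close> and
  \<open>c (Suc N)\<close> to 0, so only the indices from 1 to \<open>N\<close> name actual break
  points.\<close>

definition node :: "nat \<Rightarrow> real" where
  "node j = real_of_ereal (c j)"

lemma c_less: "i < j \<Longrightarrow> j \<le> Suc N \<Longrightarrow> c i < c j"
  using mono by (auto simp: strict_mono_on_def)

lemma c_node: "1 \<le> j \<Longrightarrow> j \<le> N \<Longrightarrow> c j = ereal (node j)"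
  using c_less[of 0 j] c_less[of j "Suc N"] c0 cN by (cases "c j") (auto simp: node_def)

lemma node_less: "1 \<le> i \<Longrightarrow> i < j \<Longrightarrow> j \<le> N \<Longrightarrow> node i < node j"
  using c_less[of i j] c_node[of i] c_node[of j] by simp

lemma node_inj: "1 \<le> i \<Longrightarrow> i \<le> N \<Longrightarrow> 1 \<le> j \<Longrightarrow> j \<le> N \<Longrightarrow> i \<noteq> j \<Longrightarrow> node i \<noteq> node j"
  using node_less[of i j] node_less[of j i] by (cases "i < j") auto

lemma einterval_disjoint:
  assumes "x \<in> einterval (c i) (c (Suc i))" "x \<in> einterval (c j) (c (Suc j))" "i \<le> N" "j \<le> N"
  shows "i = j"
proof (rule ccontr)
  assume "i \<noteq> j"
  then consider "Suc i \<le> j" | "Suc j \<le> i" by linarith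
  thus False
  proof cases
    case 1
    hence "c (Suc i) \<le> c j" using c_less[of "Suc i" j] assms by (cases "Suc i = j") auto
    thus False using assms by (auto simp: einterval_iff)
  next
    case 2
    hence "c (Suc j) \<le> c i" using c_less[of "Suc j" i] assms by (cases "Suc j = i") auto
    thus False using assms by (auto simp: einterval_iff)
  qed
qed

text \<open>The derivatives on the pieces, extended by zero and added, form one global
  \<open>g\<close> in L2. A single primitive \<open>G\<close> is continuous across the nodes, so
  every discontinuity is left in the constants \<open>K j\<close>.\<close>

lemma pieces:
  obtains g G K where "square_integrable_on g UNIV"
    "\<And>x y. x \<le> y \<Longrightarrow> G y - G x = (LINT z:{x..y}|lborel. g z)" "continuous_on UNIV G"
    "\<And>j. j \<le> N \<Longrightarrow> AE x in lborel. x \<in> einterval (c j) (c (Suc j)) \<longrightarrow> q0 x = K j + G x"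
proof -
  define S where "S = (\<lambda>j. einterval (c j) (c (Suc j)))"
  have "\<forall>j. \<exists>g. j \<le> N \<longrightarrow> square_integrable_on g (S j) \<and> has_weak_derivative_on q0 g (S j)"
    using H1 by (auto simp: has_L2_derivative_on_def S_def)
  then obtain d where d: "\<And>j. j \<le> N \<Longrightarrow> square_integrable_on (d j) (S j)"
    "\<And>j. j \<le> N \<Longrightarrow> has_weak_derivative_on q0 (d j) (S j)" by metis
  define g where "g = (\<lambda>x. \<Sum>j\<le>N. indicator (S j) x *\<^sub>R d j x)"
  have g2: "square_integrable_on g UNIV"
    unfolding g_def by (intro square_integrable_sum) (use d(1) in \<open>auto simp: square_integrable_on_iff[of "d _" "S _"]\<close>)
  have gS: "g x = d j x" if "x \<in> S j" "j \<le> N" for x j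
  proof -
    have "g x = (\<Sum>i\<le>N. if i = j then d j x else 0)"
      unfolding g_def
    proof (rule sum.cong[OF refl])
      fix i assume "i \<in> {..N}"
      hence "x \<in> S i \<longleftrightarrow> i = j" using einterval_disjoint[of x i j] that by (auto simp: S_def)
      thus "indicator (S i) x *\<^sub>R d i x = (if i = j then d j x else 0)" using that(1) by (cases "i = j") auto
    qed
    thus ?thesis using that by simp
  qed
  have wg: "has_weak_derivative_on q0 g (S j)" if j: "j \<le> N" for j
  proof -
    have "(LINT x:S j|lborel. g x * F x) = (LINT x:S j|lborel. d j x * F x)" for F :: "real \<Rightarrow> complex"
      unfolding set_lebesgue_integral_def
      by (rule Bochner_Integration.integral_cong) (use gS j in \<open>auto simp: indicator_def\<close>)
    thus ?thesis using d(2)[OF j] by (simp add: has_weak_derivative_on_def)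
  qed
  obtain G where G: "\<And>x y. x \<le> y \<Longrightarrow> G y - G x = (LINT z:{x..y}|lborel. g z)" "continuous_on UNIV G"
    using locally_integrable_primitive[OF square_integrable_locally[OF g2]] by blast
  have "\<exists>C. AE x in lborel. x \<in> S j \<longrightarrow> q0 x = C + G x" if j: "j \<le> N" for j
    using weak_derivative_representation[OF wg[OF j, unfolded S_def] _ square_integrable_locally[OF q0]
       square_integrable_locally[OF g2] G] c_less[of j "Suc j"] j by (auto simp: S_def)
  hence "\<forall>j. \<exists>C. j \<le> N \<longrightarrow> (AE x in lborel. x \<in> S j \<longrightarrow> q0 x = C + G x)" by blast
  then obtain K where "\<And>j. j \<le> N \<Longrightarrow> AE x in lborel. x \<in> S j \<longrightarrow> q0 x = K j + G x" by metis
  thus thesis using that[OF g2 G] by (auto simp: S_def)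
qed

end

text \<open>\<open>Lim\<close> determines a value only for a non-trivial filter. That is the purpose
  of \<open>pos\<close>: each neighbourhood in \<open>F\<close> contains an interval of positive
  length, which no null set exhausts.\<close>

lemma ae_one_sided_limit:
  fixes f G :: "real \<Rightarrow> complex" and F :: "real filter"
  assumes G: "isCont G a" and F: "F \<le> at a" and ev: "\<forall>\<^sub>F x in F. x \<in> {u<..<v}"
    and ae: "AE x in lborel. x \<in> {u<..<v} \<longrightarrow> f x = K + G x"
    and pos: "\<And>P. eventually P F \<Longrightarrow> \<exists>p q. p < q \<and> (\<forall>x\<in>{p<..<q}. P x)"
  shows "Lim (inf F (ae_filter lborel)) f = K + G a"
proof (rule tendsto_Lim)
  show "inf F (ae_filter lborel) \<noteq> bot"
  proof
    assume "inf F (ae_filter lborel) = bot"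
    then obtain P Q where PQ: "eventually P F" "AE x in lborel. Q x" "\<And>x. P x \<Longrightarrow> \<not> Q x"
      by (auto simp: trivial_limit_def eventually_inf)
    obtain p q where pq: "p < q" "\<And>x. x \<in> {p<..<q} \<Longrightarrow> P x" using pos[OF PQ(1)] by blast
    have "AE x in lborel. x \<notin> {p<..<q}" using PQ(2) by eventually_elim (use PQ(3) pq in blast)
    hence "emeasure lborel {p<..<q} = 0"
      by (subst (asm) AE_iff_measurable[of "{p<..<q}"]) auto
    thus False using pq by simp
  qed
  have "((\<lambda>x. K + G x) \<longlongrightarrow> K + G a) (inf F (ae_filter lborel))"
    using G F by (intro tendsto_intros) (auto simp: isCont_def intro: tendsto_mono le_infI1)
  moreover have "\<forall>\<^sub>F x in inf F (ae_filter lborel). K + G x = f x"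
    unfolding eventually_inf
    by (intro exI[of _ "\<lambda>x. x \<in> {u<..<v}"] exI[of _ "\<lambda>x. x \<in> {u<..<v} \<longrightarrow> f x = K + G x"]
        conjI ev ae allI impI) simp
  ultimately show "(f \<longlongrightarrow> K + G a) (inf F (ae_filter lborel))" by (rule Lim_transform_eventually)
qed

lemma jump_eq:
  fixes f G :: "real \<Rightarrow> complex"
  assumes G: "isCont G a" and u: "u < a" and v: "a < v"
    and L: "AE x in lborel. x \<in> {u<..<a} \<longrightarrow> f x = Kl + G x"
    and R: "AE x in lborel. x \<in> {a<..<v} \<longrightarrow> f x = Kr + G x"
  shows "jump f a = Kr - Kl"
proof -
  have "right_limit f a = Kr + G a" unfolding right_limit_def
  proof (rule ae_one_sided_limit[OF G _ _ R])
    show "at_right a \<le> at a" by (simp add: at_le)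
    show "\<forall>\<^sub>F x in at_right a. x \<in> {a<..<v}" using v by (auto simp: eventually_at_right intro!: exI[of _ v])
    show "\<exists>p q. p < q \<and> (\<forall>x\<in>{p<..<q}. P x)" if P: "eventually P (at_right a)" for P
    proof -
      obtain b where "a < b" "\<forall>y>a. y < b \<longrightarrow> P y" using P by (auto simp: eventually_at_right[OF v])
      thus ?thesis by (intro exI[of _ a] exI[of _ b]) simp
    qed
  qed
  moreover have "left_limit f a = Kl + G a" unfolding left_limit_def
  proof (rule ae_one_sided_limit[OF G _ _ L])
    show "at_left a \<le> at a" by (simp add: at_le)
    show "\<forall>\<^sub>F x in at_left a. x \<in> {u<..<a}" using u by (auto simp: eventually_at_left intro!: exI[of _ u])
    show "\<exists>p q. p < q \<and> (\<forall>x\<in>{p<..<q}. P x)" if P: "eventually P (at_left a)" for P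
    proof -
      obtain b where "b < a" "\<forall>y>b. y < a \<longrightarrow> P y" using P by (auto simp: eventually_at_left[OF u])
      thus ?thesis by (intro exI[of _ b] exI[of _ a]) simp
    qed
  qed
  ultimately show ?thesis by (simp add: jump_def)
qed

context piecewise_H1
begin

text \<open>The datum becomes a continuous function plus step functions: if \<open>x\<close> lies in
  piece \<open>m\<close>, the steps to its left telescope to \<open>K m - K 0\<close>. The
  difference \<open>K j - K (j - 1)\<close> is the jump at node \<open>j\<close> because
  \<open>G\<close> is continuous there.\<close>

lemma representation:
  obtains g G J K where "square_integrable_on g UNIV"
    "\<And>x y. x \<le> y \<Longrightarrow> G y - G x = (LINT z:{x..y}|lborel. g z)" "continuous_on UNIV G"
    "AE x in lborel. q0 x = K + G x + (\<Sum>j=1..N. if node j < x then J j else 0)"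
    "\<And>j. 1 \<le> j \<Longrightarrow> j \<le> N \<Longrightarrow> J j = jump q0 (node j)"
proof (rule pieces)
  fix g G K
  assume g: "square_integrable_on g UNIV"
    and G: "\<And>x y. x \<le> y \<Longrightarrow> G y - G x = (LINT z:{x..y}|lborel. g z)" "continuous_on UNIV G"
    and K: "\<And>j. j \<le> N \<Longrightarrow> AE x in lborel. x \<in> einterval (c j) (c (Suc j)) \<longrightarrow> q0 x = K j + G x"
  define J where "J = (\<lambda>j. K j - K (j - 1))"
  have "AE x in lborel. \<forall>j\<in>{..N}. x \<in> einterval (c j) (c (Suc j)) \<longrightarrow> q0 x = K j + G x"
    by (rule AE_finite_allI) (use K in auto)
  moreover have "AE x in lborel. x \<notin> node ` {1..N}"
    by (intro AE_not_in countable_imp_null_set_lborel) auto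
  ultimately have "AE x in lborel. q0 x = K 0 + G x + (\<Sum>j=1..N. if node j < x then J j else 0)"
  proof eventually_elim
    case (elim x)
    define A where "A = {j. j \<le> N \<and> c j < ereal x}"
    have A: "finite A" "0 \<in> A" by (auto simp: A_def c0)
    define m where "m = Max A"
    have m: "m \<in> A" "\<And>j. j \<in> A \<Longrightarrow> j \<le> m" using A unfolding m_def by (auto intro: Max_in)
    have "ereal x < c (Suc m)"
    proof (cases "m = N")
      case False
      hence mN: "Suc m \<le> N" using m(1) by (auto simp: A_def)
      hence "\<not> c (Suc m) < ereal x" using m(2)[of "Suc m"] by (auto simp: A_def)
      moreover have "x \<noteq> node (Suc m)" using elim(2) mN by auto
      ultimately show ?thesis using c_node[of "Suc m"] mN by auto
    qed (simp add: cN)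
    hence "q0 x = K m + G x" using elim(1) m(1) by (auto simp: A_def einterval_iff)
    moreover have "(\<Sum>j=1..N. if node j < x then J j else 0) = (\<Sum>j=1..m. J j)"
    proof (rule sum.mono_neutral_cong_right)
      have less: "node j < x \<longleftrightarrow> j \<le> m" if "j \<in> {1..N}" for j
      proof
        assume "node j < x"
        thus "j \<le> m" using that c_node[of j] by (intro m(2)) (auto simp: A_def)
      next
        assume "j \<le> m"
        hence "c j \<le> c m" using c_less[of j m] m(1) by (cases "j = m") (auto simp: A_def)
        hence "c j < ereal x" using m(1) by (auto simp: A_def)
        thus "node j < x" using that c_node[of j] by auto
      qed
      show "\<forall>i\<in>{1..N} - {1..m}. (if node i < x then J i else 0) = 0" using less by auto
      show "{1..m} \<subseteq> {1..N}" using m(1) by (auto simp: A_def)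
      thus "\<And>i. i \<in> {1..m} \<Longrightarrow> (if node i < x then J i else 0) = J i" using less by auto
    qed simp
    moreover have "(\<Sum>j=1..m. J j) = K m - K 0"
      unfolding J_def by (induction m) auto
    ultimately show ?case by simp
  qed
  moreover have "J j = jump q0 (node j)" if j: "1 \<le> j" "j \<le> N" for j
  proof -
    obtain u where u: "u < node j" "{u<..<node j} \<subseteq> einterval (c (j - 1)) (c j)"
    proof -
      have "c (j - 1) < ereal (node j)" using c_less[of "j - 1" j] c_node[OF j] j by simp
      then obtain u where u: "c (j - 1) < ereal u" "u < node j" using ereal_dense2 by force
      have "{u<..<node j} \<subseteq> einterval (c (j - 1)) (c j)"
      proof
        fix x assume "x \<in> {u<..<node j}"
        thus "x \<in> einterval (c (j - 1)) (c j)"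
          using less_trans[OF u(1), of "ereal x"] c_node[OF j] by (simp add: einterval_iff)
      qed
      thus thesis using that u(2) by blast
    qed
    obtain v where v: "node j < v" "{node j<..<v} \<subseteq> einterval (c j) (c (Suc j))"
    proof -
      have "ereal (node j) < c (Suc j)" using c_less[of j "Suc j"] c_node[OF j] j by simp
      then obtain v where v: "ereal v < c (Suc j)" "node j < v" using ereal_dense2 by force
      have "{node j<..<v} \<subseteq> einterval (c j) (c (Suc j))"
      proof
        fix x assume "x \<in> {node j<..<v}"
        thus "x \<in> einterval (c j) (c (Suc j))"
          using less_trans[OF _ v(1), of "ereal x"] c_node[OF j] by (simp add: einterval_iff)
      qed
      thus thesis using that v(2) by blast
    qed
    have "jump q0 (node j) = K j - K (j - 1)"
    proof (rule jump_eq[OF _ u(1) v(1)])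
      show "isCont G (node j)" using G(2) by (simp add: continuous_on_eq_continuous_at)
      show "AE x in lborel. x \<in> {u<..<node j} \<longrightarrow> q0 x = K (j - 1) + G x"
      proof -
        have "AE x in lborel. x \<in> einterval (c (j - 1)) (c j) \<longrightarrow> q0 x = K (j - 1) + G x"
          using K[of "j - 1"] j by simp
        thus ?thesis by eventually_elim (use u(2) in blast)
      qed
      show "AE x in lborel. x \<in> {node j<..<v} \<longrightarrow> q0 x = K j + G x"
        using K[OF j(2)] by eventually_elim (use v(2) in blast)
    qed
    thus ?thesis by (simp add: J_def)
  qed
  ultimately show thesis using that[OF g G] by blast
qed

end

section \<open>The Fourier transform of the datum and its integrable remainder\<close>

text \<open>Otherwise \<open>(cmod (Q x))\<^sup>2 + (cmod (Q (- x)))\<^sup>2\<close> would be at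
  least \<open>e\<^sup>2 / 2\<close> on a half-line, which has infinite measure. It yields
  truncation points at which both boundary terms of the integration by parts are small.\<close>

lemma square_integrable_small_pair:
  fixes Q :: "real \<Rightarrow> complex"
  assumes Q: "square_integrable_on Q UNIV" and e: "0 < e"
  shows "\<exists>R\<ge>M. cmod (Q R) + cmod (Q (- R)) < e"
proof (rule ccontr)
  assume "\<not> ?thesis"
  hence ge: "e \<le> cmod (Q R) + cmod (Q (- R))" if "M \<le> R" for R using that by (auto simp: not_less)
  note [measurable] = square_integrable_UNIV_D(1)[OF Q]
  have i: "integrable lborel (\<lambda>x. (cmod (Q x))\<^sup>2)" by (rule square_integrable_UNIV_D(3)[OF Q])
  have "integrable lborel (\<lambda>x. (cmod (Q (0 + -1 * x)))\<^sup>2)"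
    by (subst lborel_integrable_real_affine_iff) (use i in auto)
  hence p: "integrable lborel (\<lambda>x. (cmod (Q x))\<^sup>2 + (cmod (Q (- x)))\<^sup>2)" using i by simp
  have "(\<integral>\<^sup>+x. ennreal (e\<^sup>2 / 2) * indicator {M..} x \<partial>lborel) \<le>
      (\<integral>\<^sup>+x. ennreal ((cmod (Q x))\<^sup>2 + (cmod (Q (- x)))\<^sup>2) \<partial>lborel)"
  proof (rule nn_integral_mono)
    fix x
    have "e\<^sup>2 / 2 \<le> (cmod (Q x))\<^sup>2 + (cmod (Q (- x)))\<^sup>2" if "M \<le> x"
    proof -
      have "e\<^sup>2 \<le> (cmod (Q x) + cmod (Q (- x)))\<^sup>2" using ge[OF that] e by (intro power_mono) auto
      also have "\<dots> \<le> 2 * ((cmod (Q x))\<^sup>2 + (cmod (Q (- x)))\<^sup>2)"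
        using sum_squares_bound[of "cmod (Q x)" "cmod (Q (- x))"] by (simp add: power2_sum)
      finally show ?thesis by simp
    qed
    thus "ennreal (e\<^sup>2 / 2) * indicator {M..} x \<le> ennreal ((cmod (Q x))\<^sup>2 + (cmod (Q (- x)))\<^sup>2)"
      by (cases "M \<le> x") (simp_all add: ennreal_leI del: ennreal_plus)
  qed
  also have "\<dots> < \<infinity>" using p by (simp add: integrable_iff_bounded)
  also have "(\<integral>\<^sup>+x. ennreal (e\<^sup>2 / 2) * indicator {M..} x \<partial>lborel) = ennreal (e\<^sup>2 / 2) * emeasure lborel {M..}"
    by (subst nn_integral_cmult_indicator) auto
  also have "emeasure lborel {M..} = \<infinity>"
  proof -
    have "ennreal (real m) \<le> emeasure lborel {M..}" for m
      using emeasure_mono[of "{M..M + real m}" "{M..}" lborel] by auto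
    thus ?thesis by (metis ennreal_Ex_less_of_nat infinity_ennreal_def leD top.not_eq_extremum ennreal_of_nat_eq_real_of_nat)
  qed
  finally show False using e by (simp add: ennreal_mult_eq_top_iff)
qed

context piecewise_H1
begin

lemma trunc_fourier_identity:
  assumes g: "square_integrable_on g UNIV"
    and G: "\<And>x y. x \<le> y \<Longrightarrow> G y - G x = (LINT z:{x..y}|lborel. g z)" and Gc: "continuous_on UNIV G"
    and rep: "AE x in lborel. q0 x = K + G x + (\<Sum>j=1..N. if node j < x then J j else 0)"
    and R: "0 < R" "\<And>j. 1 \<le> j \<Longrightarrow> j \<le> N \<Longrightarrow> \<bar>node j\<bar> < R"
  defines "Q \<equiv> \<lambda>x. K + G x + (\<Sum>j=1..N. if node j < x then J j else 0)"
  shows "\<i> * of_real k * trunc_fourier (- 1) q0 R k =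
    (\<Sum>j=1..N. J j * exp (- (\<i> * of_real (k * node j)))) + trunc_fourier (- 1) g R k
    - exp (- (\<i> * of_real (k * R))) * Q R + exp (\<i> * of_real (k * R)) * Q (- R)"
proof -
  \<comment> \<open>\<open>\<phi>\<close> is a primitive of
    \<open>\<i> * k * exp (- \<i> * k * x)\<close>. Multiplying by \<open>k\<close> instead of
    dividing keeps the identity valid at \<open>k = 0\<close>.\<close>
  define \<phi> where "\<phi> = (\<lambda>x. - exp (- (\<i> * of_real (k * x))))"
  define \<phi>' where "\<phi>' = (\<lambda>x. \<i> * of_real k * exp (- (\<i> * of_real (k * x))))"
  have d: "(\<phi> has_vector_derivative \<phi>' x) (at x)" for x
  proof -
    have "((\<lambda>z. - exp (- (\<i> * (of_real k * z)))) has_field_derivative \<i> * of_real k * exp (- (\<i> * (of_real k * of_real x)))) (at (of_real x))"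
      by (auto intro!: derivative_eq_intros)
    from has_vector_derivative_real_field[OF this] show ?thesis by (simp add: \<phi>_def \<phi>'_def)
  qed
  have c: "continuous_on UNIV \<phi>'" unfolding \<phi>'_def by (intro continuous_intros)
  have i1: "set_integrable lborel {a..b} \<phi>'" for a b
    by (rule borel_integrable_atLeastAtMost'[OF continuous_on_subset[OF c]]) auto
  have FTC: "(LINT x:{a..b}|lborel. \<phi>' x) = \<phi> b - \<phi> a" if "a \<le> b" for a b
    by (rule set_lebesgue_integral_continuous_FTC[OF that d c])
  have gi: "set_integrable lborel {a..b} g" for a b by (rule square_integrable_locally[OF g])
  have "trunc_fourier (- 1) q0 R k = (LINT x:{-R..R}|lborel. exp (- (\<i> * of_real (k * x))) * Q x)"
    unfolding trunc_fourier_def set_lebesgue_integral_def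
  proof (rule integral_cong_AE)
    have [measurable]: "q0 \<in> borel_measurable borel" by (rule square_integrable_UNIV_D(1)[OF q0])
    have [measurable]: "G \<in> borel_measurable borel" by (rule borel_measurable_continuous_onI[OF Gc])
    show "(\<lambda>x. indicator {- R..R} x *\<^sub>R (exp (\<i> * of_real (k * (- 1 * x))) * q0 x)) \<in> borel_measurable lborel" by measurable
    show "(\<lambda>x. indicator {- R..R} x *\<^sub>R (exp (- (\<i> * of_real (k * x))) * Q x)) \<in> borel_measurable lborel"
      unfolding Q_def by measurable
    show "AE x in lborel. indicator {- R..R} x *\<^sub>R (exp (\<i> * of_real (k * (- 1 * x))) * q0 x) =
        indicator {- R..R} x *\<^sub>R (exp (- (\<i> * of_real (k * x))) * Q x)"
      using rep by eventually_elim (simp add: Q_def)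
  qed
  hence "\<i> * of_real k * trunc_fourier (- 1) q0 R k = (LINT x:{-R..R}|lborel. \<phi>' x * Q x)"
    unfolding set_integral_mult_right[symmetric] by (simp add: \<phi>'_def mult.assoc)
  also have "\<dots> = (LINT x:{-R..R}|lborel. (\<phi>' x * (G x - G (- R)) + (K + G (- R)) * \<phi>' x) +
      (\<Sum>j=1..N. J j * (indicator {node j<..R} x *\<^sub>R \<phi>' x)))"
  proof (rule set_lebesgue_integral_cong, simp, intro allI impI)
    fix x assume x: "x \<in> {-R..R}"
    have "\<phi>' x * (\<Sum>j=1..N. if node j < x then J j else 0) = (\<Sum>j=1..N. J j * (indicator {node j<..R} x *\<^sub>R \<phi>' x))"
      unfolding sum_distrib_left using x by (intro sum.cong) (auto simp: indicator_def)
    thus "\<phi>' x * Q x = (\<phi>' x * (G x - G (- R)) + (K + G (- R)) * \<phi>' x) +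
      (\<Sum>j=1..N. J j * (indicator {node j<..R} x *\<^sub>R \<phi>' x))"
      by (simp add: Q_def distrib_left algebra_simps)
  qed
  also have "\<dots> = (LINT x:{-R..R}|lborel. \<phi>' x * (G x - G (- R))) + (LINT x:{-R..R}|lborel. (K + G (- R)) * \<phi>' x) +
      (\<Sum>j=1..N. LINT x:{-R..R}|lborel. J j * (indicator {node j<..R} x *\<^sub>R \<phi>' x))"
  proof -
    have a: "set_integrable lborel {-R..R} (\<lambda>x. \<phi>' x * (G x - G (- R)))"
      by (rule borel_integrable_atLeastAtMost') (intro continuous_intros continuous_on_subset[OF c] continuous_on_subset[OF Gc]; simp)
    have b: "set_integrable lborel {-R..R} (\<lambda>x. (K + G (- R)) * \<phi>' x)" by (intro set_integrable_mult_right i1)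
    have cj: "set_integrable lborel {-R..R} (\<lambda>x. J j * (indicator {node j<..R} x *\<^sub>R \<phi>' x))" for j
    proof (intro set_integrable_mult_right)
      have "integrable lborel (\<lambda>x. indicator {node j<..R} x *\<^sub>R (indicator {-R..R} x *\<^sub>R \<phi>' x))"
        by (intro integrable_mult_indicator[OF _ i1[unfolded set_integrable_def]]) simp
      thus "set_integrable lborel {-R..R} (\<lambda>x. indicator {node j<..R} x *\<^sub>R \<phi>' x)"
        by (simp add: set_integrable_def mult.commute)
    qed
    have cs: "set_integrable lborel {-R..R} (\<lambda>x. \<Sum>j=1..N. J j * (indicator {node j<..R} x *\<^sub>R \<phi>' x))"
      using cj unfolding set_integrable_def scaleR_sum_right by (intro Bochner_Integration.integrable_sum) auto
    have "(LINT x:{-R..R}|lborel. \<Sum>j=1..N. J j * (indicator {node j<..R} x *\<^sub>R \<phi>' x)) =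
      (\<Sum>j=1..N. LINT x:{-R..R}|lborel. J j * (indicator {node j<..R} x *\<^sub>R \<phi>' x))"
      using cj unfolding set_integrable_def set_lebesgue_integral_def scaleR_sum_right
      by (intro Bochner_Integration.integral_sum) auto
    thus ?thesis by (simp only: set_integral_add(2)[OF set_integral_add(1)[OF a b] cs] set_integral_add(2)[OF a b])
  qed
  also have "(LINT x:{-R..R}|lborel. \<phi>' x * (G x - G (- R))) = (LINT x:{-R..R}|lborel. \<phi>' x * (LINT y:{-R..x}|lborel. g y))"
    by (rule set_lebesgue_integral_cong) (use G in auto)
  also have "\<dots> = (LINT y:{-R..R}|lborel. g y * (\<phi> R - \<phi> y))"
    by (rule primitive_times_derivative[OF gi d c])
  also have "\<dots> = (LINT y:{-R..R}|lborel. \<phi> R * g y - g y * \<phi> y)" by (simp add: algebra_simps)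
  also have "\<dots> = \<phi> R * (G R - G (- R)) + trunc_fourier (- 1) g R k"
  proof -
    have "continuous_on UNIV \<phi>" unfolding \<phi>_def by (intro continuous_intros)
    hence "(LINT y:{-R..R}|lborel. \<phi> R * g y - g y * \<phi> y) = (LINT y:{-R..R}|lborel. \<phi> R * g y) - (LINT y:{-R..R}|lborel. g y * \<phi> y)"
      by (intro set_integral_diff(2) set_integrable_mult_right set_integrable_times_continuous gi)
    also have "(LINT y:{-R..R}|lborel. g y * \<phi> y) = - trunc_fourier (- 1) g R k"
      by (simp add: trunc_fourier_def \<phi>_def set_lebesgue_integral_def mult.commute)
    finally show ?thesis using G[of "-R" R] R by simp
  qed
  also have "(LINT x:{-R..R}|lborel. (K + G (- R)) * \<phi>' x) = (K + G (- R)) * (\<phi> R - \<phi> (- R))"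
    using FTC[of "-R" R] R by simp
  also have "(\<Sum>j=1..N. LINT x:{-R..R}|lborel. J j * (indicator {node j<..R} x *\<^sub>R \<phi>' x)) = (\<Sum>j=1..N. J j * (\<phi> R - \<phi> (node j)))"
  proof (rule sum.cong[OF refl])
    fix j assume j: "j \<in> {1..N}"
    hence nj: "\<bar>node j\<bar> < R" using R by simp
    have "(LINT x:{-R..R}|lborel. indicator {node j<..R} x *\<^sub>R \<phi>' x) = (LINT x:{node j..R}|lborel. \<phi>' x)"
      unfolding set_lebesgue_integral_def
      by (rule integral_discrete_difference[of "{node j}"]) (use nj in \<open>auto simp: indicator_def\<close>)
    also have "\<dots> = \<phi> R - \<phi> (node j)" using nj by (intro FTC) auto
    finally show "(LINT x:{-R..R}|lborel. J j * (indicator {node j<..R} x *\<^sub>R \<phi>' x)) = J j * (\<phi> R - \<phi> (node j))"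
      by (simp only: set_integral_mult_right)
  qed
  also have "\<dots> = \<phi> R * (\<Sum>j=1..N. J j) + (\<Sum>j=1..N. J j * exp (- (\<i> * of_real (k * node j))))"
  proof -
    have "(\<Sum>j=1..N. J j * (\<phi> R - \<phi> (node j))) = \<phi> R * (\<Sum>j=1..N. J j) - (\<Sum>j=1..N. J j * \<phi> (node j))"
      by (simp only: right_diff_distrib sum_subtractf sum_distrib_right mult.commute[of "\<phi> R"])
    thus ?thesis by (simp add: \<phi>_def sum_negf)
  qed
  finally have "\<i> * of_real k * trunc_fourier (- 1) q0 R k = \<phi> R * (G R - G (- R)) + trunc_fourier (- 1) g R k +
     (K + G (- R)) * (\<phi> R - \<phi> (- R)) + (\<phi> R * (\<Sum>j=1..N. J j) + (\<Sum>j=1..N. J j * exp (- (\<i> * of_real (k * node j)))))" .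
  moreover have "Q R = K + G R + (\<Sum>j=1..N. J j)"
    unfolding Q_def using R by (intro arg_cong2[of _ _ _ _ "(+)"] refl sum.cong) (auto simp: abs_less_iff)
  moreover have "Q (- R) = K + G (- R)"
  proof -
    have "(\<Sum>j=1..N. if node j < - R then J j else 0) = 0" 
    proof (intro sum.neutral ballI)
      fix j assume "j \<in> {1..N}"
      hence "\<bar>node j\<bar> < R" using R by simp
      hence "\<not> node j < - R" by linarith
      thus "(if node j < - R then J j else 0) = 0" by simp
    qed
    thus ?thesis by (simp add: Q_def)
  qed
  moreover have "\<phi> R = - exp (- (\<i> * of_real (k * R)))" "\<phi> (- R) = - exp (\<i> * of_real (k * R))" by (simp_all add: \<phi>_def)
  \<comment> \<open>All terms with \<open>\<phi> R\<close> collect to \<open>\<phi> R * Q R\<close>,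
    those with \<open>\<phi> (- R)\<close> to \<open>- \<phi> (- R) * Q (- R)\<close>.\<close>
  ultimately show ?thesis by (simp only:) (simp add: algebra_simps)
qed

end

context piecewise_H1
begin

text \<open>The truncated identity is passed to the limit in L2. Multiplication by \<open>k\<close>
  is unbounded on L2, so the defect \<open>D\<close> is shown to vanish on each window
  \<open>\<bar>k\<bar> \<le> M\<close>, and countably many windows cover the line.\<close>

lemma fourier_identity:
  obtains g J where "square_integrable_on g UNIV" "\<And>j. 1 \<le> j \<Longrightarrow> j \<le> N \<Longrightarrow> J j = jump q0 (node j)"
    "AE k in lborel. \<i> * of_real k * fourier_L2 q0 k =
       (\<Sum>j=1..N. J j * exp (- (\<i> * of_real (k * node j)))) + fourier_L2 g k"
proof (rule representation)
  fix g G J K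
  assume g: "square_integrable_on g UNIV"
    and G: "\<And>x y. x \<le> y \<Longrightarrow> G y - G x = (LINT z:{x..y}|lborel. g z)" "continuous_on UNIV G"
    and rep: "AE x in lborel. q0 x = K + G x + (\<Sum>j=1..N. if node j < x then J j else 0)"
    and J: "\<And>j. 1 \<le> j \<Longrightarrow> j \<le> N \<Longrightarrow> J j = jump q0 (node j)"
  define Q where "Q = (\<lambda>x. K + G x + (\<Sum>j=1..N. if node j < x then J j else 0))"
  have [measurable]: "G \<in> borel_measurable borel" by (rule borel_measurable_continuous_onI[OF G(2)])
  have Qm: "Q \<in> borel_measurable borel" unfolding Q_def by measurable
  have "l2sq Q = l2sq q0" using rep by (intro l2sq_cong_AE) (auto simp: Q_def)
  hence Q2: "square_integrable_on Q UNIV"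
    using Qm square_integrable_UNIV_D(2)[OF q0] by (simp add: square_integrable_UNIV_iff)
  define B where "B = (\<Sum>j=1..N. \<bar>node j\<bar>) + 1"
  have B: "\<bar>node j\<bar> < B" if "1 \<le> j" "j \<le> N" for j
    using member_le_sum[of j "{1..N}" "\<lambda>j. \<bar>node j\<bar>"] that by (simp add: B_def)
  \<comment> \<open>\<open>B\<close> exceeds every node in absolute value, so the truncated identity
    holds at each \<open>R m\<close>, while its boundary terms tend to 0 along the sequence.\<close>
  have "\<forall>m. \<exists>R. real m + B \<le> R \<and> cmod (Q R) + cmod (Q (- R)) < 1 / real (Suc m)"
    using square_integrable_small_pair[OF Q2] by (metis of_nat_0_less_iff zero_less_Suc zero_less_divide_1_iff)
  then obtain R where R: "\<And>m. real m + B \<le> R m" "\<And>m. cmod (Q (R m)) + cmod (Q (- R m)) < 1 / real (Suc m)"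
    by metis
  have B0: "1 \<le> B" unfolding B_def by (simp add: sum_nonneg)
  have Rtop: "filterlim R at_top sequentially"
  proof (rule filterlim_at_top_mono[OF filterlim_real_sequentially])
    show "\<forall>\<^sub>F m in sequentially. real m \<le> R m"
    proof (rule always_eventually, rule allI)
      fix m show "real m \<le> R m" using R(1)[of m] B0 by linarith
    qed
  qed
  define F where "F = fourier_L2 q0"
  define H where "H = fourier_L2 g"
  note F = fourier_L2[OF q0, folded F_def] and H = fourier_L2[OF g, folded H_def]
  have [measurable]: "F \<in> borel_measurable borel" "H \<in> borel_measurable borel"
    "q0 \<in> borel_measurable borel" "g \<in> borel_measurable borel"
    using F(1) H(1) q0 g by (auto dest: square_integrable_UNIV_D(1))
  define E where "E = (\<lambda>k. \<Sum>j=1..N. J j * exp (- (\<i> * of_real (k * node j))))"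
  have [measurable]: "E \<in> borel_measurable borel" unfolding E_def by measurable
  define D where "D = (\<lambda>k. \<i> * of_real k * F k - E k - H k)"
  have [measurable]: "D \<in> borel_measurable borel" unfolding D_def by measurable
  have zero: "AE k in lborel. indicator {- real M..real M} k *\<^sub>R D k = 0" for M :: nat
  proof (rule l2sq_eq_0)
    define I where "I = {- real M..real M}"
    \<comment> \<open>The factor 3 comes from squaring a sum of three terms,
      \<open>(real M)\<^sup>2\<close> from the multiplier \<open>k\<close> on the window, and
      \<open>2 * real M\<close> is the length of the window over which the boundary error is
      integrated.\<close>
    define T where "T = (\<lambda>m. ennreal (3 * (real M)\<^sup>2) * l2sq (\<lambda>k. trunc_fourier (- 1) q0 (R m) k - F k) +
      3 * l2sq (\<lambda>k. trunc_fourier (- 1) g (R m) k - H k) + ennreal (3 * (1 / real (Suc m))\<^sup>2 * (2 * real M)))"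
    have le: "l2sq (\<lambda>k. indicator I k *\<^sub>R D k) \<le> T m" for m
    proof -
      define a where "a = (\<lambda>k. trunc_fourier (- 1) q0 (R m) k - F k)"
      define b where "b = (\<lambda>k. trunc_fourier (- 1) g (R m) k - H k)"
      define \<epsilon> where "\<epsilon> = 1 / real (Suc m)"
      have [measurable]: "a \<in> borel_measurable borel" "b \<in> borel_measurable borel" unfolding a_def b_def by measurable
      have D: "cmod (D k) \<le> \<bar>k\<bar> * cmod (a k) + cmod (b k) + \<epsilon>" for k
      proof -
        have "\<i> * of_real k * trunc_fourier (- 1) q0 (R m) k = E k + trunc_fourier (- 1) g (R m) k
           - exp (- (\<i> * of_real (k * R m))) * Q (R m) + exp (\<i> * of_real (k * R m)) * Q (- R m)"
          unfolding E_def Q_def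
        proof (rule trunc_fourier_identity[OF g G rep])
          show "0 < R m" using R(1)[of m] B0 by linarith
          show "\<bar>node j\<bar> < R m" if "1 \<le> j" "j \<le> N" for j using B[OF that] R(1)[of m] by linarith
        qed
        hence "D k = b k - \<i> * of_real k * a k +
           (exp (\<i> * of_real (k * R m)) * Q (- R m) - exp (- (\<i> * of_real (k * R m))) * Q (R m))"
          by (simp add: D_def a_def b_def algebra_simps)
        also have "cmod \<dots> \<le> (cmod (b k) + \<bar>k\<bar> * cmod (a k)) + (cmod (Q (- R m)) + cmod (Q (R m)))"
        proof (rule norm_triangle_le[OF add_mono])
          show "cmod (b k - \<i> * of_real k * a k) \<le> cmod (b k) + \<bar>k\<bar> * cmod (a k)"
            by (rule order_trans[OF norm_triangle_ineq4]) (simp add: norm_mult)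
          show "cmod (exp (\<i> * of_real (k * R m)) * Q (- R m) - exp (- (\<i> * of_real (k * R m))) * Q (R m))
             \<le> cmod (Q (- R m)) + cmod (Q (R m))"
            by (rule order_trans[OF norm_triangle_ineq4]) (simp add: norm_mult)
        qed
        also have "\<dots> \<le> \<bar>k\<bar> * cmod (a k) + cmod (b k) + \<epsilon>" using R(2)[of m] by (simp add: \<epsilon>_def)
        finally show ?thesis .
      qed
      have "l2sq (\<lambda>k. indicator I k *\<^sub>R D k) \<le> (\<integral>\<^sup>+k. ennreal (3 * (real M)\<^sup>2) * ennreal ((cmod (a k))\<^sup>2) +
          3 * ennreal ((cmod (b k))\<^sup>2) + ennreal (3 * \<epsilon>\<^sup>2) * indicator I k \<partial>lborel)"
        unfolding l2sq_def
      proof (rule nn_integral_mono)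
        fix k
        have sq: "(x + y + z)\<^sup>2 \<le> 3 * x\<^sup>2 + 3 * y\<^sup>2 + 3 * z\<^sup>2" for x y z :: real
          using sum_squares_bound[of x y] sum_squares_bound[of y z] sum_squares_bound[of x z]
          by (simp add: power2_eq_square algebra_simps)
        show "ennreal ((cmod (indicator I k *\<^sub>R D k))\<^sup>2) \<le> ennreal (3 * (real M)\<^sup>2) * ennreal ((cmod (a k))\<^sup>2) +
          3 * ennreal ((cmod (b k))\<^sup>2) + ennreal (3 * \<epsilon>\<^sup>2) * indicator I k"
        proof (cases "k \<in> I")
          case True
          have "(cmod (D k))\<^sup>2 \<le> (\<bar>k\<bar> * cmod (a k) + cmod (b k) + \<epsilon>)\<^sup>2"
            by (intro power_mono D) auto
          also have "\<dots> \<le> 3 * (\<bar>k\<bar> * cmod (a k))\<^sup>2 + 3 * (cmod (b k))\<^sup>2 + 3 * \<epsilon>\<^sup>2" by (rule sq)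
          also have "3 * (\<bar>k\<bar> * cmod (a k))\<^sup>2 \<le> 3 * (real M)\<^sup>2 * (cmod (a k))\<^sup>2"
          proof -
            have "\<bar>k\<bar>\<^sup>2 \<le> (real M)\<^sup>2" using True by (intro power_mono) (auto simp: I_def)
            thus ?thesis unfolding power_mult_distrib mult.assoc by (intro mult_left_mono mult_right_mono) auto
          qed
          finally have "ennreal ((cmod (D k))\<^sup>2) \<le> ennreal (3 * (real M)\<^sup>2 * (cmod (a k))\<^sup>2 + 3 * (cmod (b k))\<^sup>2 + 3 * \<epsilon>\<^sup>2)"
            by (intro ennreal_leI) simp
          also have "\<dots> = ennreal (3 * (real M)\<^sup>2) * ennreal ((cmod (a k))\<^sup>2) + 3 * ennreal ((cmod (b k))\<^sup>2) + ennreal (3 * \<epsilon>\<^sup>2)"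
            by (simp add: ennreal_mult)
          finally show ?thesis using True by simp
        qed simp
      qed
      also have "\<dots> = ennreal (3 * (real M)\<^sup>2) * l2sq a + 3 * l2sq b + ennreal (3 * \<epsilon>\<^sup>2) * emeasure lborel I"
        by (subst nn_integral_add, simp, simp add: I_def, subst nn_integral_add, simp, simp,
            simp add: nn_integral_cmult l2sq_def I_def nn_integral_cmult_indicator)
      also have "emeasure lborel I = ennreal (2 * real M)" by (simp add: I_def)
      also have "ennreal (3 * \<epsilon>\<^sup>2) * ennreal (2 * real M) = ennreal (3 * \<epsilon>\<^sup>2 * (2 * real M))"
        by (rule ennreal_mult[symmetric]) auto
      also have "ennreal (3 * (real M)\<^sup>2) * l2sq a + 3 * l2sq b + \<dots> = T m"
        unfolding T_def a_def b_def \<epsilon>_def ..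
      finally show ?thesis .
    qed
    have "T \<longlonglongrightarrow> ennreal (3 * (real M)\<^sup>2) * 0 + 3 * 0 + ennreal (3 * 0\<^sup>2 * (2 * real M))"
      unfolding T_def
    proof (intro tendsto_add ennreal_tendsto_cmult tendsto_ennrealI)
      show "(\<lambda>m. l2sq (\<lambda>k. trunc_fourier (- 1) q0 (R m) k - F k)) \<longlonglongrightarrow> 0"
        using filterlim_compose[OF F(2)[unfolded L2_tendsto_def l2sq_def[symmetric]] Rtop] .
      show "(\<lambda>m. l2sq (\<lambda>k. trunc_fourier (- 1) g (R m) k - H k)) \<longlonglongrightarrow> 0"
        using filterlim_compose[OF H(2)[unfolded L2_tendsto_def l2sq_def[symmetric]] Rtop] .
      have "(\<lambda>m. 1 / real (Suc m)) \<longlonglongrightarrow> 0" by real_asymp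
      thus "(\<lambda>m. 3 * (1 / real (Suc m))\<^sup>2 * (2 * real M)) \<longlonglongrightarrow> 3 * 0\<^sup>2 * (2 * real M)"
        by (intro tendsto_intros)
    qed auto
    hence "T \<longlonglongrightarrow> 0" by simp
    hence "l2sq (\<lambda>k. indicator I k *\<^sub>R D k) \<le> 0" using le by (intro LIMSEQ_le_const) auto
    thus "l2sq (\<lambda>k. indicator {- real M..real M} k *\<^sub>R D k) = 0" by (simp add: I_def)
  qed measurable
  hence "AE k in lborel. \<forall>M::nat. indicator {- real M..real M} k *\<^sub>R D k = 0" by (subst AE_all_countable) blast
  hence "AE k in lborel. \<i> * of_real k * F k = E k + H k"
  proof eventually_elim
    case (elim k)
    obtain M :: nat where "\<bar>k\<bar> \<le> real M" using real_arch_simple by blast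
    hence "k \<in> {- real M..real M}" by auto
    hence "D k = 0" using elim[rule_format, of M] by simp
    thus ?case by (simp add: D_def algebra_simps)
  qed
  thus thesis using that[OF g J] by (simp add: F_def E_def H_def)
qed

text \<open>For \<open>\<bar>k\<bar> > 1\<close> the remainder is the transform of \<open>g\<close>
  divided by \<open>\<i> * k\<close>, a product of two square integrable functions; for
  \<open>\<bar>k\<bar> \<le> 1\<close> it is the square integrable transform itself on a bounded
  set. The cut at 1 keeps the jump terms away from the pole.\<close>

lemma fourier_remainder_integrable:
  obtains H where "integrable lborel H"
    "AE k in lborel. fourier_L2 q0 k = H k +
       (if 1 < \<bar>k\<bar> then \<Sum>j=1..N. jump q0 (node j) * exp (- (\<i> * of_real (k * node j))) / (\<i> * of_real k) else 0)"
proof (rule fourier_identity)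
  fix g J
  assume g: "square_integrable_on g UNIV"
    and J: "\<And>j. 1 \<le> j \<Longrightarrow> j \<le> N \<Longrightarrow> J j = jump q0 (node j)"
    and id: "AE k in lborel. \<i> * of_real k * fourier_L2 q0 k =
       (\<Sum>j=1..N. J j * exp (- (\<i> * of_real (k * node j)))) + fourier_L2 g k"
  define P where "P = (\<lambda>k. if 1 < \<bar>k\<bar> then \<Sum>j=1..N. jump q0 (node j) * exp (- (\<i> * of_real (k * node j))) / (\<i> * of_real k) else 0)"
  have [measurable]: "P \<in> borel_measurable borel" unfolding P_def by measurable
  note F = fourier_L2[OF q0] and G = fourier_L2[OF g]
  note [measurable] = square_integrable_UNIV_D(1)[OF F(1)] square_integrable_UNIV_D(1)[OF G(1)]
  define H where "H = (\<lambda>k. fourier_L2 q0 k - P k)"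
  \<comment> \<open>\<open>2 * inverse (1 + k\<^sup>2)\<close> dominates both 1 on
    \<open>\<bar>k\<bar> \<le> 1\<close> and \<open>1 / k\<^sup>2\<close> on
    \<open>\<bar>k\<bar> > 1\<close>.\<close>
  have Hle: "AE k in lborel. cmod (H k) \<le> 2 * (inverse (1 + k\<^sup>2)) + (cmod (fourier_L2 q0 k))\<^sup>2 + (cmod (fourier_L2 g k))\<^sup>2"
    using id
  proof eventually_elim
    case (elim k)
    have ab: "x * y \<le> x\<^sup>2 + y\<^sup>2" for x y :: real
      using sum_squares_bound[of x y] zero_le_power2[of x] zero_le_power2[of y] by linarith
    show ?case
    proof (cases "1 < \<bar>k\<bar>")
      case True
      hence k0: "k \<noteq> 0" by auto
      have "P k = (\<Sum>j=1..N. J j * exp (- (\<i> * of_real (k * node j)))) / (\<i> * of_real k)"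
        using True J by (simp add: P_def sum_divide_distrib)
      hence "H k = fourier_L2 g k / (\<i> * of_real k)"
        using elim k0 by (simp add: H_def field_simps)
      hence "cmod (H k) = cmod (fourier_L2 g k) * (1 / \<bar>k\<bar>)" by (simp add: norm_divide norm_mult)
      also have "\<dots> \<le> (cmod (fourier_L2 g k))\<^sup>2 + (1 / \<bar>k\<bar>)\<^sup>2" by (rule ab)
      also have "(1 / \<bar>k\<bar>)\<^sup>2 \<le> 2 * inverse (1 + k\<^sup>2)"
      proof -
        have "1 \<le> k\<^sup>2" using True power_mono[of 1 "\<bar>k\<bar>" 2] by simp
        moreover have "0 < 1 + k\<^sup>2" by (simp add: add_pos_nonneg)
        ultimately show ?thesis using k0 by (simp add: power_divide field_simps)
      qed
      finally show ?thesis using zero_le_power2[of "cmod (fourier_L2 q0 k)"] by linarith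
    next
      case False
      hence "cmod (H k) = 1 * cmod (fourier_L2 q0 k)" by (simp add: H_def P_def)
      also have "\<dots> \<le> 1\<^sup>2 + (cmod (fourier_L2 q0 k))\<^sup>2" by (rule ab)
      also have "1\<^sup>2 \<le> 2 * inverse (1 + k\<^sup>2)"
      proof -
        have "k\<^sup>2 \<le> 1" using False power_mono[of "\<bar>k\<bar>" 1 2] by simp
        moreover have "0 < 1 + k\<^sup>2" by (simp add: add_pos_nonneg)
        ultimately show ?thesis by (simp add: field_simps)
      qed
      finally show ?thesis using zero_le_power2[of "cmod (fourier_L2 g k)"] by linarith
    qed
  qed
  have "integrable lborel (\<lambda>k. inverse (1 + k\<^sup>2) :: real)"
    using integrable_inverse_1_plus_square by (simp add: set_integrable_def)
  hence "integrable lborel (\<lambda>k. 2 * (inverse (1 + k\<^sup>2)) + (cmod (fourier_L2 q0 k))\<^sup>2 + (cmod (fourier_L2 g k))\<^sup>2)"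
    using square_integrable_UNIV_D(3)[OF F(1)] square_integrable_UNIV_D(3)[OF G(1)] by simp
  hence "integrable lborel H"
  proof (rule Bochner_Integration.integrable_bound)
    show "H \<in> borel_measurable lborel" unfolding H_def by measurable
    show "AE k in lborel. cmod (H k) \<le> norm (2 * (inverse (1 + k\<^sup>2)) + (cmod (fourier_L2 q0 k))\<^sup>2 + (cmod (fourier_L2 g k))\<^sup>2)"
      using Hle by eventually_elim (simp add: abs_of_nonneg add_nonneg_nonneg)
  qed
  thus thesis by (rule that) (simp add: H_def P_def)
qed

end

section \<open>Short-time limits of the terms at the other nodes and of the integrable part\<close>

lemma phase_slope_scaled:
  assumes "0 < s"
  shows "phase_slope n b (K / s) = s * phase_slope n (\<lambda>j. b j / s ^ j) K"
  unfolding phase_slope_def sum_distrib_left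
proof (rule sum.cong[OF refl])
  fix j assume "j \<in> {2..n}"
  hence "s ^ j = s ^ (j - 1) * s" using power_minus_mult[of j s] by simp
  thus "\<bar>b j\<bar> * (K / s) ^ (j - 1) = s * (\<bar>b j / s ^ j\<bar> * K ^ (j - 1))"
    using assms by (simp add: power_divide abs_mult field_simps)
qed

text \<open>
  Beyond \<open>|k| = K / s\<close> both integrals are small, and below it the factor \<open>exp (- \<i> w(k) t) - 1\<close>
  varies slowly.
\<close>

lemma osc_lim_off_jump:
  fixes w :: "nat \<Rightarrow> real"
  assumes n: "2 \<le> n" and w: "w n \<noteq> 0" and d0: "d0 \<noteq> 0" and e: "0 < e"
  shows "\<forall>\<^sub>F t in at_right 0. \<forall>y. \<bar>y\<bar> \<le> X \<longrightarrow>
    norm (osc_lim n (d0 + y * root n \<bar>w n * t\<bar>) (\<lambda>j. w j * t) 1 - osc_lim n d0 (\<lambda>_. 0) 1) < e"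
proof -
  define S where "S = (\<lambda>t. root n \<bar>w n * t\<bar>)"
  have n0: "0 < n" using n by simp
  have Spos: "0 < S t" and Spow: "S t ^ n = \<bar>w n\<bar> * t" if "0 < t" for t
    using scale_pos[OF n0 w that] by (simp_all only: S_def)
  have Slim: "(S \<longlongrightarrow> 0) (at_right 0)" unfolding S_def by (rule scale_tendsto_0)
  obtain C where C0: "0 \<le> C" and C: "\<And>d b a s. 0 < s \<Longrightarrow> \<bar>b n\<bar> = s ^ n \<Longrightarrow> 0 < a \<Longrightarrow>
    (osc n d b a \<longlongrightarrow> osc_lim n d b a) at_top \<and>
    (\<forall>B\<ge>a. norm (osc_lim n d b a - osc n d b a B) \<le> C / (s * B))"
    using osc_lim_bound[OF n] by blast
  \<comment> \<open>For small \<open>t\<close> the shifted offset \<open>d0 + y * S t\<close> stays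
    at distance at least \<open>\<delta>\<close> from 0, uniformly in \<open>y\<close>.\<close>
  define \<delta> where "\<delta> = \<bar>d0\<bar> / 2"
  have \<delta>: "0 < \<delta>" using d0 by (simp add: \<delta>_def)
  obtain K where K: "1 \<le> K" "C / K < e / 4" using ex_small_quotient[of "e / 4" C] e by auto
  \<comment> \<open>Unlike the cut \<open>K / S t\<close>, this second cut is fixed: replacing the
    offset \<open>d\<close> by \<open>d0\<close> costs
    \<open>2 * \<bar>d - d0\<bar> * (M - 1)\<close>, which is small only for bounded
    \<open>M\<close>. The six errors add up to at most
    \<open>2 * (e / 4) + 4 * (e / 16) < e\<close>.\<close>
  obtain M where M: "1 \<le> M" "8 / (\<delta> * M) < e / 16"
    using ex_small_quotient[of "e / 16" "8 / \<delta>"] e by auto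
  define P where "P = (\<lambda>t. 10 / \<delta> * (S t * phase_slope n (\<lambda>j. w j * t / S t ^ j) K))"
  have Plim: "(P \<longlongrightarrow> 0) (at_right 0)"
  proof -
    define p where "p = (\<lambda>t. 10 / \<delta> * (\<Sum>j=2..n. \<bar>w j\<bar> / \<bar>w n\<bar> * S t ^ (n - j) * K ^ (j - 1) * S t))"
    have "(p \<longlongrightarrow> 10 / \<delta> * (\<Sum>j=2..n. \<bar>w j\<bar> / \<bar>w n\<bar> * 0 ^ (n - j) * K ^ (j - 1) * 0)) (at_right 0)"
      unfolding p_def by (intro tendsto_intros Slim)
    hence "(p \<longlongrightarrow> 0) (at_right 0)" by simp
    moreover have "\<forall>\<^sub>F t in at_right 0. p t = P t"
      using eventually_at_right_less[of 0]
    proof eventually_elim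
      case (elim t)
      have tm: "\<bar>w j\<bar> / \<bar>w n\<bar> * S t ^ (n - j) * K ^ (j - 1) * S t = S t * (\<bar>w j * t / S t ^ j\<bar> * K ^ (j - 1))"
        if j: "j \<in> {2..n}" for j
      proof -
        have "t / S t ^ j = S t ^ (n - j) / \<bar>w n\<bar>" using scale_quotient[OF n0 w elim] j by (simp add: S_def)
        moreover have "\<bar>w j * t / S t ^ j\<bar> = \<bar>w j\<bar> * (t / S t ^ j)"
          using elim Spos[OF elim] by (simp add: abs_mult)
        ultimately show ?thesis by simp
      qed
      have "(\<Sum>j=2..n. \<bar>w j\<bar> / \<bar>w n\<bar> * S t ^ (n - j) * K ^ (j - 1) * S t) =
          S t * (\<Sum>j=2..n. \<bar>w j * t / S t ^ j\<bar> * K ^ (j - 1))"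
        unfolding sum_distrib_left by (rule sum.cong[OF refl tm])
      thus ?case by (simp only: p_def P_def phase_slope_def)
    qed
    ultimately show ?thesis by (rule Lim_transform_eventually)
  qed
  have "((\<lambda>t. X * S t) \<longlongrightarrow> X * 0) (at_right 0)" by (intro tendsto_intros Slim)
  hence "\<forall>\<^sub>F t in at_right 0. X * S t < \<delta>" using \<delta> by (intro order_tendstoD) auto
  moreover have "((\<lambda>t. 2 * (X * S t) * (M - 1)) \<longlongrightarrow> 2 * (X * 0) * (M - 1)) (at_right 0)" by (intro tendsto_intros Slim)
  hence "\<forall>\<^sub>F t in at_right 0. 2 * (X * S t) * (M - 1) < e / 16" using e by (intro order_tendstoD) auto
  moreover have "\<forall>\<^sub>F t in at_right 0. P t < e / 4" using Plim by (rule order_tendstoD) (use e in simp)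
  moreover have "\<forall>\<^sub>F t in at_right 0. S t < 1 / M" using Slim by (rule order_tendstoD) (use M in simp)
  ultimately show ?thesis
    using eventually_at_right_less[of 0]
  proof eventually_elim
    case (elim t)
    show ?case
    proof (intro allI impI)
      fix y assume y: "\<bar>y\<bar> \<le> X"
      define d where "d = d0 + y * S t"
      define R where "R = K / S t"
      have st: "0 < S t" by (rule Spos[OF elim(5)])
      have MR: "M \<le> R"
      proof -
        have "S t * M \<le> 1" using elim(4) M by (simp add: field_simps)
        hence "S t * M \<le> K" using K by linarith
        thus ?thesis using st by (simp add: R_def field_simps)
      qed
      have R1: "1 \<le> R" using MR M by simp
      have yS: "\<bar>y * S t\<bar> \<le> X * S t" using y st by (simp add: abs_mult)
      have d\<delta>: "\<delta> \<le> \<bar>d\<bar>" "d \<noteq> 0" using yS elim(1) \<delta> unfolding d_def \<delta>_def by linarith+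
      have d0\<delta>: "\<delta> \<le> \<bar>d0\<bar>" by (simp add: \<delta>_def)
      let ?b = "\<lambda>j. w j * t" and ?z = "\<lambda>_::nat. 0::real"
      have "\<bar>?b n\<bar> = S t ^ n" using Spow[OF elim(5)] elim(5) by (simp add: abs_mult)
      hence "norm (osc_lim n d ?b 1 - osc n d ?b 1 R) \<le> C / (S t * R)"
        using C[OF st, of ?b 1 d] R1 by simp
      moreover have "S t * R = K" using st by (simp add: R_def)
      ultimately have "norm (osc_lim n d ?b 1 - osc n d ?b 1 R) \<le> C / K" by simp
      hence 1: "norm (osc_lim n d ?b 1 - osc n d ?b 1 R) < e / 4" using K(2) by (rule le_less_trans)
      have lin: "8 / (\<bar>d'\<bar> * B) < e / 16" if "\<delta> \<le> \<bar>d'\<bar>" "M \<le> B" for d' B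
      proof -
        have "\<delta> * M \<le> \<bar>d'\<bar> * B" using that \<delta> M by (intro mult_mono) auto
        moreover have "0 < \<delta> * M" using \<delta> M by simp
        ultimately have "8 / (\<bar>d'\<bar> * B) \<le> 8 / (\<delta> * M)" by (intro frac_le[OF _ order_refl]) simp_all
        thus ?thesis using M by simp
      qed
      have 2: "norm (osc_lim n d ?z 1 - osc n d ?z 1 R) < e / 16"
        using osc_lim_linear[OF d\<delta>(2), of 1 R n] lin[OF d\<delta>(1) MR] R1 by simp
      have 3: "norm (osc_lim n d ?z 1 - osc n d ?z 1 M) < e / 16"
        using osc_lim_linear[OF d\<delta>(2), of 1 M n] lin[OF d\<delta>(1), of M] M by simp
      have 4: "norm (osc_lim n d0 ?z 1 - osc n d0 ?z 1 M) < e / 16"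
        using osc_lim_linear[OF d0, of 1 M n] lin[OF d0\<delta>, of M] M by simp
      have "norm (osc n d ?z 1 M - osc n d0 ?z 1 M) \<le> 2 * \<bar>d - d0\<bar> * (M - 1)"
        by (rule osc_diff_le_d) (use M in auto)
      also have "\<dots> \<le> 2 * (X * S t) * (M - 1)"
        using yS M by (intro mult_right_mono mult_left_mono) (auto simp: d_def)
      finally have 5: "norm (osc n d ?z 1 M - osc n d0 ?z 1 M) < e / 16" using elim(2) by simp
      have "norm (osc n d ?b 1 R - osc n d ?z 1 R) \<le> 10 / \<bar>d\<bar> * phase_slope n ?b R"
        by (rule osc_linear_diff[OF d\<delta>(2) R1])
      also have "\<dots> \<le> 10 / \<delta> * phase_slope n ?b R"
        using d\<delta> \<delta> R1 by (intro mult_right_mono divide_left_mono phase_slope_nonneg mult_pos_pos) auto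
      also have "\<dots> = P t" unfolding P_def R_def by (simp only: phase_slope_scaled[OF st])
      finally have 6: "norm (osc n d ?b 1 R - osc n d ?z 1 R) < e / 4" using elim(3) by simp
      have tri: "norm (p - u) \<le> norm (p - q) + norm (q - u)" for p q u :: complex
        using norm_triangle_ineq[of "p - q" "q - u"] by simp
      have "norm (osc_lim n d ?b 1 - osc_lim n d0 ?z 1) < e"
        using 1 2 3 4 5 6 e
          tri[of "osc_lim n d ?b 1" "osc_lim n d0 ?z 1" "osc n d ?b 1 R"]
          tri[of "osc n d ?b 1 R" "osc_lim n d0 ?z 1" "osc n d ?z 1 R"]
          tri[of "osc n d ?z 1 R" "osc_lim n d0 ?z 1" "osc_lim n d ?z 1"]
          tri[of "osc_lim n d ?z 1" "osc_lim n d0 ?z 1" "osc n d ?z 1 M"]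
          tri[of "osc n d ?z 1 M" "osc_lim n d0 ?z 1" "osc n d0 ?z 1 M"]
        unfolding norm_minus_commute[of "osc n d ?z 1 R" "osc_lim n d ?z 1"]
          norm_minus_commute[of "osc n d0 ?z 1 M" "osc_lim n d0 ?z 1"]
        by linarith
      thus "norm (osc_lim n (d0 + y * root n \<bar>w n * t\<bar>) ?b 1 - osc_lim n d0 ?z 1) < e"
        by (simp add: d_def S_def)
    qed
  qed
qed

text \<open>Dominated convergence, with uniformity built in: \<open>D t k\<close> majorises the
  change of the integrand for all \<open>\<bar>y\<bar> \<le> X\<close> at once, by the smaller of
  the trivial bound 2 and the change of the phase.\<close>

lemma integrable_phase_perturbation:
  fixes H :: "real \<Rightarrow> complex"
  assumes H: "integrable lborel H" and e: "0 < e" and s: "(s \<longlongrightarrow> 0) (at_right 0)"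
    and W: "continuous_on UNIV W"
  shows "\<forall>\<^sub>F t in at_right 0. \<forall>y. \<bar>y\<bar> \<le> X \<longrightarrow>
    norm ((LINT k|lborel. cis (k * (a + y * s t) - W k * t) * H k) - (LINT k|lborel. cis (k * a) * H k)) < e"
proof -
  note [measurable] = borel_measurable_integrable[OF H] borel_measurable_continuous_onI[OF W]
  define D where "D = (\<lambda>t k. min 2 (\<bar>k\<bar> * (X * \<bar>s t\<bar>) + \<bar>W k\<bar> * \<bar>t\<bar>) * cmod (H k))"
  have [measurable]: "D t \<in> borel_measurable borel" for t unfolding D_def by measurable
  have t0: "((\<lambda>t::real. t) \<longlongrightarrow> 0) (at_right 0)" by (rule tendsto_ident_at)
  have Dlim: "((\<lambda>t. D t k) \<longlongrightarrow> 0) (at_right 0)" for k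
  proof -
    have "((\<lambda>t. D t k) \<longlongrightarrow> min 2 (\<bar>k\<bar> * (X * \<bar>0\<bar>) + \<bar>W k\<bar> * \<bar>0\<bar>) * cmod (H k)) (at_right 0)"
      unfolding D_def by (intro tendsto_intros s t0)
    thus ?thesis by simp
  qed
  \<comment> \<open>The substitution \<open>t = inverse u\<close> turns the limit into one at
    infinity. \<open>max 0\<close> covers a negative \<open>X\<close>, for which \<open>D\<close>
    may be negative.\<close>
  have "((\<lambda>u. LINT k|lborel. max 0 (D (inverse u) k)) \<longlongrightarrow> (LINT k|(lborel :: real measure). 0)) at_top"
  proof (rule integral_dominated_convergence_at_top)
    show "integrable lborel (\<lambda>k. 2 * cmod (H k))" using H by simp
    show "\<forall>\<^sub>F u in at_top. AE k in lborel. norm (max 0 (D (inverse u) k)) \<le> 2 * cmod (H k)"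
    proof (intro always_eventually allI AE_I2)
      fix u k
      have "D (inverse u) k \<le> 2 * cmod (H k)" unfolding D_def by (intro mult_right_mono) auto
      thus "norm (max 0 (D (inverse u) k)) \<le> 2 * cmod (H k)" by simp
    qed
    show "AE k in lborel. ((\<lambda>u. max 0 (D (inverse u) k)) \<longlongrightarrow> 0) at_top"
    proof (rule AE_I2)
      fix k
      have "((\<lambda>u. D (inverse u) k) \<longlongrightarrow> 0) at_top"
        using Dlim[of k] unfolding filterlim_at_right_to_top .
      from tendsto_max[OF tendsto_const[of 0] this] show "((\<lambda>u. max 0 (D (inverse u) k)) \<longlongrightarrow> 0) at_top" by simp
    qed
  qed measurable
  hence "((\<lambda>t. LINT k|lborel. max 0 (D t k)) \<longlongrightarrow> 0) (at_right 0)"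
    unfolding filterlim_at_right_to_top by simp
  hence "\<forall>\<^sub>F t in at_right 0. (LINT k|lborel. max 0 (D t k)) < e" using e by (rule order_tendstoD)
  thus ?thesis
  proof eventually_elim
    case (elim t)
    show ?case
    proof (intro allI impI)
      fix y assume y: "\<bar>y\<bar> \<le> X"
      have ci: "integrable lborel (\<lambda>k. cis (f k) * H k)" if [measurable]: "f \<in> borel_measurable borel" for f
      proof (rule Bochner_Integration.integrable_bound[OF H])
        show "(\<lambda>k. cis (f k) * H k) \<in> borel_measurable lborel" unfolding cis_conv_exp by measurable
      qed (simp add: norm_mult)
      have i1: "integrable lborel (\<lambda>k. cis (k * (a + y * s t) - W k * t) * H k)"
        and i2: "integrable lborel (\<lambda>k. cis (k * a) * H k)" by (rule ci; measurable)+
      have "norm ((LINT k|lborel. cis (k * (a + y * s t) - W k * t) * H k) - (LINT k|lborel. cis (k * a) * H k)) =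
         norm (LINT k|lborel. cis (k * (a + y * s t) - W k * t) * H k - cis (k * a) * H k)"
        by (simp add: Bochner_Integration.integral_diff[OF i1 i2])
      also have "\<dots> \<le> (LINT k|lborel. norm (cis (k * (a + y * s t) - W k * t) * H k - cis (k * a) * H k))"
        by (rule integral_norm_bound)
      also have "\<dots> \<le> (LINT k|lborel. max 0 (D t k))"
      proof (rule integral_mono)
        show "integrable lborel (\<lambda>k. norm (cis (k * (a + y * s t) - W k * t) * H k - cis (k * a) * H k))"
          by (intro integrable_norm Bochner_Integration.integrable_diff i1 i2)
        show "integrable lborel (\<lambda>k. max 0 (D t k))"
        proof (rule Bochner_Integration.integrable_bound)
          show "integrable lborel (\<lambda>k. 2 * cmod (H k))" using H by simp
          have "D t k \<le> 2 * cmod (H k)" for k unfolding D_def by (intro mult_right_mono) auto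
          thus "AE k in lborel. norm (max 0 (D t k)) \<le> norm (2 * cmod (H k))" by (intro AE_I2) simp
        qed measurable
        fix k
        have "cmod (cis (k * (a + y * s t) - W k * t) - cis (k * a)) \<le> \<bar>(k * (a + y * s t) - W k * t) - k * a\<bar>"
          by (rule norm_cis_diff_le)
        also have "(k * (a + y * s t) - W k * t) - k * a = k * (y * s t) - W k * t" by (simp add: algebra_simps)
        also have "\<bar>\<dots>\<bar> \<le> \<bar>k\<bar> * (\<bar>y\<bar> * \<bar>s t\<bar>) + \<bar>W k\<bar> * \<bar>t\<bar>"
          by (rule order_trans[OF abs_triangle_ineq4]) (simp add: abs_mult)
        also have "\<dots> \<le> \<bar>k\<bar> * (X * \<bar>s t\<bar>) + \<bar>W k\<bar> * \<bar>t\<bar>"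
          using y by (intro add_right_mono mult_left_mono mult_right_mono) auto
        finally have "cmod (cis (k * (a + y * s t) - W k * t) - cis (k * a)) \<le> \<bar>k\<bar> * (X * \<bar>s t\<bar>) + \<bar>W k\<bar> * \<bar>t\<bar>" .
        moreover have "cmod (cis (k * (a + y * s t) - W k * t) - cis (k * a)) \<le> 2"
          by (rule order_trans[OF norm_triangle_ineq4]) simp
        ultimately have "cmod (cis (k * (a + y * s t) - W k * t) - cis (k * a)) * cmod (H k) \<le> D t k"
          unfolding D_def by (intro mult_right_mono) auto
        thus "norm (cis (k * (a + y * s t) - W k * t) * H k - cis (k * a) * H k) \<le> max 0 (D t k)"
          by (simp flip: left_diff_distrib add: norm_mult)
      qed
      finally show "norm ((LINT k|lborel. cis (k * (a + y * s t) - W k * t) * H k) - (LINT k|lborel. cis (k * a) * H k)) < e"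
        using elim by simp
    qed
  qed
qed

section \<open>The continuous representative of the solution\<close>

lemma osc_set_integral:
  fixes R d :: real and b :: "nat \<Rightarrow> real" and n :: nat
  assumes R: "1 \<le> R"
  defines "f \<equiv> (\<lambda>k. if 1 < \<bar>k\<bar> then cis (phase n d b k) / (\<i> * of_real k) else 0)"
  shows "set_integrable lborel {-R..R} f" "(LINT k:{-R..R}|lborel. f k) = osc n d b 1 R"
proof -
  define h where "h = (\<lambda>k. cis (phase n d b k) / (\<i> * of_real k))"
  have c1: "continuous_on {1..R} h" and c2: "continuous_on {-R..-1} h"
    unfolding h_def by (intro continuous_intros; auto)+
  have c3: "continuous_on {1..R} (\<lambda>x. h (- x))"
    unfolding h_def by (intro continuous_intros) auto
  note i1 = borel_integrable_atLeastAtMost'[OF c1] and i2 = borel_integrable_atLeastAtMost'[OF c2]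
  have iU: "set_integrable lborel ({1..R} \<union> {-R..-1}) h" by (intro set_integrable_Un i1 i2) auto
  have eq: "indicator {-R..R} x *\<^sub>R f x = indicator ({1..R} \<union> {-R..-1}) x *\<^sub>R h x" if "x \<notin> {-1, 1}" for x
    using that R by (auto simp: f_def h_def indicator_def abs_if)
  show "set_integrable lborel {-R..R} f"
    unfolding set_integrable_def
    by (subst integrable_discrete_difference[of "{-1, 1}" _ _ "\<lambda>x. indicator ({1..R} \<union> {-R..-1}) x *\<^sub>R h x"])
      (use eq iU in \<open>auto simp: set_integrable_def\<close>)
  have "(LINT k:{-R..R}|lborel. f k) = (LINT k:{1..R} \<union> {-R..-1}|lborel. h k)"
    unfolding set_lebesgue_integral_def
    by (rule integral_discrete_difference[of "{-1, 1}"]) (use eq in auto)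
  also have "\<dots> = (LINT k:{1..R}|lborel. h k) + (LINT k:{-R..-1}|lborel. h k)"
    by (rule set_integral_Un[OF _ i1 i2]) auto
  also have "(LINT k:{1..R}|lborel. h k) = integral {1..R} h" by (rule set_borel_integral_eq_integral(2)[OF i1])
  also have "(LINT k:{-R..-1}|lborel. h k) = integral {-R..-1} h" by (rule set_borel_integral_eq_integral(2)[OF i2])
  also have "integral {-R..-1} h = integral {1..R} (\<lambda>x. h (- x))"
    using Henstock_Kurzweil_Integration.integral_reflect_real[of R 1 "\<lambda>x. h (- x)"] by simp
  also have "integral {1..R} h + integral {1..R} (\<lambda>x. h (- x)) = integral {1..R} (\<lambda>x. h x + h (- x))"
    by (rule Henstock_Kurzweil_Integration.integral_add[symmetric]) (intro integrable_continuous_interval c1 c3)+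
  also have "\<dots> = osc n d b 1 R"
    unfolding osc_def by (rule Henstock_Kurzweil_Integration.integral_cong) (simp add: h_def diff_divide_distrib)
  finally show "(LINT k:{-R..R}|lborel. f k) = osc n d b 1 R" .
qed

lemma symmetric_integral_tendsto:
  fixes h :: "real \<Rightarrow> complex"
  assumes h: "integrable lborel h"
  shows "((\<lambda>R. LINT k:{-R..R}|lborel. h k) \<longlongrightarrow> (LINT k|lborel. h k)) at_top"
  unfolding set_lebesgue_integral_def
proof (rule integral_dominated_convergence_at_top)
  note [measurable] = borel_measurable_integrable[OF h]
  show "integrable lborel (\<lambda>k. cmod (h k))" using h by simp
  show "AE k in lborel. ((\<lambda>R. indicator {-R..R} k *\<^sub>R h k) \<longlongrightarrow> h k) at_top"
  proof (rule AE_I2, rule tendsto_eventually)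
    fix k :: real
    show "\<forall>\<^sub>F R in at_top. indicator {-R..R} k *\<^sub>R h k = h k"
      using eventually_ge_at_top[of "\<bar>k\<bar>"] by eventually_elim (auto simp: indicator_def)
  qed
  show "h \<in> borel_measurable lborel" by measurable
  show "(\<lambda>k. indicator {-R..R} k *\<^sub>R h k) \<in> borel_measurable lborel" for R by measurable
qed (auto intro!: always_eventually simp: indicator_def)

lemma integrable_cis_mult:
  assumes H: "integrable lborel H" and [measurable]: "f \<in> borel_measurable borel"
  shows "integrable lborel (\<lambda>k. cis (f k) * H k)"
proof (rule Bochner_Integration.integrable_bound[OF H])
  note [measurable] = borel_measurable_integrable[OF H]
  show "(\<lambda>k. cis (f k) * H k) \<in> borel_measurable lborel" unfolding cis_conv_exp by measurable
qed (simp add: norm_mult)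

lemma continuous_fourier_integral:
  assumes H: "integrable lborel H" and [measurable]: "W \<in> borel_measurable borel"
  shows "continuous_on UNIV (\<lambda>x. LINT k|lborel. cis (k * x - W k) * H k)"
proof -
  note [measurable] = borel_measurable_integrable[OF H]
  have "(\<lambda>m. LINT k|lborel. cis (k * X m - W k) * H k) \<longlonglongrightarrow> (LINT k|lborel. cis (k * x - W k) * H k)"
    if X: "X \<longlonglongrightarrow> x" for X x
  proof (rule integral_dominated_convergence)
    show "integrable lborel (\<lambda>k. cmod (H k))" using H by simp
    show "AE k in lborel. (\<lambda>m. cis (k * X m - W k) * H k) \<longlonglongrightarrow> cis (k * x - W k) * H k"
      unfolding cis_conv_exp by (intro AE_I2 tendsto_intros X)
    show "(\<lambda>k. cis (k * x - W k) * H k) \<in> borel_measurable lborel" unfolding cis_conv_exp by measurable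
    show "(\<lambda>k. cis (k * X m - W k) * H k) \<in> borel_measurable lborel" for m unfolding cis_conv_exp by measurable
  qed (simp add: norm_mult)
  thus ?thesis by (auto simp: continuous_on_sequentially o_def)
qed

lemma L2_limit_unique_AE:
  assumes U: "\<And>R. U R \<in> borel_measurable borel" and u: "u \<in> borel_measurable borel" and v: "v \<in> borel_measurable borel"
    and Lu: "L2_tendsto U u" and Lv: "L2_tendsto U v"
  shows "AE x in lborel. u x = v x"
proof -
  note [measurable] = U u v
  have "((\<lambda>R. 2 * l2sq (\<lambda>x. U R x - u x) + 2 * l2sq (\<lambda>x. U R x - v x)) \<longlongrightarrow> 2 * 0 + 2 * 0) at_top"
    using Lu Lv unfolding L2_tendsto_def l2sq_def[symmetric]
    by (intro tendsto_add ennreal_tendsto_cmult) auto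
  hence "((\<lambda>R. 2 * l2sq (\<lambda>x. U R x - u x) + 2 * l2sq (\<lambda>x. U R x - v x)) \<longlongrightarrow> 0) at_top" by simp
  moreover have "l2sq (\<lambda>x. u x - v x) \<le> 2 * l2sq (\<lambda>x. U R x - u x) + 2 * l2sq (\<lambda>x. U R x - v x)" for R
    using l2sq_triangle[of u "U R" v] by (simp add: l2sq_diff_commute[of u])
  ultimately have "l2sq (\<lambda>x. u x - v x) \<le> 0"
    by (intro tendsto_lowerbound[of _ _ at_top]) auto
  hence "AE x in lborel. u x - v x = 0" by (intro l2sq_eq_0) auto
  thus ?thesis by simp
qed

lemma continuous_AE_eq:
  fixes u v :: "real \<Rightarrow> complex"
  assumes u: "continuous_on UNIV u" and v: "continuous_on UNIV v" and ae: "AE x in lborel. u x = v x"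
  shows "u = v"
proof (rule ccontr)
  assume "u \<noteq> v"
  then obtain x where x: "u x \<noteq> v x" by auto
  have "open {x. u x \<noteq> v x}" by (rule open_Collect_neq[OF u v])
  then obtain e where e: "0 < e" "ball x e \<subseteq> {x. u x \<noteq> v x}" using x by (auto simp: open_contains_ball)
  have "AE y in lborel. y \<notin> {x - e<..<x + e}"
    using ae by eventually_elim (use e in \<open>auto simp: ball_eq_greaterThanLessThan\<close>)
  hence "emeasure lborel {x - e<..<x + e} = 0"
    by (subst (asm) AE_iff_measurable[of "{x - e<..<x + e}"]) auto
  thus False using e by simp
qed

context piecewise_H1
begin

text \<open>The truncated inverse transforms converge at every \<open>x\<close>: the integrable part
  by dominated convergence, the jump parts to \<open>osc_lim\<close>. The pointwise limit is also
  the L2 limit by \<open>trunc_fourier_L2_tendsto\<close>, and it is continuous. L2 limits agree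
  almost everywhere, and continuous functions that do so are equal; this is the uniqueness that
  \<open>THE\<close> demands.\<close>

lemma dispersive_solution_eq:
  fixes w :: "nat \<Rightarrow> real"
  assumes n: "2 \<le> n" and w: "w n \<noteq> 0" and t: "0 < t" and H: "integrable lborel H"
    and FH: "AE k in lborel. fourier_L2 q0 k = H k +
       (if 1 < \<bar>k\<bar> then \<Sum>j=1..N. jump q0 (node j) * exp (- (\<i> * of_real (k * node j))) / (\<i> * of_real k) else 0)"
  defines "W \<equiv> \<lambda>k. \<Sum>j=2..n. w j * k ^ j"
  shows "dispersive_solution W q0 t x = 1 / (2 * of_real pi) * ((LINT k|lborel. cis (k * x - W k * t) * H k) +
     (\<Sum>j=1..N. jump q0 (node j) * osc_lim n (x - node j) (\<lambda>i. w i * t) 1))"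
proof -
  define b where "b = (\<lambda>i. w i * t)"
  define V where "V = (\<lambda>x. (LINT k|lborel. cis (k * x - W k * t) * H k) +
     (\<Sum>j=1..N. jump q0 (node j) * osc_lim n (x - node j) b 1))"
  define u where "u = (\<lambda>x. 1 / (2 * of_real pi) * V x)"
  define Gt where "Gt = (\<lambda>k. exp (- \<i> * of_real (W k) * of_real t) * fourier_L2 q0 k)"
  have Wc: "continuous_on UNIV W" unfolding W_def by (intro continuous_intros)
  note [measurable] = borel_measurable_continuous_onI[OF Wc] borel_measurable_integrable[OF H]
  note F = fourier_L2[OF q0]
  have [measurable]: "fourier_L2 q0 \<in> borel_measurable borel" by (rule square_integrable_UNIV_D(1)[OF F(1)])
  have Gtm[measurable]: "Gt \<in> borel_measurable borel" unfolding Gt_def by measurable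
  have "cmod (Gt k) = cmod (fourier_L2 q0 k)" for k by (simp add: Gt_def norm_mult)
  hence "l2sq Gt = l2sq (fourier_L2 q0)" by (simp add: l2sq_def)
  hence Gt2: "square_integrable_on Gt UNIV"
    using square_integrable_UNIV_D(2)[OF F(1)] by (simp add: square_integrable_UNIV_iff)
  have bn: "b n \<noteq> 0" using w t by (simp add: b_def)
  have ph: "phase n (x - y) b k = (x - y) * k - W k * t" for x y k
    by (simp add: phase_def b_def W_def sum_distrib_left mult_ac)
  have cH: "integrable lborel (\<lambda>k. cis (k * x - W k * t) * H k)" for x
    by (rule integrable_cis_mult[OF H]) measurable
  define f where "f = (\<lambda>x j k. if 1 < \<bar>k\<bar> then cis (phase n (x - node j) b k) / (\<i> * of_real k) else 0)"
  have [measurable]: "f x j \<in> borel_measurable borel" for x j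
    unfolding f_def ph cis_conv_exp by measurable
  have trunc: "trunc_fourier 1 Gt R x = (LINT k:{-R..R}|lborel. cis (k * x - W k * t) * H k) +
      (\<Sum>j=1..N. jump q0 (node j) * osc n (x - node j) b 1 R)" if R: "1 \<le> R" for R x
  proof -
    have "trunc_fourier 1 Gt R x = (LINT k:{-R..R}|lborel. cis (k * x - W k * t) * H k + (\<Sum>j=1..N. jump q0 (node j) * f x j k))"
      unfolding trunc_fourier_def set_lebesgue_integral_def
    proof (rule integral_cong_AE)
      show "(\<lambda>k. indicator {-R..R} k *\<^sub>R (exp (\<i> * of_real (x * (1 * k))) * Gt k)) \<in> borel_measurable lborel" by measurable
      show "(\<lambda>k. indicator {-R..R} k *\<^sub>R (cis (k * x - W k * t) * H k + (\<Sum>j=1..N. jump q0 (node j) * f x j k))) \<in> borel_measurable lborel"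
        unfolding cis_conv_exp by measurable
      show "AE k in lborel. indicator {-R..R} k *\<^sub>R (exp (\<i> * of_real (x * (1 * k))) * Gt k) =
         indicator {-R..R} k *\<^sub>R (cis (k * x - W k * t) * H k + (\<Sum>j=1..N. jump q0 (node j) * f x j k))"
        using FH
      proof eventually_elim
        case (elim k)
        have e: "exp (\<i> * of_real (x * (1 * k))) * exp (- \<i> * of_real (W k) * of_real t) = cis (k * x - W k * t)"
          unfolding exp_add[symmetric] cis_conv_exp by (rule arg_cong[of _ _ exp]) (simp add: algebra_simps)
        have Ge: "exp (\<i> * of_real (x * (1 * k))) * Gt k = cis (k * x - W k * t) * fourier_L2 q0 k"
          using arg_cong[OF e, of "\<lambda>z. z * fourier_L2 q0 k"] by (simp only: Gt_def mult.assoc)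
        have js: "cis (k * x - W k * t) * (if 1 < \<bar>k\<bar> then \<Sum>j=1..N. jump q0 (node j) * exp (- (\<i> * of_real (k * node j))) / (\<i> * of_real k) else 0)
           = (\<Sum>j=1..N. jump q0 (node j) * f x j k)"
        proof (cases "1 < \<bar>k\<bar>")
          case True
          have "cis (k * x - W k * t) * exp (- (\<i> * of_real (k * node j))) = cis (phase n (x - node j) b k)" for j
            unfolding ph cis_conv_exp exp_add[symmetric] by (rule arg_cong[of _ _ exp]) (simp add: algebra_simps)
          hence "cis (k * x - W k * t) * (jump q0 (node j) * exp (- (\<i> * of_real (k * node j))) / (\<i> * of_real k)) =
              jump q0 (node j) * f x j k" for j
            using True by (simp add: f_def mult.left_commute)
          thus ?thesis using True by (simp add: sum_distrib_left)
        qed (simp add: f_def)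
        show ?case unfolding Ge elim distrib_left js ..
      qed
    qed
    also have "\<dots> = (LINT k:{-R..R}|lborel. cis (k * x - W k * t) * H k) + (LINT k:{-R..R}|lborel. \<Sum>j=1..N. jump q0 (node j) * f x j k)"
    proof (rule set_integral_add(2))
      show "set_integrable lborel {-R..R} (\<lambda>k. cis (k * x - W k * t) * H k)"
        unfolding set_integrable_def by (intro integrable_mult_indicator[OF _ cH]) simp
      have "set_integrable lborel {-R..R} (\<lambda>k. jump q0 (node j) * f x j k)" for j
        unfolding f_def by (intro set_integrable_mult_right osc_set_integral(1)[OF R])
      thus "set_integrable lborel {-R..R} (\<lambda>k. \<Sum>j=1..N. jump q0 (node j) * f x j k)"
        unfolding set_integrable_def scaleR_sum_right by (intro Bochner_Integration.integrable_sum)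
    qed
    also have "(LINT k:{-R..R}|lborel. \<Sum>j=1..N. jump q0 (node j) * f x j k) = (\<Sum>j=1..N. LINT k:{-R..R}|lborel. jump q0 (node j) * f x j k)"
    proof -
      have "set_integrable lborel {-R..R} (\<lambda>k. jump q0 (node j) * f x j k)" for j
        unfolding f_def by (intro set_integrable_mult_right osc_set_integral(1)[OF R])
      thus ?thesis
        unfolding set_integrable_def set_lebesgue_integral_def scaleR_sum_right by (intro Bochner_Integration.integral_sum)
    qed
    also have "\<dots> = (\<Sum>j=1..N. jump q0 (node j) * osc n (x - node j) b 1 R)"
      unfolding f_def by (simp only: set_integral_mult_right osc_set_integral(2)[OF R])
    finally show ?thesis .
  qed
  have osc: "(osc n d b 1 \<longlongrightarrow> osc_lim n d b 1) at_top" for d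
  proof -
    have "0 < root n \<bar>b n\<bar>" "\<bar>b n\<bar> = root n \<bar>b n\<bar> ^ n" using n bn by (auto simp: real_root_gt_zero)
    thus ?thesis using osc_lim_bound[OF n] zero_less_one by blast
  qed
  have lim: "((\<lambda>R. trunc_fourier 1 Gt R x) \<longlongrightarrow> V x) at_top" for x
  proof (rule Lim_transform_eventually)
    show "((\<lambda>R. (LINT k:{-R..R}|lborel. cis (k * x - W k * t) * H k) +
      (\<Sum>j=1..N. jump q0 (node j) * osc n (x - node j) b 1 R)) \<longlongrightarrow> V x) at_top"
      unfolding V_def by (intro tendsto_intros symmetric_integral_tendsto cH osc)
    show "\<forall>\<^sub>F R in at_top. (LINT k:{-R..R}|lborel. cis (k * x - W k * t) * H k) +
      (\<Sum>j=1..N. jump q0 (node j) * osc n (x - node j) b 1 R) = trunc_fourier 1 Gt R x"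
      using eventually_ge_at_top[of 1] by eventually_elim (simp add: trunc)
  qed
  have Vc: "continuous_on UNIV V"
    unfolding V_def
  proof (intro continuous_intros)
    show "continuous_on UNIV (\<lambda>x. LINT k|lborel. cis (k * x - W k * t) * H k)"
      by (rule continuous_fourier_integral[OF H]) measurable
    show "continuous_on UNIV (\<lambda>x. osc_lim n (x - node j) b 1)" for j
      by (rule continuous_on_compose2[OF continuous_osc_lim[of n b 1, OF n bn zero_less_one]]) (auto intro!: continuous_intros)
  qed
  have [measurable]: "V \<in> borel_measurable borel" by (rule borel_measurable_continuous_onI[OF Vc])
  have V2: "square_integrable_on V UNIV \<and> L2_tendsto (trunc_fourier 1 Gt) V"
  proof (rule trunc_fourier_L2_tendsto[OF Gt2 _ filterlim_real_sequentially])
    show "AE x in lborel. (\<lambda>m. trunc_fourier 1 Gt (real m) x) \<longlonglongrightarrow> V x"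
      by (intro AE_I2 filterlim_compose[OF lim filterlim_real_sequentially])
  qed auto
  define \<gamma> where "\<gamma> = (1 / (2 * of_real pi) :: complex)"
  have uc: "continuous_on UNIV u" unfolding u_def by (intro continuous_intros Vc)
  have um[measurable]: "u \<in> borel_measurable borel" by (rule borel_measurable_continuous_onI[OF uc])
  have Lu: "L2_tendsto (\<lambda>R x. \<gamma> * trunc_fourier 1 Gt R x) u"
  proof -
    have "((\<lambda>R. ennreal ((cmod \<gamma>)\<^sup>2) * l2sq (\<lambda>x. trunc_fourier 1 Gt R x - V x)) \<longlongrightarrow> ennreal ((cmod \<gamma>)\<^sup>2) * 0) at_top"
      using V2 unfolding L2_tendsto_def l2sq_def[symmetric] by (intro ennreal_tendsto_cmult) auto
    moreover have "ennreal ((cmod \<gamma>)\<^sup>2) * l2sq (\<lambda>x. trunc_fourier 1 Gt R x - V x) = l2sq (\<lambda>x. \<gamma> * trunc_fourier 1 Gt R x - u x)" for R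
      by (subst l2sq_cmult[symmetric]) (simp_all add: u_def \<gamma>_def right_diff_distrib)
    ultimately show ?thesis by (simp add: L2_tendsto_def l2sq_def[symmetric])
  qed
  have "l2sq u = ennreal ((cmod \<gamma>)\<^sup>2) * l2sq V"
    unfolding u_def \<gamma>_def by (rule l2sq_cmult) measurable
  hence u2: "square_integrable_on u UNIV"
    using V2 by (simp add: square_integrable_UNIV_iff ennreal_mult_less_top)
  have "dispersive_solution W q0 t = u"
    unfolding dispersive_solution_def Gt_def[symmetric] is_inverse_fourier_L2_iff \<gamma>_def[symmetric]
  proof (rule the_equality)
    show "continuous_on UNIV u \<and> square_integrable_on u UNIV \<and> L2_tendsto (\<lambda>R x. \<gamma> * trunc_fourier 1 Gt R x) u"
      using uc u2 Lu by blast
    fix v assume v: "continuous_on UNIV v \<and> square_integrable_on v UNIV \<and> L2_tendsto (\<lambda>R x. \<gamma> * trunc_fourier 1 Gt R x) v"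
    have "AE x in lborel. v x = u x"
      by (rule L2_limit_unique_AE[of "\<lambda>R x. \<gamma> * trunc_fourier 1 Gt R x"])
        (use v Lu um in \<open>auto intro!: borel_measurable_continuous_onI borel_measurable_times\<close>)
    thus "v = u" using v uc by (intro continuous_AE_eq) auto
  qed
  thus ?thesis by (simp add: u_def V_def b_def)
qed

end

section \<open>The limit at a jump, assembled from the integrable part and the jump terms\<close>

theorem mainTheorem4:
  fixes n N i :: nat and \<omega> :: "nat \<Rightarrow> real" and q0 :: "real \<Rightarrow> complex"
    and c :: "nat \<Rightarrow> ereal" and r :: real
  assumes "n \<ge> 2" and "\<omega> n \<noteq> 0"
    and "square_integrable_on q0 UNIV"
    and "c 0 = -\<infinity>" and "c (Suc N) = \<infinity>" and "strict_mono_on {0..Suc N} c"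
    and "\<And>j. j \<le> N \<Longrightarrow> has_L2_derivative_on q0 (einterval (c j) (c (Suc j)))"
    and "1 \<le> i" and "i \<le> N" and "jump q0 (real_of_ereal (c i)) \<noteq> 0"
    and "0 < r" and "r < 1"
  shows "let q = (\<lambda>x t. dispersive_solution (\<lambda>k. \<Sum>j=2..n. \<omega> j * k ^ j) q0 t x);
             ci = real_of_ereal (c i);
             p = monom (exp (\<i> * of_real (Arg (of_real (\<omega> n))))) n
         in \<exists>qc :: complex. \<forall>X :: real set. bounded X \<longrightarrow>
              uniform_limit X
                (\<lambda>t x. (q (ci + x * root n \<bar>\<omega> n * t\<bar>) t - qc) / jump q0 ci)
                (\<lambda>x. I_zero r p x 1) (at_right 0)"
proof -
  interpret piecewise_H1 q0 c N by unfold_locales (use assms in auto)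
  define S where "S = (\<lambda>t. root n \<bar>\<omega> n * t\<bar>)"
  define W where "W = (\<lambda>k. \<Sum>j=2..n. \<omega> j * k ^ j)"
  define J where "J = (\<lambda>j. jump q0 (node j))"
  define b where "b = (\<lambda>j. if j = n then sgn (\<omega> n) else 0)"
  define p where "p = monom (exp (\<i> * of_real (Arg (of_real (\<omega> n))))) n"
  have p: "p = monom (of_real (sgn (\<omega> n))) n" unfolding p_def exp_Arg_of_real[OF assms(2)] ..
  have Ji: "J i \<noteq> 0" using assms by (simp add: J_def node_def)
  obtain H where H: "integrable lborel H"
    and FH: "AE k in lborel. fourier_L2 q0 k = H k +
       (if 1 < \<bar>k\<bar> then \<Sum>j=1..N. jump q0 (node j) * exp (- (\<i> * of_real (k * node j))) / (\<i> * of_real k) else 0)"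
    by (rule fourier_remainder_integrable)
  define A where "A = (\<lambda>x t. LINT k|lborel. cis (k * x - W k * t) * H k)"
  define A0 where "A0 = (LINT k|lborel. cis (k * node i) * H k)"
  define O1 where "O1 = (\<lambda>y t j. osc_lim n (node i + y * S t - node j) (\<lambda>l. \<omega> l * t) 1)"
  define O0 where "O0 = (\<lambda>j. osc_lim n (node i - node j) (\<lambda>_. 0) 1)"
  define L where "L = {1..N} - {i}"
  have L: "finite L" "i \<notin> L" "{1..N} = insert i L" using assms by (auto simp: L_def)
  \<comment> \<open>\<open>A0\<close> and \<open>O0 j\<close> are the values at
    \<open>x = node i\<close>, \<open>t = 0\<close> of the parts that stay continuous there. As
    \<open>osc_lim\<close> is close to \<open>2 * pi * I_zero + pi\<close>, the half residue leaves
    \<open>J i * pi / (2 * pi) = J i / 2\<close>.\<close>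
  define qc where "qc = 1 / (2 * of_real pi) * (A0 + (\<Sum>j\<in>L. J j * O0 j)) + J i / 2"
  define q where "q = (\<lambda>x t. dispersive_solution W q0 t x)"
  have q: "q (node i + y * S t) t = 1 / (2 * of_real pi) * (A (node i + y * S t) t + J i * O1 y t i + (\<Sum>j\<in>L. J j * O1 y t j))"
    if "0 < t" for y t
    using dispersive_solution_eq[where n = n and w = \<omega> and t = t and H = H and x = "node i + y * S t", OF assms(1,2) that H FH] L
    by (simp add: q_def W_def A_def O1_def J_def add.assoc)
  have "uniform_limit X (\<lambda>t y. (q (node i + y * S t) t - qc) / J i) (\<lambda>y. I_zero r p y 1) (at_right 0)"
    if "bounded X" for X
    unfolding uniform_limit_iff
  proof (intro allI impI)
    fix e :: real assume e: "0 < e"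
    obtain B where B: "\<And>y. y \<in> X \<Longrightarrow> \<bar>y\<bar> \<le> B" using \<open>bounded X\<close> by (auto simp: bounded_iff)
    \<comment> \<open>The first two errors will be divided by \<open>J i\<close>, hence this
      tolerance. In \<open>T\<close> the added 1 prevents division by zero when there is no other
      jump.\<close>
    define e1 where "e1 = cmod (J i) * e"
    define T where "T = (\<Sum>j\<in>L. cmod (J j)) + 1"
    have T: "1 \<le> T" by (simp add: T_def sum_nonneg)
    have e1: "0 < e1" using Ji e by (simp add: e1_def)
    have Slim: "(S \<longlongrightarrow> 0) (at_right 0)" unfolding S_def by (rule scale_tendsto_0)
    have Wc: "continuous_on UNIV W" unfolding W_def by (intro continuous_intros)
    have evA: "\<forall>\<^sub>F t in at_right 0. \<forall>y. \<bar>y\<bar> \<le> B \<longrightarrow> norm (A (node i + y * S t) t - A0) < e1"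
      unfolding A_def A0_def by (rule integrable_phase_perturbation[OF H e1 Slim Wc])
    have evO: "\<forall>\<^sub>F t in at_right 0. \<forall>j\<in>L. \<forall>y. \<bar>y\<bar> \<le> B \<longrightarrow> norm (O1 y t j - O0 j) < e1 / T"
    proof (rule eventually_ball_finite[OF L(1)], rule ballI)
      fix j assume "j \<in> L"
      hence "node i - node j \<noteq> 0" using node_inj[of i j] assms by (auto simp: L_def)
      from osc_lim_off_jump[where n = n and w = \<omega> and e = "e1 / T" and X = B, OF assms(1,2) this]
      show "\<forall>\<^sub>F t in at_right 0. \<forall>y. \<bar>y\<bar> \<le> B \<longrightarrow> norm (O1 y t j - O0 j) < e1 / T"
        using e1 T by (simp add: O1_def O0_def S_def add_diff_eq diff_add_eq)
    qed
    have evi: "\<forall>\<^sub>F t in at_right 0. \<forall>y. norm (O1 y t i - osc_lim n y b (S t)) < e"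
      using osc_lim_rescaled[where n = n and w = \<omega>, OF assms(1,2) e] by (simp add: O1_def S_def b_def)
    have "((\<lambda>t. 2 * S t * (B + 1)) \<longlongrightarrow> 2 * 0 * (B + 1)) (at_right 0)" by (intro tendsto_intros Slim)
    hence evS: "\<forall>\<^sub>F t in at_right 0. 2 * S t * (B + 1) < e" using e by (intro order_tendstoD) auto
    have evS1: "\<forall>\<^sub>F t in at_right 0. S t < 1" using Slim by (rule order_tendstoD) simp
    show "\<forall>\<^sub>F t in at_right 0. \<forall>y\<in>X. dist ((q (node i + y * S t) t - qc) / J i) (I_zero r p y 1) < e"
      using evA evO evi evS evS1 eventually_at_right_less[of 0]
    proof eventually_elim
      case (elim t)
      show ?case
      proof
        fix y assume "y \<in> X"
        hence y: "\<bar>y\<bar> \<le> B" by (rule B)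
        have st: "0 < S t" using elim(6) assms by (simp add: S_def real_root_gt_zero)
        define a where "a = A (node i + y * S t) t - A0"
        define o1 where "o1 = (\<Sum>j\<in>L. J j * (O1 y t j - O0 j))"
        define o2 where "o2 = O1 y t i - osc_lim n y b (S t)"
        define o3 where "o3 = 2 * of_real pi * I_zero r p y 1 + of_real pi - osc_lim n y b (S t)"
        have na: "norm a < e1" using elim(1) y by (simp add: a_def)
        have no1: "norm o1 \<le> e1"
        proof -
          have "norm o1 \<le> (\<Sum>j\<in>L. cmod (J j) * (e1 / T))"
            unfolding o1_def
          proof (rule sum_norm_le)
            fix j assume "j \<in> L"
            hence "norm (O1 y t j - O0 j) \<le> e1 / T" using elim(2) y by (simp add: less_imp_le)
            thus "norm (J j * (O1 y t j - O0 j)) \<le> cmod (J j) * (e1 / T)"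
              unfolding norm_mult by (intro mult_left_mono) auto
          qed
          also have "\<dots> = (T - 1) * (e1 / T)"
            by (simp only: T_def sum_distrib_right add_diff_cancel_right')
          also have "\<dots> \<le> T * (e1 / T)" using e1 T by (intro mult_right_mono) auto
          finally show ?thesis using T by simp
        qed
        have no2: "norm o2 < e" using elim(3) by (simp add: o2_def)
        have "norm o3 \<le> 2 * S t * (\<bar>y\<bar> + 1)"
          unfolding o3_def p b_def
          by (rule I_zero_eq_osc_lim) (use assms st elim(5) in \<open>auto simp: abs_sgn_eq\<close>)
        also have "\<dots> \<le> 2 * S t * (B + 1)" using y st by (intro mult_left_mono) auto
        finally have no3: "norm o3 < e" using elim(4) by simp
        \<comment> \<open>The four errors \<open>a\<close>, \<open>o1\<close>, \<open>o2\<close>,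
          \<open>o3\<close> contribute less than \<open>4 * e\<close> to \<open>2 * pi\<close> times
          the distance to \<open>I_zero\<close>, and \<open>4 < 2 * pi\<close> absorbs the
          constant.\<close>
        have "2 * of_real pi * (q (node i + y * S t) t - qc) = a + o1 + J i * (O1 y t i - of_real pi)"
          unfolding q[OF elim(6)] qc_def a_def o1_def
          by (simp add: field_simps sum_subtractf)
        hence "2 * of_real pi * ((q (node i + y * S t) t - qc) / J i) = (a + o1) / J i + (O1 y t i - of_real pi)"
          using Ji by (simp add: field_simps)
        hence "2 * of_real pi * ((q (node i + y * S t) t - qc) / J i - I_zero r p y 1) = (a + o1) / J i + (o2 - o3)"
          by (simp add: o2_def o3_def algebra_simps)
        hence "norm (2 * of_real pi * ((q (node i + y * S t) t - qc) / J i - I_zero r p y 1)) = norm ((a + o1) / J i + (o2 - o3))"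
          by (rule arg_cong)
        hence "2 * pi * norm ((q (node i + y * S t) t - qc) / J i - I_zero r p y 1) = norm ((a + o1) / J i + (o2 - o3))"
          by (simp add: norm_mult)
        also have "\<dots> \<le> norm ((a + o1) / J i) + (norm o2 + norm o3)"
          by (intro norm_triangle_le add_left_mono norm_triangle_ineq4)
        also have "norm ((a + o1) / J i) \<le> 2 * e"
        proof -
          have "norm (a + o1) \<le> 2 * e1" using norm_triangle_ineq[of a o1] na no1 by linarith
          thus ?thesis using Ji by (simp add: norm_divide e1_def field_simps)
        qed
        finally have "2 * pi * norm ((q (node i + y * S t) t - qc) / J i - I_zero r p y 1) < 4 * e"
          using no2 no3 by linarith
        also have "4 * e \<le> 2 * pi * e" using e pi_gt3 by (intro mult_right_mono) auto
        finally show "dist ((q (node i + y * S t) t - qc) / J i) (I_zero r p y 1) < e"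
          by (simp add: dist_norm)
      qed
    qed
  qed
  thus ?thesis
    unfolding Let_def q_def S_def W_def p_def J_def node_def by blast
qed

end
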